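(* Let $X,X_1,X_2,\ldots$ be i.i.d. random points in $\mathbb{R}^d$ whose common distribution $\mu$ has a density $f$ with respect to Lebesgue measure. Suppose that the support of $\mu$ is $[0,1]^d$ and that there are constants $f_-,f_+\in(0,\infty)$ such that $f_-\le f(x)\le f_+$ for all $x\in[0,1]^d$. Fix an integer $k\ge1$ and $t\in\mathbb{R}$, and let $Z$ be a Poisson random variable with parameter $e^{-t}$. Then, as $n\to\infty$, $$d_{TV}(C_{n,k},Z)=O\left(\frac{\log\log n}{\log n}\right).$$
   Context: $\|\cdot\|$ is the Euclidean norm on $\mathbb{R}^d$ and $B(x,r)=\{y\in\mathbb{R}^d:\|x-y\|\le r\}$. For $k\le n-1$ and $i\in\{1,\ldots,n\}$, $R_{i,n,k}$ denotes the Euclidean distance of $X_i$ to its $k$th-nearest neighbor among $\{X_1,\ldots,X_n\}\setminus\{X_i\}$. Put $$v_{n,k}=v_{n,k}(t)=\frac{t+\log n+(k-1)\log\log n-\log (k-1)!}{n},\qquad C_{n,k}=\sum_{i=1}^n \mathbf{1}\{\mu(B(X_i,R_{i,n,k}))>v_{n,k}\}.$$ Here $\mathbf{1}\{A\}$ is the indicator of $A$. For integer-valued random variables $Y,Z$, $d_{TV}(Y,Z)=2\sup_{A\subset\mathbb{N}}|\mathbb{P}(Y\in A)-\mathbb{P}(Z\in A)|$, where $\mathbb{N}$ includes $0$. The notation $a_n=O(b_n)$ means $|a_n|\le C|b_n|$ for some positive constant $C$ not depending on $n$ (for all sufficiently large $n$). *)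

theory Defs
  imports "HOL-Probability.Probability" "HOL-Library.Landau_Symbols"
begin

definition msupport :: "'a::topological_space measure \<Rightarrow> 'a set" where
  "msupport \<mu> = {x. \<forall>U. open U \<and> x \<in> U \<longrightarrow> emeasure \<mu> U > 0}"

(* The k-th smallest of the n - 1 distances from x i to the points x j with j in {1..n} - {i}.
   Neighbours are counted with multiplicity, by their indices; the value is
   meaningful for 1 <= k <= n - 1 and i in {1..n}. *)
definition nn_dist :: "(nat \<Rightarrow> 'a::metric_space) \<Rightarrow> nat \<Rightarrow> nat \<Rightarrow> nat \<Rightarrow> real" where
  "nn_dist x i n k = sort (map (\<lambda>j. dist (x i) (x j)) (filter (\<lambda>j. j \<noteq> i) [1..<n+1])) ! (k - 1)"

definition v_thr :: "real \<Rightarrow> nat \<Rightarrow> nat \<Rightarrow> real" where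
  "v_thr t n k =
     (t + ln (real n) + (real k - 1) * ln (ln (real n)) - ln (fact (k - 1))) / real n"

definition C_count :: "'a::metric_space measure \<Rightarrow> real \<Rightarrow> (nat \<Rightarrow> 'a) \<Rightarrow> nat \<Rightarrow> nat \<Rightarrow> nat" where
  "C_count \<mu> t x n k =
     (\<Sum>i=1..n. of_bool (measure \<mu> (cball (x i) (nn_dist x i n k)) > v_thr t n k))"

(* Total variation distance with the normalising factor 2, for random variables that
   may live on different probability spaces M and N. *)
definition dTV :: "'a measure \<Rightarrow> ('a \<Rightarrow> nat) \<Rightarrow> 'b measure \<Rightarrow> ('b \<Rightarrow> nat) \<Rightarrow> real" where
  "dTV M Y N Z =
     2 * (SUP A. \<bar>measure M {\<omega> \<in> space M. Y \<omega> \<in> A} - measure N {\<omega> \<in> space N. Z \<omega> \<in> A}\<bar>)"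

end

theory Submission
  imports Defs "HOL-Real_Asymp.Real_Asymp"
begin

text \<open>
  Let \<open>E x\<close> be the ball around \<open>x\<close> of \<open>\<mu>\<close>-mass exactly \<open>v = v_thr t n k\<close>. The \<open>k\<close>th-nearest-neighbour ball of
  \<open>X\<^sub>i\<close> has mass larger than \<open>v\<close> iff fewer than \<open>k\<close> of the other points lie in \<open>E X\<^sub>i\<close>, so \<open>C_count\<close> counts the
  points whose ball is nearly empty. Up to a negligible boundary layer this count \<open>W\<close> is compared with the
  Poisson law by Stein's method, which requires \<open>\<bbbE>[I\<^sub>i g(W)] \<approx> \<bbbP>(I\<^sub>i = 1) \<bbbE>[g(W + 1)]\<close> for bounded \<open>g\<close>.
  On \<open>I\<^sub>i = 1\<close> there is, up to probability \<open>O(ln ln n / (n ln n))\<close>, no second point counted by \<open>W\<close> near \<open>X\<^sub>i\<close>,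
  since \<open>E y - E x\<close> contains a ball of radius of order \<open>min (dist x y) (radius of E x)\<close>. The contribution
  of the points far from \<open>X\<^sub>i\<close> does not see the points inside \<open>E X\<^sub>i\<close>; conditionally on how many points lie
  there, the others are i.i.d. from \<open>\<mu>\<close> restricted to the complement, and the deletion of a few of them
  hardly changes the count. The remaining error is that of the mean \<open>n \<bbbP>(I\<^sub>1 = 1)\<close>, which also
  is \<open>O(ln ln n / ln n)\<close> because \<open>(n v / ln n)^(k - 1) = 1 + O(ln ln n / ln n)\<close>.
\<close>

subsection \<open>Counting points of an i.i.d. sample\<close>

text \<open>The rate is set by pairs of counted points close to each other. If
  \<open>X\<^sub>j\<close> lies in \<open>E X\<^sub>i\<close>, it takes one of the k - 1 places
  allowed there, which lowers the probability by a factor of order 1 / ln n; if it lies outside,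
  \<open>E X\<^sub>j - E X\<^sub>i\<close> has mass of order v and must hold fewer than k points,
  which costs a power of n. In the first case there remain points so close to
  \<open>X\<^sub>i\<close> that the difference of the balls has no useful mass. They are cut off at
  mass of order ln ln n / n: beyond the cutoff the difference supplies another factor 1 / ln n,
  below it the expected number of points is O(ln ln n), whence the rate. The implied constant may
  depend on t and k, so the crude bound \<open>exp l\<close> on the Stein solution suffices. The
  boundary layer has width 1 / ln n: its mass is within the rate, and it is far wider than the
  balls, whose radii have order (ln n / n)^(1/d).\<close>

definition cnt :: "'i set \<Rightarrow> ('i \<Rightarrow> 'a) \<Rightarrow> 'a set \<Rightarrow> nat" where
  "cnt S X B = card {l \<in> S. X l \<in> B}"

text \<open>Conditioning uses this random set and not merely its size: given the set, the
  coordinates stay independent, each conditioned on \<open>E\<close> or on its complement.\<close>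

definition outside_idx :: "'i set \<Rightarrow> 'a set \<Rightarrow> ('i \<Rightarrow> 'a) \<Rightarrow> 'i set" where
  "outside_idx J E X = {j \<in> J. X j \<notin> E}"

text \<open>The probability that a binomial variable with \<open>m\<close> trials and success
  probability \<open>w\<close> is strictly less than \<open>k\<close>; at \<open>k = 0\<close> it is
  0.\<close>

definition binom_cdf :: "nat \<Rightarrow> real \<Rightarrow> nat \<Rightarrow> real" where
  "binom_cdf m w k = (\<Sum>a<k. real (m choose a) * w ^ a * (1 - w) ^ (m - a))"

lemma outside_subset: "outside_idx J E X \<subseteq> J"
  by (auto simp: outside_idx_def)

lemma cnt_eq_card_outside:
  assumes "finite J"
  shows "cnt J X E = card (J - outside_idx J E X)"
  unfolding cnt_def outside_idx_def by (rule arg_cong[where f = card]) auto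

lemma cnt_mono:
  assumes "finite T" "S \<subseteq> T" "A \<subseteq> B"
  shows "cnt S X A \<le> cnt T X B"
  unfolding cnt_def using assms by (intro card_mono) auto

lemma cnt_cong: "(\<And>l. l \<in> S \<Longrightarrow> X l = Y l) \<Longrightarrow> cnt S X B = cnt S Y B"
  unfolding cnt_def by (rule arg_cong[where f = card]) auto

lemma cnt_insert:
  assumes "finite S" "i \<notin> S"
  shows "cnt (insert i S) X B = cnt S X B + of_bool (X i \<in> B)"
proof -
  have "{l \<in> insert i S. X l \<in> B} = (if X i \<in> B then insert i {l \<in> S. X l \<in> B} else {l \<in> S. X l \<in> B})"
    by auto
  thus ?thesis using assms by (auto simp: cnt_def)
qed

lemma measurable_card_pred:
  assumes "finite S" "\<And>l. l \<in> S \<Longrightarrow> Measurable.pred N (P l)"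
  shows "(\<lambda>x. card {l \<in> S. P l x}) \<in> measurable N (count_space UNIV)"
  using assms
proof (induction S rule: finite_induct)
  case (insert a F)
  have eq: "card {l \<in> insert a F. P l x} = (if P a x then Suc (card {l \<in> F. P l x}) else card {l \<in> F. P l x})" for x
  proof -
    have "{l \<in> insert a F. P l x} = (if P a x then insert a {l \<in> F. P l x} else {l \<in> F. P l x})"
      by auto
    thus ?thesis using insert.hyps by auto
  qed
  have [measurable]: "Measurable.pred N (P a)" "(\<lambda>x. card {l \<in> F. P l x}) \<in> measurable N (count_space UNIV)"
    using insert by auto
  show ?case unfolding eq by measurable
qed simp

section \<open>Conditioning a product measure on the indices that fall into a set\<close>

lemma product_prob_space_const: "prob_space M \<Longrightarrow> product_prob_space (\<lambda>_. M)"
  by (simp add: product_prob_space_def product_prob_space_axioms_def product_sigma_finite_def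
      prob_space_imp_sigma_finite)

lemma prob_space_PiM_const: "prob_space M \<Longrightarrow> prob_space (PiM J (\<lambda>_. M))"
  by (intro prob_space_PiM)

text \<open>Both sides agree on boxes, since a ratio of products of masses is the product of the
  ratios. Conditioning on a box thus becomes a coordinatewise operation.\<close>

lemma uniform_measure_PiM:
  assumes M: "prob_space M" and I: "finite I"
    and A: "\<And>i. A i \<in> sets M" "\<And>i. emeasure M (A i) \<noteq> 0"
  shows "uniform_measure (PiM I (\<lambda>_. M)) (Pi\<^sub>E I A) = PiM I (\<lambda>i. uniform_measure M (A i))"
proof -
  interpret M: prob_space M by fact
  interpret P: product_prob_space "\<lambda>_. M" I using M by (rule product_prob_space_const)
  have ps: "prob_space (uniform_measure M (A i))" for i
    using A by (intro prob_space_uniform_measure) (auto simp: M.emeasure_eq_measure)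
  interpret Q: product_sigma_finite "\<lambda>i. uniform_measure M (A i)"
    using ps by (simp add: product_sigma_finite_def prob_space_imp_sigma_finite)
  show ?thesis
  proof (rule Q.PiM_eqI)
    fix B assume B: "\<And>i. i \<in> I \<Longrightarrow> B i \<in> sets (uniform_measure M (A i))"
    have "emeasure (uniform_measure (PiM I (\<lambda>_. M)) (Pi\<^sub>E I A)) (Pi\<^sub>E I B)
        = emeasure (PiM I (\<lambda>_. M)) (Pi\<^sub>E I (\<lambda>i. A i \<inter> B i)) / emeasure (PiM I (\<lambda>_. M)) (Pi\<^sub>E I A)"
      using I A B by (subst emeasure_uniform_measure) (auto intro!: sets_PiM_I_finite simp: PiE_Int)
    also have "\<dots> = (\<Prod>i\<in>I. emeasure M (A i \<inter> B i)) / (\<Prod>i\<in>I. emeasure M (A i))"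
      using I A B by (subst (1 2) P.emeasure_PiM) auto
    also have "\<dots> = (\<Prod>i\<in>I. emeasure M (A i \<inter> B i) / emeasure M (A i))"
    proof -
      have pos: "measure M (A i) > 0" for i
        using A[of i] by (simp add: M.emeasure_eq_measure zero_less_measure_iff)
      show ?thesis
        unfolding M.emeasure_eq_measure
        by (subst (1 2) prod_ennreal) (auto simp: divide_ennreal pos prod_nonneg prod_pos prod_ennreal
             prod_dividef intro!: prod_pos)
    qed
    also have "\<dots> = (\<Prod>i\<in>I. emeasure (uniform_measure M (A i)) (B i))"
      using A B by (intro prod.cong) auto
    finally show "emeasure (uniform_measure (PiM I (\<lambda>_. M)) (Pi\<^sub>E I A)) (Pi\<^sub>E I B)
       = (\<Prod>i\<in>I. emeasure (uniform_measure M (A i)) (B i))" .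
  qed (use I in \<open>auto intro!: sets_PiM_cong\<close>)
qed

text \<open>Each index is asked separately to lie inside or outside \<open>E\<close>, so fixing the
  set of outside indices describes a box, to which \<open>uniform_measure_PiM\<close>
  applies.\<close>

lemma outside_box:
  assumes "E \<in> sets M" "S \<subseteq> J"
  shows "{X \<in> space (PiM J (\<lambda>_. M)). outside_idx J E X = S}
    = Pi\<^sub>E J (\<lambda>j. if j \<in> S then space M - E else E)"
proof -
  have sub: "E \<subseteq> space M" using assms(1) by (rule sets.sets_into_space)
  show ?thesis
  proof (intro set_eqI iffI)
    fix X assume "X \<in> {X \<in> space (PiM J (\<lambda>_. M)). outside_idx J E X = S}"
    thus "X \<in> Pi\<^sub>E J (\<lambda>j. if j \<in> S then space M - E else E)"
      by (fastforce simp: outside_idx_def space_PiM PiE_iff extensional_def)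
  next
    fix X assume X: "X \<in> Pi\<^sub>E J (\<lambda>j. if j \<in> S then space M - E else E)"
    hence "X j \<in> (if j \<in> S then space M - E else E)" if "j \<in> J" for j
      using that by (auto simp: PiE_iff)
    moreover have "X \<in> extensional J" using X by (auto simp: PiE_iff)
    ultimately show "X \<in> {X \<in> space (PiM J (\<lambda>_. M)). outside_idx J E X = S}"
      using sub assms(2) by (fastforce simp: outside_idx_def space_PiM PiE_iff split: if_splits)
  qed
qed

definition pattern_weight :: "'i set \<Rightarrow> real \<Rightarrow> 'i set \<Rightarrow> real" where
  "pattern_weight J v S = v ^ card (J - S) * (1 - v) ^ card S"

lemma measure_outside:
  assumes M: "prob_space M" and J: "finite J" and E: "E \<in> sets M" and S: "S \<subseteq> J"
  shows "\<P>(X in PiM J (\<lambda>_. M). outside_idx J E X = S)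
    = pattern_weight J (measure M E) S"
proof -
  interpret M: prob_space M by fact
  interpret P: product_prob_space "\<lambda>_. M" J using M by (rule product_prob_space_const)
  have "emeasure (PiM J (\<lambda>_. M)) {X \<in> space (PiM J (\<lambda>_. M)). outside_idx J E X = S}
     = (\<Prod>j\<in>J. emeasure M (if j \<in> S then space M - E else E))"
    unfolding outside_box[OF E S] using J E by (subst P.emeasure_PiM) auto
  also have "\<dots> = (\<Prod>j\<in>J. ennreal (if j \<in> S then 1 - measure M E else measure M E))"
    using E by (intro prod.cong) (auto simp: M.emeasure_eq_measure M.prob_compl)
  also have "\<dots> = ennreal (\<Prod>j\<in>J. if j \<in> S then 1 - measure M E else measure M E)"
    by (rule prod_ennreal) auto
  also have "(\<Prod>j\<in>J. if j \<in> S then 1 - measure M E else measure M E)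
      = pattern_weight J (measure M E) S"
    using J S by (simp add: prod.If_cases pattern_weight_def Int_absorb1 mult.commute Diff_eq)
  finally show ?thesis
    by (simp add: P.P.emeasure_eq_measure pattern_weight_def M.prob_le_1)
qed

lemma measurable_outside [measurable]:
  assumes "E \<in> sets M" "finite J"
  shows "outside_idx J E \<in> measurable (PiM J (\<lambda>_. M)) (count_space (Pow J))"
proof (subst measurable_count_space_eq2)
  show "outside_idx J E \<in> space (Pi\<^sub>M J (\<lambda>_. M)) \<rightarrow> Pow J \<and>
    (\<forall>a\<in>Pow J. outside_idx J E -` {a} \<inter> space (Pi\<^sub>M J (\<lambda>_. M)) \<in> sets (Pi\<^sub>M J (\<lambda>_. M)))"
  proof (intro conjI ballI)
    fix a assume a: "a \<in> Pow J"
    have "outside_idx J E -` {a} \<inter> space (Pi\<^sub>M J (\<lambda>_. M)) = {X \<in> space (PiM J (\<lambda>_. M)). outside_idx J E X = a}"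
      by auto
    also have "\<dots> = Pi\<^sub>E J (\<lambda>j. if j \<in> a then space M - E else E)"
      by (rule outside_box) (use assms a in auto)
    also have "\<dots> \<in> sets (Pi\<^sub>M J (\<lambda>_. M))"
      using assms by (intro sets_PiM_I_finite) auto
    finally show "outside_idx J E -` {a} \<inter> space (Pi\<^sub>M J (\<lambda>_. M)) \<in> sets (Pi\<^sub>M J (\<lambda>_. M))" .
  qed (auto simp: outside_idx_def)
qed (use assms in auto)

lemma integral_PiM_restrict:
  fixes h :: "('i \<Rightarrow> 'a) \<Rightarrow> real"
  assumes M: "\<And>i. prob_space (M i)" and J: "finite J" and S: "S \<subseteq> J" and h: "h \<in> borel_measurable (PiM S M)"
  shows "(\<integral>X. h (restrict X S) \<partial>PiM J M) = (\<integral>X. h X \<partial>PiM S M)"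
proof -
  interpret P: product_prob_space M J
    using M by (simp add: product_prob_space_def product_prob_space_axioms_def product_sigma_finite_def
      prob_space_imp_sigma_finite)
  show ?thesis
    using h by (subst P.distr_restrict[OF S J]) (simp add: integral_distr measurable_restrict_subset[OF S])
qed

text \<open>On the event that \<open>S\<close> is the set of outside indices, the coordinates in
  \<open>S\<close> are i.i.d. from \<open>M\<close> conditioned on the complement of
  \<open>E\<close>, and \<open>h'\<close> looks at no others; the coordinates inside
  \<open>E\<close> integrate out and leave only the weight.\<close>

lemma integral_outside_pattern:
  fixes h :: "('i \<Rightarrow> 'a) \<Rightarrow> real"
  assumes M: "prob_space M" and J: "finite J" and E: "E \<in> sets M" and v: "0 < measure M E" "measure M E < 1"
    and S: "S \<subseteq> J" and h: "h \<in> borel_measurable (PiM S (\<lambda>_. M))"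
    and hr: "\<And>X. X \<in> space (PiM J (\<lambda>_. M)) \<Longrightarrow> h' X = h (restrict X S)"
  shows "(\<integral>X. indicator {X. outside_idx J E X = S} X * h' X \<partial>PiM J (\<lambda>_. M))
    = pattern_weight J (measure M E) S * (\<integral>X. h X \<partial>PiM S (\<lambda>_. uniform_measure M (space M - E)))"
proof -
  interpret M: prob_space M by fact
  interpret P: product_prob_space "\<lambda>_. M" J using M by (rule product_prob_space_const)
  define P where "P = PiM J (\<lambda>_. M)"
  define A where "A = (\<lambda>j. if j \<in> S then space M - E else E)"
  define box where "box = Pi\<^sub>E J A"
  have box_eq: "box = {X \<in> space P. outside_idx J E X = S}"
    unfolding box_def A_def P_def using outside_box[OF E S] by simp
  have A: "A i \<in> sets M" "emeasure M (A i) \<noteq> 0" for i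
    using E v by (auto simp: A_def M.emeasure_eq_measure M.prob_compl)
  have box: "box \<in> sets P" unfolding box_def P_def using A J by (intro sets_PiM_I_finite) auto
  have mb: "measure P box = pattern_weight J (measure M E) S"
    unfolding box_eq P_def by (rule measure_outside[OF M J E S])
  have pos: "measure P box > 0" unfolding mb pattern_weight_def using v by simp
  have fin: "emeasure P box = ennreal (measure P box)"
    unfolding P_def by (simp add: P.P.emeasure_eq_measure)
  have h'': "(\<lambda>X. h (restrict X S)) \<in> borel_measurable P"
    unfolding P_def using h by (rule measurable_compose[OF measurable_restrict_subset[OF S]])
  have "(\<integral>X. h X \<partial>PiM S (\<lambda>_. uniform_measure M (space M - E)))
     = (\<integral>X. h X \<partial>PiM S (\<lambda>i. uniform_measure M (A i)))"
    by (intro arg_cong2[where f = "integral\<^sup>L"] PiM_cong) (auto simp: A_def)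
  also have "\<dots> = (\<integral>X. h (restrict X S) \<partial>PiM J (\<lambda>i. uniform_measure M (A i)))"
  proof (rule integral_PiM_restrict[symmetric])
    show "prob_space (uniform_measure M (A i))" for i
      using A by (intro prob_space_uniform_measure) (auto simp: M.emeasure_eq_measure)
    show "h \<in> borel_measurable (Pi\<^sub>M S (\<lambda>i. uniform_measure M (A i)))"
      using h by (subst measurable_cong_sets) (auto intro!: sets_PiM_cong)
  qed (use J S in auto)
  also have "\<dots> = (\<integral>X. h (restrict X S) \<partial>uniform_measure P box)"
    unfolding box_def P_def by (subst uniform_measure_PiM[OF M J A]) auto
  also have "\<dots> = (\<integral>X. (indicator box X / measure P box) *\<^sub>R h (restrict X S) \<partial>P)"
  proof -
    have "uniform_measure P box = density P (\<lambda>X. ennreal (indicator box X / measure P box))"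
      unfolding uniform_measure_def fin using pos
      by (intro arg_cong2[where f = density] refl ext)
         (auto simp: divide_ennreal simp flip: ennreal_indicator)
    thus ?thesis
      using pos h'' box by (simp only:) (subst integral_density, auto)
  qed
  also have "\<dots> = (\<integral>X. indicator {X. outside_idx J E X = S} X * h' X / measure P box \<partial>P)"
    by (intro Bochner_Integration.integral_cong) (auto simp: box_eq hr P_def split: split_indicator)
  also have "\<dots> = (\<integral>X. indicator {X. outside_idx J E X = S} X * h' X \<partial>P) / measure P box"
    by simp
  finally show ?thesis
    using pos unfolding P_def[symmetric] mb by (simp add: field_simps)
qed

lemma pattern_weight_nonneg: "0 \<le> v \<Longrightarrow> v \<le> 1 \<Longrightarrow> 0 \<le> pattern_weight J v S"
  by (simp add: pattern_weight_def)

text \<open>Grouping the patterns by the number of indices in \<open>E\<close> turns a sum over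
  subsets into an expectation under the binomial law. Below, \<open>q\<close> is an indicator, the
  constant 1, or the identity.\<close>

lemma sum_pattern_weight:
  assumes J: "finite J"
  shows "(\<Sum>S\<in>Pow J. q (card (J - S)) * pattern_weight J v S)
    = (\<Sum>a\<le>card J. q a * (real (card J choose a) * v ^ a * (1 - v) ^ (card J - a)))"
proof -
  have "(\<Sum>S\<in>Pow J. q (card (J - S)) * pattern_weight J v S)
      = (\<Sum>T\<in>Pow J. q (card T) * (v ^ card T * (1 - v) ^ (card J - card T)))"
  proof (rule sum.reindex_bij_witness[where i = "\<lambda>T. J - T" and j = "\<lambda>S. J - S"])
    fix S assume "S \<in> Pow J"
    hence S: "S \<subseteq> J" and fS: "finite S" using J finite_subset by auto
    have "card J - card (J - S) = card S"
      using S J fS by (simp add: card_Diff_subset card_mono)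
    thus "q (card (J - S)) * (v ^ card (J - S) * (1 - v) ^ (card J - card (J - S)))
       = q (card (J - S)) * pattern_weight J v S"
      by (simp add: pattern_weight_def)
  qed auto
  also have "\<dots> = (\<Sum>a\<le>card J. \<Sum>T | T \<in> Pow J \<and> card T = a. q (card T) * (v ^ card T * (1 - v) ^ (card J - card T)))"
    using J by (intro sum.group[symmetric]) (auto intro: card_mono)
  also have "\<dots> = (\<Sum>a\<le>card J. q a * (real (card J choose a) * v ^ a * (1 - v) ^ (card J - a)))"
  proof (intro sum.cong refl)
    fix a
    have "(\<Sum>T | T \<in> Pow J \<and> card T = a. q (card T) * (v ^ card T * (1 - v) ^ (card J - card T)))
        = real (card {T. T \<subseteq> J \<and> card T = a}) * (q a * (v ^ a * (1 - v) ^ (card J - a)))"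
      by simp
    thus "(\<Sum>T | T \<in> Pow J \<and> card T = a. q (card T) * (v ^ card T * (1 - v) ^ (card J - card T)))
        = q a * (real (card J choose a) * v ^ a * (1 - v) ^ (card J - a))"
      using J by (simp add: n_subsets)
  qed
  finally show ?thesis .
qed

lemma binom_cdf_alt:
  "binom_cdf m w k = (\<Sum>a\<le>m. of_bool (a < k) * (real (m choose a) * w ^ a * (1 - w) ^ (m - a)))"
proof -
  have "(\<Sum>a\<le>m. of_bool (a < k) * (real (m choose a) * w ^ a * (1 - w) ^ (m - a)))
     = (\<Sum>a | a \<le> m \<and> a < k. real (m choose a) * w ^ a * (1 - w) ^ (m - a))"
    by (intro sum.mono_neutral_cong_right) auto
  also have "\<dots> = binom_cdf m w k"
    unfolding binom_cdf_def by (intro sum.mono_neutral_left) auto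
  finally show ?thesis ..
qed

lemma sum_pattern_weight_less:
  "finite J \<Longrightarrow> (\<Sum>S\<in>Pow J. of_bool (card (J - S) < k) * pattern_weight J v S) = binom_cdf (card J) v k"
  using sum_pattern_weight[of J "\<lambda>a. of_bool (a < k)" v] by (simp add: binom_cdf_alt)

lemma sum_pattern_weight_one: "finite J \<Longrightarrow> (\<Sum>S\<in>Pow J. pattern_weight J v S) = 1"
  using sum_pattern_weight[of J "\<lambda>_. 1" v] binomial_ring[of v "1 - v" "card J"] by simp

lemma sum_pattern_weight_card:
  "finite J \<Longrightarrow> (\<Sum>S\<in>Pow J. real (card (J - S)) * pattern_weight J v S) = real (card J) * v"
  using sum_pattern_weight[of J "\<lambda>a. real a" v] sum_k_Bernstein[of "card J" v]
  by (simp add: Bernstein_def mult_ac)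

lemma binom_cdf_nonneg: "0 \<le> w \<Longrightarrow> w \<le> 1 \<Longrightarrow> 0 \<le> binom_cdf m w k"
  unfolding binom_cdf_def by (intro sum_nonneg) auto

lemma measurable_cnt:
  assumes "finite S" "S \<subseteq> J" "E \<in> sets M"
  shows "(\<lambda>X. cnt S X E) \<in> measurable (PiM J (\<lambda>_. M)) (count_space UNIV)"
  unfolding cnt_def
proof (rule measurable_card_pred)
  fix l assume "l \<in> S"
  hence "(\<lambda>X. X l) \<in> measurable (PiM J (\<lambda>_. M)) M"
    using assms by (intro measurable_component_singleton) auto
  thus "Measurable.pred (PiM J (\<lambda>_. M)) (\<lambda>X. X l \<in> E)"
    using assms(3) by (simp add: pred_sets2)
qed (use assms in auto)

lemma measure_PiM_restrict:
  fixes M :: "'i \<Rightarrow> 'a measure"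
  assumes M: "\<And>i. prob_space (M i)" and J: "finite J" and S: "S \<subseteq> J"
    and P: "{X \<in> space (PiM S M). P X} \<in> sets (PiM S M)"
    and PP: "\<And>X. X \<in> space (PiM J M) \<Longrightarrow> P' X = P (restrict X S)"
  shows "\<P>(X in PiM J M. P' X) = \<P>(X in PiM S M. P X)"
proof -
  interpret P: product_prob_space M J
    using M by (simp add: product_prob_space_def product_prob_space_axioms_def product_sigma_finite_def
      prob_space_imp_sigma_finite)
  have "\<P>(X in PiM S M. P X)
     = measure (PiM J M) ((\<lambda>X. restrict X S) -` {X \<in> space (PiM S M). P X} \<inter> space (PiM J M))"
    using P by (subst P.distr_restrict[OF S J], subst measure_distr)
      (auto simp: measurable_restrict_subset[OF S])
  also have "(\<lambda>X. restrict X S) -` {X \<in> space (PiM S M). P X} \<inter> space (PiM J M) = {X \<in> space (PiM J M). P' X}"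
    using measurable_space[OF measurable_restrict_subset[OF S, of M]] PP by auto
  finally show ?thesis ..
qed

lemma prob_cnt_less:
  assumes M: "prob_space M" and J: "finite J" and S: "S \<subseteq> J" and E: "E \<in> sets M"
  shows "\<P>(X in PiM J (\<lambda>_. M). cnt S X E < k)
    = binom_cdf (card S) (measure M E) k"
proof -
  have fS: "finite S" using S J finite_subset by blast
  interpret PS: prob_space "PiM S (\<lambda>_. M)" using M by (rule prob_space_PiM_const)
  have [measurable]: "(\<lambda>X. cnt S X E) \<in> measurable (PiM S (\<lambda>_. M)) (count_space UNIV)"
    using fS E by (intro measurable_cnt) auto
  have "\<P>(X in PiM J (\<lambda>_. M). cnt S X E < k)
      = \<P>(X in PiM S (\<lambda>_. M). cnt S X E < k)"
    by (rule measure_PiM_restrict[OF M J S]) (auto intro!: arg_cong[where f = "\<lambda>x. x < k"] cnt_cong)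
  also have "{X \<in> space (PiM S (\<lambda>_. M)). cnt S X E < k}
     = (\<Union>T\<in>{T \<in> Pow S. card (S - T) < k}. {X \<in> space (PiM S (\<lambda>_. M)). outside_idx S E X = T})"
    using outside_subset[of S E] by (auto simp: cnt_eq_card_outside[OF fS])
  also have "measure (PiM S (\<lambda>_. M)) \<dots>
     = (\<Sum>T\<in>{T \<in> Pow S. card (S - T) < k}. \<P>(X in PiM S (\<lambda>_. M). outside_idx S E X = T))"
  proof (rule PS.finite_measure_finite_Union)
    show "(\<lambda>T. {X \<in> space (PiM S (\<lambda>_. M)). outside_idx S E X = T}) ` {T \<in> Pow S. card (S - T) < k} \<subseteq> PS.events"
      using fS E by (auto intro!: sets_PiM_I_finite simp: outside_box)
  qed (use fS in \<open>auto simp: disjoint_family_on_def\<close>)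
  also have "\<dots> = (\<Sum>T\<in>{T \<in> Pow S. card (S - T) < k}. pattern_weight S (measure M E) T)"
    using measure_outside[OF M fS E] by (intro sum.cong) auto
  also have "\<dots> = (\<Sum>T\<in>Pow S. of_bool (card (S - T) < k) * pattern_weight S (measure M E) T)"
    using fS by (intro sum.mono_neutral_cong_left) auto
  also have "\<dots> = binom_cdf (card S) (measure M E) k"
    by (rule sum_pattern_weight_less[OF fS])
  finally show ?thesis .
qed

text \<open>Fubini in the coordinate \<open>i\<close>: a bound on the sections that is uniform over
  \<open>B\<close> takes the place of a conditional probability given \<open>X i = x\<close>, and
  sections over points outside \<open>B\<close> are empty by \<open>out\<close>.\<close>

lemma measure_PiM_insert_le:
  assumes M: "prob_space M" and J: "finite J" "i \<notin> J"
    and P [measurable]: "Measurable.pred (PiM (insert i J) (\<lambda>_. M)) P"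
    and B [measurable]: "B \<in> sets M" and c: "0 \<le> c"
    and le: "\<And>x. x \<in> B \<Longrightarrow> \<P>(X in PiM J (\<lambda>_. M). P (X(i := x))) \<le> c"
    and out: "\<And>X. X \<in> space (PiM (insert i J) (\<lambda>_. M)) \<Longrightarrow> P X \<Longrightarrow> X i \<in> B"
  shows "\<P>(X in PiM (insert i J) (\<lambda>_. M). P X) \<le> c * measure M B"
proof -
  interpret M: prob_space M by fact
  interpret P: product_prob_space "\<lambda>_. M" J using M by (rule product_prob_space_const)
  interpret I: prob_space "PiM (insert i J) (\<lambda>_. M)" using M by (rule prob_space_PiM_const)
  let ?A = "{X \<in> space (PiM (insert i J) (\<lambda>_. M)). P X}"
  have A: "?A \<in> sets (PiM (insert i J) (\<lambda>_. M))" by measurable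
  have "emeasure (PiM (insert i J) (\<lambda>_. M)) ?A = (\<integral>\<^sup>+ X. indicator ?A X \<partial>PiM (insert i J) (\<lambda>_. M))"
    using A by simp
  also have "\<dots> = (\<integral>\<^sup>+ x. (\<integral>\<^sup>+ X. indicator ?A (X(i := x)) \<partial>PiM J (\<lambda>_. M)) \<partial>M)"
    using A by (intro P.product_nn_integral_insert_rev J) auto
  also have "\<dots> \<le> (\<integral>\<^sup>+ x. ennreal c * indicator B x \<partial>M)"
  proof (intro nn_integral_mono)
    fix x assume x: "x \<in> space M"
    have upd: "X(i := x) \<in> space (PiM (insert i J) (\<lambda>_. M))" if "X \<in> space (PiM J (\<lambda>_. M))" for X
      using that x by (auto simp: space_PiM PiE_iff extensional_def)
    have mupd: "(\<lambda>X. X(i := x)) \<in> measurable (PiM J (\<lambda>_. M)) (PiM (insert i J) (\<lambda>_. M))"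
      using x by (intro measurable_fun_upd[where J = J]) auto
    have pm: "Measurable.pred (PiM J (\<lambda>_. M)) (\<lambda>X. P (X(i := x)))"
      using measurable_compose[OF mupd P] by simp
    have "(\<integral>\<^sup>+ X. indicator ?A (X(i := x)) \<partial>PiM J (\<lambda>_. M))
        = (\<integral>\<^sup>+ X. indicator {X \<in> space (PiM J (\<lambda>_. M)). P (X(i := x))} X \<partial>PiM J (\<lambda>_. M))"
      by (intro nn_integral_cong) (auto simp: upd split: split_indicator)
    also have "\<dots> = ennreal (\<P>(X in PiM J (\<lambda>_. M). P (X(i := x))))"
      using pm by (simp add: P.P.emeasure_eq_measure)
    also have "\<dots> \<le> ennreal c * indicator B x"
    proof (cases "x \<in> B")
      case True
      thus ?thesis using le[OF True] by (simp add: ennreal_leI)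
    next
      case False
      hence e: "{X \<in> space (PiM J (\<lambda>_. M)). P (X(i := x))} = {}"
        using out[OF upd] by auto
      show ?thesis unfolding e by simp
    qed
    finally show "(\<integral>\<^sup>+ X. indicator ?A (X(i := x)) \<partial>PiM J (\<lambda>_. M)) \<le> ennreal c * indicator B x" .
  qed
  also have "\<dots> = ennreal (c * measure M B)"
    using c by (simp add: nn_integral_cmult M.emeasure_eq_measure ennreal_mult)
  finally show ?thesis
    using c by (simp add: I.emeasure_eq_measure)
qed

section \<open>Exponential bounds for binomial lower tails\<close>

definition tail_const :: "nat \<Rightarrow> real" where
  "tail_const k = exp (real k) * (\<Sum>j<k. 2 ^ j * fact j)"

lemma tail_const_nonneg: "0 \<le> tail_const k"
  unfolding tail_const_def by (intro mult_nonneg_nonneg sum_nonneg) auto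

text \<open>\<open>(1 - w) ^ (m - a)\<close> is at most \<open>exp (- w * (m - a))\<close>, and the
  excess \<open>exp (a * w)\<close> is at most \<open>exp k\<close> because \<open>a < k\<close> and
  \<open>w \<le> 1\<close>.\<close>

lemma binom_cdf_le_poisson:
  assumes w: "0 \<le> w" "w \<le> 1"
  shows "binom_cdf m w k \<le> exp (real k) * (\<Sum>a<k. (real m * w) ^ a * exp (- (real m * w)))"
  unfolding binom_cdf_def sum_distrib_left
proof (intro sum_mono)
  fix a assume a: "a \<in> {..<k}"
  show "real (m choose a) * w ^ a * (1 - w) ^ (m - a) \<le> exp (real k) * ((real m * w) ^ a * exp (- (real m * w)))"
  proof (cases "a \<le> m")
    case True
    have "real (m choose a) \<le> real m ^ a"
      using binomial_le_pow[OF True] by (metis of_nat_le_iff of_nat_power)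
    moreover have "(1 - w) ^ (m - a) \<le> exp (real k) * exp (- (real m * w))"
    proof -
      have "(1 - w) ^ (m - a) \<le> exp (- w) ^ (m - a)"
        using w exp_ge_add_one_self[of "-w"] by (intro power_mono) auto
      also have "\<dots> = exp (real a * w - real m * w)"
        using True by (simp add: of_nat_diff algebra_simps flip: exp_of_nat_mult)
      also have "\<dots> \<le> exp (real k - real m * w)"
        using a w mult_mono[of "real a" "real k" w 1] by simp
      finally show ?thesis by (simp add: exp_diff exp_minus field_simps)
    qed
    ultimately have "real (m choose a) * w ^ a * (1 - w) ^ (m - a) \<le> real m ^ a * w ^ a * (exp (real k) * exp (- (real m * w)))"
      using w by (intro mult_mono) auto
    thus ?thesis by (simp add: power_mult_distrib mult_ac)
  qed (use w in \<open>auto simp: binomial_eq_0\<close>)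
qed

text \<open>Half of the exponential absorbs the power: a single term of the series of
  \<open>exp (x / 2)\<close> is compared with its sum. The numbers \<open>2 ^ a * fact a\<close>
  become the summands of \<open>tail_const\<close>.\<close>

lemma pow_exp_le:
  fixes x :: real
  assumes "0 \<le> x"
  shows "x ^ a * exp (- x) \<le> 2 ^ a * fact a * exp (- x / 2)"
proof -
  have "(x / 2) ^ a / fact a \<le> exp (x / 2)"
  proof -
    have "(\<Sum>n\<in>{a}. (x / 2) ^ n /\<^sub>R fact n) \<le> (\<Sum>n. (x / 2) ^ n /\<^sub>R fact n)"
      using assms by (intro sum_le_suminf summable_exp_generic) auto
    thus ?thesis by (simp only: exp_def sum.insert sum.empty finite.emptyI empty_iff not_False_eq_True add_0_right real_scaleR_def divide_inverse mult.commute)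
  qed
  hence "x ^ a \<le> 2 ^ a * fact a * exp (x / 2)"
    by (simp add: power_divide field_simps)
  hence "x ^ a * exp (- x) \<le> 2 ^ a * fact a * exp (x / 2) * exp (- x)"
    by (intro mult_right_mono) auto
  also have "exp (x / 2) * exp (- x) = exp (- x / 2)"
    by (simp flip: exp_add)
  hence "2 ^ a * fact a * exp (x / 2) * exp (- x) = 2 ^ a * fact a * exp (- x / 2)"
    by (simp add: mult.assoc)
  finally show ?thesis .
qed

lemma binom_cdf_le_exp:
  assumes w: "0 \<le> w" "w \<le> 1"
  shows "binom_cdf m w k \<le> tail_const k * exp (- (real m * w / 2))"
proof -
  have "binom_cdf m w k \<le> exp (real k) * (\<Sum>a<k. (real m * w) ^ a * exp (- (real m * w)))"
    by (rule binom_cdf_le_poisson[OF w])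
  also have "\<dots> \<le> exp (real k) * (\<Sum>a<k. 2 ^ a * fact a * exp (- (real m * w / 2)))"
    using w pow_exp_le[of "real m * w"] by (intro mult_left_mono sum_mono) auto
  also have "\<dots> = tail_const k * exp (- (real m * w / 2))"
    by (simp add: tail_const_def sum_distrib_right mult.assoc)
  finally show ?thesis .
qed

text \<open>The exponential bound is monotone in the mass and in the number of indices, so lower
  bounds \<open>w\<close> and \<open>m\<close> for them are enough.\<close>

lemma prob_cnt_less_le:
  assumes M: "prob_space M" and J: "finite J" and S: "S \<subseteq> J" and E: "E \<in> sets M"
    and w: "w \<le> measure M E" and m: "m \<le> card S"
  shows "\<P>(X in PiM J (\<lambda>_. M). cnt S X E < k)
    \<le> tail_const k * exp (- (real m * w / 2))"
proof -
  interpret M: prob_space M by fact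
  have "binom_cdf (card S) (measure M E) k \<le> tail_const k * exp (- (real (card S) * measure M E / 2))"
    by (rule binom_cdf_le_exp) auto
  also have "\<dots> \<le> tail_const k * exp (- (real m * w / 2))"
  proof -
    have "real m * w \<le> real m * measure M E" using w by (intro mult_left_mono) auto
    also have "\<dots> \<le> real (card S) * measure M E" using m by (intro mult_right_mono) auto
    finally show ?thesis by (intro mult_left_mono tail_const_nonneg) auto
  qed
  finally show ?thesis using prob_cnt_less[OF M J S E] by simp
qed

section \<open>Total probability over the set of outside indices, and decorrelation\<close>

lemma integral_by_outside:
  fixes F :: "'i set \<Rightarrow> ('i \<Rightarrow> 'a) \<Rightarrow> real"
  assumes M: "prob_space M" and J: "finite J" and E: "E \<in> sets M" and v: "0 < measure M E" "measure M E < 1"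
    and F: "\<And>S. S \<subseteq> J \<Longrightarrow> F S \<in> borel_measurable (PiM S (\<lambda>_. M))"
    and bd: "\<And>S X. \<bar>F S X\<bar> \<le> G"
    and h: "\<And>X. X \<in> space (PiM J (\<lambda>_. M)) \<Longrightarrow> h X = F (outside_idx J E X) (restrict X (outside_idx J E X))"
  shows "(\<integral>X. q (outside_idx J E X) * h X \<partial>PiM J (\<lambda>_. M))
    = (\<Sum>S\<in>Pow J. q S * pattern_weight J (measure M E) S *
        (\<integral>X. F S X \<partial>PiM S (\<lambda>_. uniform_measure M (space M - E))))"
proof -
  let ?P = "PiM J (\<lambda>_. M)"
  interpret PJ: prob_space ?P using M by (rule prob_space_PiM_const)
  have ind: "(\<lambda>X. indicator {X. outside_idx J E X = S} X :: real) \<in> borel_measurable ?P" if "S \<in> Pow J" for S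
  proof -
    have "(\<lambda>X. indicator {S} (outside_idx J E X) :: real) \<in> borel_measurable ?P"
      using measurable_compose[OF measurable_outside[OF E J], of "indicator {S} :: _ \<Rightarrow> real" borel] by simp
    thus ?thesis by (simp add: indicator_def)
  qed
  have int: "integrable ?P (\<lambda>X. indicator {X. outside_idx J E X = S} X * F S (restrict X S))" if S: "S \<in> Pow J" for S
  proof (rule PJ.integrable_const_bound[where B = G])
    show "AE x in ?P. norm (indicator {X. outside_idx J E X = S} x * F S (restrict x S)) \<le> G"
      using bd[of S] by (auto split: split_indicator intro!: AE_I2 order.trans[OF abs_ge_zero bd])
    show "(\<lambda>X. indicator {X. outside_idx J E X = S} X * F S (restrict X S)) \<in> borel_measurable ?P"
      using S by (intro borel_measurable_times ind S measurable_compose[OF measurable_restrict_subset F]) auto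
  qed
  have "(\<integral>X. q (outside_idx J E X) * h X \<partial>?P)
     = (\<integral>X. (\<Sum>S\<in>Pow J. q S * (indicator {X. outside_idx J E X = S} X * F S (restrict X S))) \<partial>?P)"
  proof (intro Bochner_Integration.integral_cong refl)
    fix X assume X: "X \<in> space ?P"
    have "(\<Sum>S\<in>Pow J. q S * (indicator {X. outside_idx J E X = S} X * F S (restrict X S)))
        = (\<Sum>S\<in>Pow J. if S = outside_idx J E X then q S * F S (restrict X S) else 0)"
      by (intro sum.cong) auto
    also have "\<dots> = q (outside_idx J E X) * h X"
      using J outside_subset[of J E X] by (subst sum.delta) (auto simp: h[OF X])
    finally show "q (outside_idx J E X) * h X
       = (\<Sum>S\<in>Pow J. q S * (indicator {X. outside_idx J E X = S} X * F S (restrict X S)))" ..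
  qed
  also have "\<dots> = (\<Sum>S\<in>Pow J. \<integral>X. q S * (indicator {X. outside_idx J E X = S} X * F S (restrict X S)) \<partial>?P)"
    using int by (intro Bochner_Integration.integral_sum) auto
  also have "\<dots> = (\<Sum>S\<in>Pow J. q S * (\<integral>X. indicator {X. outside_idx J E X = S} X * F S (restrict X S) \<partial>?P))"
    by simp
  also have "\<dots> = (\<Sum>S\<in>Pow J. q S * (pattern_weight J (measure M E) S *
        (\<integral>X. F S X \<partial>PiM S (\<lambda>_. uniform_measure M (space M - E)))))"
  proof (intro sum.cong refl arg_cong[where f = "\<lambda>x. q _ * x"])
    fix S assume S: "S \<in> Pow J"
    show "(\<integral>X. indicator {X. outside_idx J E X = S} X * F S (restrict X S) \<partial>?P)
       = pattern_weight J (measure M E) S * (\<integral>X. F S X \<partial>PiM S (\<lambda>_. uniform_measure M (space M - E)))"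
      using S F by (intro integral_outside_pattern[OF M J E v]) auto
  qed
  finally show ?thesis by (simp add: mult.assoc)
qed

text \<open>Every exchange of one count for another below passes through this: the probability that
  the counts differ controls the change in the mean of any bounded test function.\<close>

lemma (in prob_space) integral_diff_le_prob:
  fixes f g :: "'a \<Rightarrow> real"
  assumes f: "f \<in> borel_measurable M" "\<And>x. \<bar>f x\<bar> \<le> G" and g: "g \<in> borel_measurable M" "\<And>x. \<bar>g x\<bar> \<le> G"
    and R: "{x \<in> space M. R x} \<in> events" and eq: "\<And>x. x \<in> space M \<Longrightarrow> \<not> R x \<Longrightarrow> f x = g x"
  shows "\<bar>(\<integral>x. f x \<partial>M) - (\<integral>x. g x \<partial>M)\<bar> \<le> 2 * G * prob {x \<in> space M. R x}"
proof -
  have int: "integrable M f" "integrable M g"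
    using f g by (auto intro!: integrable_const_bound[where B = G])
  have intR: "integrable M (\<lambda>x. 2 * G * indicator {x \<in> space M. R x} x)"
    using R by (intro integrable_mult_right integrable_real_indicator) (auto simp: emeasure_eq_measure)
  have "\<bar>(\<integral>x. f x \<partial>M) - (\<integral>x. g x \<partial>M)\<bar> = \<bar>\<integral>x. f x - g x \<partial>M\<bar>"
    using int by simp
  also have "\<dots> \<le> (\<integral>x. \<bar>f x - g x\<bar> \<partial>M)"
    using integral_norm_bound[of M "\<lambda>x. f x - g x"] by simp
  also have "\<dots> \<le> (\<integral>x. 2 * G * indicator {x \<in> space M. R x} x \<partial>M)"
  proof (rule integral_mono)
    fix x assume x: "x \<in> space M"
    show "\<bar>f x - g x\<bar> \<le> 2 * G * indicator {x \<in> space M. R x} x"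
      using f(2)[of x] g(2)[of x] eq[OF x] x by (cases "R x") auto
  qed (use int intR in auto)
  also have "\<dots> = 2 * G * prob {x \<in> space M. R x}"
    using R by simp
  finally show ?thesis .
qed

text \<open>If fewer than \<open>a\<close> indices fall into \<open>E\<close>, more than
  \<open>card J - a\<close> lie outside, i.i.d. from the conditioned law. These must leave
  \<open>G - E\<close> nearly empty, and conditioning on the complement of \<open>E\<close> can only
  enlarge the mass of \<open>G - E\<close>; so the two requirements give a product of
  bounds.\<close>

lemma prob_cnt_less_and:
  assumes M: "prob_space M" and J: "finite J" and E: "E \<in> sets M" and v: "0 < measure M E" "measure M E < 1"
    and G: "G \<in> sets M" and w: "w \<le> measure M (G - E)"
  shows "\<P>(X in PiM J (\<lambda>_. M). cnt J X E < a \<and> cnt J X G < k)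
    \<le> binom_cdf (card J) (measure M E) a * (tail_const k * exp (- (real (card J - a) * w / 2)))"
proof -
  interpret M: prob_space M by fact
  let ?P = "PiM J (\<lambda>_. M)" and ?\<nu> = "uniform_measure M (space M - E)"
  interpret PJ: prob_space ?P using M by (rule prob_space_PiM_const)
  have nz: "emeasure M (space M - E) \<noteq> 0"
    using v E by (simp add: M.emeasure_eq_measure M.prob_compl)
  hence \<nu>: "prob_space ?\<nu>"
    by (intro prob_space_uniform_measure) auto
  define q :: "'b set \<Rightarrow> real" where "q = (\<lambda>S. of_bool (card (J - S) < a))"
  define F :: "'b set \<Rightarrow> ('b \<Rightarrow> 'a) \<Rightarrow> real" where "F = (\<lambda>S X. of_bool (cnt S X (G - E) < k))"
  define T where "T = tail_const k * exp (- (real (card J - a) * w / 2))"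
  have Gm: "G - E \<in> sets M" using G E by auto
  have Fm: "F S \<in> borel_measurable (PiM S (\<lambda>_. M))" if "S \<subseteq> J" for S
  proof -
    have [measurable]: "(\<lambda>X. cnt S X (G - E)) \<in> measurable (PiM S (\<lambda>_. M)) (count_space UNIV)"
      using that J by (intro measurable_cnt Gm) (auto intro: finite_subset)
    show ?thesis unfolding F_def by measurable
  qed
  have cm: "(\<lambda>X. cnt J X B) \<in> measurable ?P (count_space UNIV)" if "B \<in> sets M" for B
    using that J by (intro measurable_cnt) auto
  note [measurable] = cm[OF E] cm[OF G]
  \<comment> \<open>Passing from \<open>G\<close> to \<open>G - E\<close> enlarges the event, but it
    makes the second count a function of the outside coordinates alone.\<close>
  have inc: "indicator {X \<in> space ?P. cnt J X E < a \<and> cnt J X G < k} X \<le> q (outside_idx J E X) * F (outside_idx J E X) X"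
    for X
  proof -
    have "finite J" "outside_idx J E X \<subseteq> J" by (fact J, rule outside_subset)
    thus ?thesis using cnt_mono[of J "outside_idx J E X" "G - E" G X]
      by (auto simp: q_def F_def cnt_eq_card_outside[OF J] split: split_indicator)
  qed
  have FE: "F (outside_idx J E X) X = of_bool (cnt J X (G - E) < k)" for X
  proof -
    have "cnt (outside_idx J E X) X (G - E) = cnt J X (G - E)"
      unfolding cnt_def outside_idx_def by (rule arg_cong[where f = card]) auto
    thus ?thesis by (simp add: F_def)
  qed
  have "\<P>(X in ?P. cnt J X E < a \<and> cnt J X G < k)
      = (\<integral>X. indicator {X \<in> space ?P. cnt J X E < a \<and> cnt J X G < k} X \<partial>?P)"
    by simp
  also have "\<dots> \<le> (\<integral>X. q (outside_idx J E X) * F (outside_idx J E X) X \<partial>?P)"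
  proof (rule integral_mono[OF _ _ inc])
    note [measurable] = cm[OF Gm]
    have "integrable ?P (\<lambda>X. of_bool (cnt J X E < a) * of_bool (cnt J X (G - E) < k) :: real)"
      by (rule PJ.integrable_const_bound[where B = 1]) auto
    thus "integrable ?P (\<lambda>X. q (outside_idx J E X) * F (outside_idx J E X) X)"
      unfolding FE by (simp add: q_def cnt_eq_card_outside[OF J])
    show "integrable ?P (\<lambda>X. indicator {X \<in> space ?P. cnt J X E < a \<and> cnt J X G < k} X :: real)"
      by (rule integrable_real_indicator) (auto simp: PJ.emeasure_eq_measure)
  qed
  also have "\<dots> = (\<Sum>S\<in>Pow J. q S * pattern_weight J (measure M E) S * (\<integral>X. F S X \<partial>PiM S (\<lambda>_. ?\<nu>)))"
  proof (rule integral_by_outside[OF M J E v Fm])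
    show "\<bar>F S X\<bar> \<le> 1" for S X by (simp add: F_def)
    show "F (outside_idx J E X) X = F (outside_idx J E X) (restrict X (outside_idx J E X))" for X
      unfolding F_def by (intro arg_cong[where f = "\<lambda>x. of_bool (x < k)"] cnt_cong) auto
  qed
  also have "\<dots> \<le> (\<Sum>S\<in>Pow J. q S * pattern_weight J (measure M E) S * T)"
  proof (intro sum_mono)
    fix S assume S: "S \<in> Pow J"
    hence fS: "finite S" using J finite_subset by auto
    interpret PS: prob_space "PiM S (\<lambda>_. ?\<nu>)" using \<nu> by (rule prob_space_PiM_const)
    have nn: "0 \<le> q S * pattern_weight J (measure M E) S"
      using v by (simp add: q_def pattern_weight_nonneg)
    show "q S * pattern_weight J (measure M E) S * (\<integral>X. F S X \<partial>PiM S (\<lambda>_. ?\<nu>))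
      \<le> q S * pattern_weight J (measure M E) S * T"
    proof (cases "card (J - S) < a")
      case True
      have mc: "card J - a \<le> card S"
        using True S J fS card_mono[OF J, of S] by (simp add: card_Diff_subset)
      have m\<nu>: "w \<le> measure ?\<nu> (G - E)"
      proof -
        have "measure ?\<nu> (G - E) = measure M (G - E) / measure M (space M - E)"
        proof (subst measure_uniform_measure)
          have "(space M - E) \<inter> (G - E) = G - E"
            using sets.sets_into_space[OF G] by auto
          thus "measure M ((space M - E) \<inter> (G - E)) / measure M (space M - E) = measure M (G - E) / measure M (space M - E)"
            by simp
        qed (use nz Gm in auto)
        also have "\<dots> \<ge> measure M (G - E)"
          using v E by (simp add: M.prob_compl field_simps mult_left_le)
        finally show ?thesis using w by simp
      qed
      have [measurable]: "(\<lambda>X. cnt S X (G - E)) \<in> measurable (PiM S (\<lambda>_. ?\<nu>)) (count_space UNIV)"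
        using fS Gm by (intro measurable_cnt) auto
      have "(\<integral>X. F S X \<partial>PiM S (\<lambda>_. ?\<nu>)) = (\<integral>X. indicator {X \<in> space (PiM S (\<lambda>_. ?\<nu>)). cnt S X (G - E) < k} X \<partial>PiM S (\<lambda>_. ?\<nu>))"
        by (intro Bochner_Integration.integral_cong) (auto simp: F_def)
      also have "\<dots> = \<P>(X in PiM S (\<lambda>_. ?\<nu>). cnt S X (G - E) < k)"
        by simp
      also have "\<dots> \<le> T"
        unfolding T_def by (rule prob_cnt_less_le[OF \<nu> fS subset_refl _ m\<nu> mc]) (use Gm in auto)
      finally show ?thesis using nn by (intro mult_left_mono)
    qed (simp add: q_def)
  qed
  also have "\<dots> = binom_cdf (card J) (measure M E) a * T"
    using sum_pattern_weight_less[OF J, of a "measure M E"] by (simp add: q_def flip: sum_distrib_right)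
  finally show ?thesis by (simp add: T_def)
qed

text \<open>Conditionally on the positions of the indices that fall into \<open>E\<close>, the remaining points are
  i.i.d. from \<open>M\<close> conditioned on the complement of \<open>E\<close>. A statistic that ignores the points of \<open>E\<close>
  and hardly notices the deletion of a few points is thus nearly independent of the number of
  points of \<open>E\<close>.\<close>
lemma cnt_decorrelation:
  fixes F :: "'i set \<Rightarrow> ('i \<Rightarrow> 'a) \<Rightarrow> real"
  assumes M: "prob_space M" and J: "finite J" and E: "E \<in> sets M" and v: "0 < measure M E" "measure M E < 1"
    and F: "\<And>S. S \<subseteq> J \<Longrightarrow> F S \<in> borel_measurable (PiM S (\<lambda>_. M))"
    and bd: "\<And>S X. \<bar>F S X\<bar> \<le> G"
    and h: "\<And>X. X \<in> space (PiM J (\<lambda>_. M)) \<Longrightarrow> h X = F (outside_idx J E X) (restrict X (outside_idx J E X))"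
    and D: "\<And>S. S \<subseteq> J \<Longrightarrow>
      \<bar>(\<integral>X. F S X \<partial>PiM S (\<lambda>_. uniform_measure M (space M - E)))
        - (\<integral>X. F J X \<partial>PiM J (\<lambda>_. uniform_measure M (space M - E)))\<bar> \<le> D * real (card (J - S))"
    and D0: "0 \<le> D"
  shows "\<bar>(\<integral>X. of_bool (cnt J X E < k) * h X \<partial>PiM J (\<lambda>_. M))
       - binom_cdf (card J) (measure M E) k * (\<integral>X. h X \<partial>PiM J (\<lambda>_. M))\<bar>
    \<le> D * binom_cdf (card J) (measure M E) k * (real k + real (card J) * measure M E)"
proof -
  define v where "v = measure M E"
  define p where "p = binom_cdf (card J) v k"
  define \<psi> where "\<psi> S = (\<integral>X. F S X \<partial>PiM S (\<lambda>_. uniform_measure M (space M - E)))" for S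
  define b :: "'i set \<Rightarrow> real" where "b S = of_bool (card (J - S) < k)" for S
  let ?pw = "pattern_weight J v"
  have v01: "0 \<le> v" "v \<le> 1" using assms(4,5) by (auto simp: v_def)
  have p0: "0 \<le> p" unfolding p_def using v01 by (rule binom_cdf_nonneg)
  have pw0: "0 \<le> ?pw S" for S using v01 by (rule pattern_weight_nonneg)
  have I1: "(\<integral>X. of_bool (cnt J X E < k) * h X \<partial>PiM J (\<lambda>_. M)) = (\<Sum>S\<in>Pow J. b S * ?pw S * \<psi> S)"
    using integral_by_outside[OF M J E v F bd h, of b] by (simp add: b_def cnt_eq_card_outside[OF J] \<psi>_def v_def)
  have I2: "(\<integral>X. h X \<partial>PiM J (\<lambda>_. M)) = (\<Sum>S\<in>Pow J. ?pw S * \<psi> S)"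
    using integral_by_outside[OF M J E v F bd h, of "\<lambda>_. 1"] by (simp add: \<psi>_def v_def)
  have sp: "(\<Sum>S\<in>Pow J. b S * ?pw S) = p" unfolding b_def p_def by (rule sum_pattern_weight_less[OF J])
  have s1: "(\<Sum>S\<in>Pow J. ?pw S) = 1" by (rule sum_pattern_weight_one[OF J])
  have sc: "(\<Sum>S\<in>Pow J. real (card (J - S)) * ?pw S) = real (card J) * v"
    by (rule sum_pattern_weight_card[OF J])
  \<comment> \<open>The constant \<open>\<psi> J\<close> contributes \<open>p * \<psi> J\<close> to
    both terms and cancels, so \<open>\<psi>\<close> may be centred at the full index set, where
    \<open>D\<close> controls the differences.\<close>
  have "(\<Sum>S\<in>Pow J. b S * ?pw S * \<psi> S) - p * (\<Sum>S\<in>Pow J. ?pw S * \<psi> S)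
      = (\<Sum>S\<in>Pow J. b S * ?pw S * (\<psi> S - \<psi> J)) - p * (\<Sum>S\<in>Pow J. ?pw S * (\<psi> S - \<psi> J))"
    using sp s1 by (simp add: algebra_simps sum_subtractf flip: sum_distrib_left)
  also have "\<bar>\<dots>\<bar> \<le> (\<Sum>S\<in>Pow J. \<bar>b S * ?pw S * (\<psi> S - \<psi> J)\<bar>) + p * (\<Sum>S\<in>Pow J. \<bar>?pw S * (\<psi> S - \<psi> J)\<bar>)"
  proof -
    have "\<bar>p * (\<Sum>S\<in>Pow J. ?pw S * (\<psi> S - \<psi> J))\<bar> \<le> p * (\<Sum>S\<in>Pow J. \<bar>?pw S * (\<psi> S - \<psi> J)\<bar>)"
      unfolding abs_mult abs_of_nonneg[OF p0] by (intro mult_left_mono p0 order.trans[OF sum_abs])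
        (auto simp: abs_mult)
    moreover have "\<bar>\<Sum>S\<in>Pow J. b S * ?pw S * (\<psi> S - \<psi> J)\<bar> \<le> (\<Sum>S\<in>Pow J. \<bar>b S * ?pw S * (\<psi> S - \<psi> J)\<bar>)"
      by (rule sum_abs)
    ultimately show ?thesis by linarith
  qed
  \<comment> \<open>In the first sum fewer than \<open>k\<close> indices lie in \<open>E\<close>, so
    the deviation is at most \<open>D * k\<close>; in the second their number is binomial with mean
    \<open>card J * v\<close>.\<close>
  also have "\<dots> \<le> (\<Sum>S\<in>Pow J. D * real k * (b S * ?pw S)) + p * (\<Sum>S\<in>Pow J. D * (real (card (J - S)) * ?pw S))"
  proof (intro add_mono mult_left_mono sum_mono p0)
    fix S assume S: "S \<in> Pow J"
    have d: "\<bar>\<psi> S - \<psi> J\<bar> \<le> D * real (card (J - S))" using D[of S] S by (simp add: \<psi>_def)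
    have "b S * \<bar>\<psi> S - \<psi> J\<bar> \<le> b S * (D * real k)"
    proof (cases "card (J - S) < k")
      case True
      have "\<bar>\<psi> S - \<psi> J\<bar> \<le> D * real k"
        using d mult_left_mono[OF _ D0, of "real (card (J - S))" "real k"] True by simp
      thus ?thesis by (simp add: b_def)
    qed (simp add: b_def)
    hence "?pw S * (b S * \<bar>\<psi> S - \<psi> J\<bar>) \<le> ?pw S * (b S * (D * real k))"
      by (rule mult_left_mono) (rule pw0)
    thus "\<bar>b S * ?pw S * (\<psi> S - \<psi> J)\<bar> \<le> D * real k * (b S * ?pw S)"
      using pw0[of S] by (simp add: abs_mult b_def mult_ac)
    have "?pw S * \<bar>\<psi> S - \<psi> J\<bar> \<le> ?pw S * (D * real (card (J - S)))"
      using d pw0 by (intro mult_left_mono)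
    thus "\<bar>?pw S * (\<psi> S - \<psi> J)\<bar> \<le> D * (real (card (J - S)) * ?pw S)"
      using pw0[of S] by (simp add: abs_mult mult_ac)
  qed
  also have "\<dots> = D * p * (real k + real (card J) * v)"
    by (simp only: sum_distrib_left[symmetric] sp sc) (simp add: algebra_simps)
  finally show ?thesis unfolding I1 I2 p_def v_def .
qed

section \<open>Events that involve the ball of one of the sampled points\<close>

lemma pred_PiM_pair:
  assumes "Measurable.pred (M \<Otimes>\<^sub>M M) (\<lambda>(x, y). y \<in> E x)" "sets N = sets M" "i \<in> J" "j \<in> J"
  shows "Measurable.pred (PiM J (\<lambda>_. N)) (\<lambda>X. X i \<in> E (X j))"
proof -
  have s: "sets (PiM J (\<lambda>_. N)) = sets (PiM J (\<lambda>_. M))" using assms(2) by (intro sets_PiM_cong) auto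
  have "(\<lambda>X. (X j, X i)) \<in> measurable (PiM J (\<lambda>_. M)) (M \<Otimes>\<^sub>M M)"
    using assms by (intro measurable_Pair measurable_component_singleton)
  from measurable_compose[OF this assms(1)] show ?thesis
    by (simp add: measurable_cong_sets[OF s refl])
qed

text \<open>Formulated for any \<open>N\<close> with the measurable sets of \<open>M\<close>,
  because the same events are needed under \<open>M\<close> conditioned on the complement of a
  ball.\<close>

lemma pred_cnt_pair:
  assumes "Measurable.pred (M \<Otimes>\<^sub>M M) (\<lambda>(x, y). y \<in> E x)" "sets N = sets M" "S \<subseteq> J" "j \<in> J" "finite S"
  shows "Measurable.pred (PiM J (\<lambda>_. N)) (\<lambda>X. cnt S X (E (X j)) < k)"
proof -
  have [measurable]: "(\<lambda>X. cnt S X (E (X j))) \<in> measurable (PiM J (\<lambda>_. N)) (count_space UNIV)"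
    unfolding cnt_def using assms by (intro measurable_card_pred pred_PiM_pair[OF assms(1,2)]) auto
  show ?thesis by measurable
qed

lemma pred_component:
  assumes "B \<in> sets N" "j \<in> J"
  shows "Measurable.pred (PiM J (\<lambda>_. N)) (\<lambda>X. X j \<in> B)"
  using assms by (intro pred_sets2[OF assms(1)] measurable_component_singleton)

lemma section_sets:
  assumes "Measurable.pred (M \<Otimes>\<^sub>M M) (\<lambda>(x, y). y \<in> E x)" "space M = UNIV"
  shows "E x \<in> sets M"
proof -
  have "(\<lambda>y. (x, y)) \<in> measurable M (M \<Otimes>\<^sub>M M)" using assms(2) by auto
  from measurable_compose[OF this assms(1)] have "Measurable.pred M (\<lambda>y. y \<in> E x)" by simp
  thus ?thesis using assms(2) by (simp add: pred_def)
qed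

text \<open>With \<open>X j = x\<close> fixed, the count over \<open>S\<close> is binomial. Its
  success probability is the same \<open>w\<close> for every \<open>x\<close> in \<open>B\<close>,
  so the position of \<open>X j\<close> contributes only the factor
  \<open>measure N B\<close>.\<close>

lemma prob_own_cnt_less:
  assumes N: "prob_space N" "sets N = sets M" "space M = UNIV" and E: "Measurable.pred (M \<Otimes>\<^sub>M M) (\<lambda>(x, y). y \<in> E x)"
    and J: "finite J" "j \<in> J" "S \<subseteq> J - {j}" and B: "B \<in> sets N"
    and w: "\<And>x. x \<in> B \<Longrightarrow> measure N (E x) = w"
  shows "\<P>(X in PiM J (\<lambda>_. N). X j \<in> B \<and> cnt S X (E (X j)) < k)
     \<le> binom_cdf (card S) w k * measure N B"
proof (cases "B = {}")
  case False
  then obtain x0 where x0: "x0 \<in> B" by auto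
  interpret N: prob_space N by fact
  have Es: "E x \<in> sets N" for x using section_sets[OF E N(3)] N(2) by simp
  have w01: "0 \<le> w" "w \<le> 1" using w[OF x0] by auto
  define J' where "J' = J - {j}"
  have J': "J = insert j J'" "finite J'" "j \<notin> J'" "S \<subseteq> J'" using J by (auto simp: J'_def)
  have fS: "finite S" using J' finite_subset by auto
  have pr: "Measurable.pred (PiM J (\<lambda>_. N)) (\<lambda>X. X j \<in> B \<and> cnt S X (E (X j)) < k)"
    using J B fS by (intro pred_intros_logic pred_component pred_cnt_pair[OF E N(2)]) auto
  show ?thesis unfolding J'(1)
  proof (rule measure_PiM_insert_le[OF N(1) J'(2,3) _ B])
    show "Measurable.pred (PiM (insert j J') (\<lambda>_. N)) (\<lambda>X. X j \<in> B \<and> cnt S X (E (X j)) < k)"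
      using pr J' by simp
    show "0 \<le> binom_cdf (card S) w k" using w01 by (rule binom_cdf_nonneg)
    fix x assume x: "x \<in> B"
    have "cnt S (X(j := x)) A = cnt S X A" for X A
      using J' by (intro cnt_cong) auto
    thus "\<P>(X in PiM J' (\<lambda>_. N). (X(j := x)) j \<in> B \<and> cnt S (X(j := x)) (E ((X(j := x)) j)) < k)
       \<le> binom_cdf (card S) w k"
      using prob_cnt_less[OF N(1) J'(2,4) Es, of x k] w[OF x] x by simp
  qed auto
qed auto

text \<open>With \<open>X j = x\<close> fixed, the event that \<open>X i\<close> hits
  \<open>E x\<close> is independent of the count over \<open>S\<close>, which omits
  \<open>i\<close>; this yields the additional factor \<open>w\<close>.\<close>

lemma prob_own_cnt_less_hit:
  assumes N: "prob_space N" "sets N = sets M" "space M = UNIV" and E: "Measurable.pred (M \<Otimes>\<^sub>M M) (\<lambda>(x, y). y \<in> E x)"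
    and J: "finite J" "j \<in> J" "i \<in> J" "i \<noteq> j" "S \<subseteq> J - {i, j}" and B: "B \<in> sets N"
    and w: "\<And>x. x \<in> B \<Longrightarrow> measure N (E x) = w"
  shows "\<P>(X in PiM J (\<lambda>_. N). X j \<in> B \<and> cnt S X (E (X j)) < k \<and> X i \<in> E (X j))
     \<le> binom_cdf (card S) w k * w * measure N B"
proof (cases "B = {}")
  case False
  then obtain x0 where x0: "x0 \<in> B" by auto
  interpret N: prob_space N by fact
  have Es: "E x \<in> sets N" for x using section_sets[OF E N(3)] N(2) by simp
  have w01: "0 \<le> w" "w \<le> 1" using w[OF x0] by auto
  define J' where "J' = J - {j}"
  define J'' where "J'' = J' - {i}"
  have J': "J = insert j J'" "finite J'" "j \<notin> J'" "S \<subseteq> J'" using J by (auto simp: J'_def)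
  have J'': "J' = insert i J''" "finite J''" "i \<notin> J''" "S \<subseteq> J''" using J by (auto simp: J'_def J''_def)
  have fS: "finite S" using J' finite_subset by auto
  have pr: "Measurable.pred (PiM J (\<lambda>_. N)) (\<lambda>X. X j \<in> B \<and> cnt S X (E (X j)) < k \<and> X i \<in> E (X j))"
    using J B fS by (intro pred_intros_logic pred_component pred_cnt_pair[OF E N(2)] pred_PiM_pair[OF E N(2)]) auto
  show ?thesis unfolding J'(1)
  proof (rule measure_PiM_insert_le[OF N(1) J'(2,3) _ B])
    show "Measurable.pred (PiM (insert j J') (\<lambda>_. N)) (\<lambda>X. X j \<in> B \<and> cnt S X (E (X j)) < k \<and> X i \<in> E (X j))"
      using pr J' by simp
    show "0 \<le> binom_cdf (card S) w k * w" using w01 by (intro mult_nonneg_nonneg binom_cdf_nonneg)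
    fix x assume x: "x \<in> B"
    have c1: "cnt S (X(j := x)) A = cnt S X A" for X A using J' by (intro cnt_cong) auto
    have c2: "cnt S (X(i := y)) A = cnt S X A" for X y A using J'' by (intro cnt_cong) auto
    have pr2: "Measurable.pred (PiM J' (\<lambda>_. N)) (\<lambda>X. cnt S X (E x) < k \<and> X i \<in> E x)"
    proof -
      have [measurable]: "(\<lambda>X. cnt S X (E x)) \<in> measurable (PiM J' (\<lambda>_. N)) (count_space UNIV)"
        using fS J' Es by (intro measurable_cnt) auto
      have [measurable]: "Measurable.pred (PiM J' (\<lambda>_. N)) (\<lambda>X. X i \<in> E x)"
        using J'' Es by (intro pred_component) auto
      show ?thesis by measurable
    qed
    have "\<P>(X in PiM J' (\<lambda>_. N). cnt S X (E x) < k \<and> X i \<in> E x)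
       \<le> binom_cdf (card S) w k * measure N (E x)"
      unfolding J''(1)
    proof (rule measure_PiM_insert_le[OF N(1) J''(2,3) _ Es])
      show "Measurable.pred (PiM (insert i J'') (\<lambda>_. N)) (\<lambda>X. cnt S X (E x) < k \<and> X i \<in> E x)"
        using pr2 J'' by simp
      show "0 \<le> binom_cdf (card S) w k" using w01 by (rule binom_cdf_nonneg)
      fix y assume "y \<in> E x"
      thus "\<P>(X in PiM J'' (\<lambda>_. N). cnt S (X(i := y)) (E x) < k \<and> (X(i := y)) i \<in> E x)
         \<le> binom_cdf (card S) w k"
        using prob_cnt_less[OF N(1) J''(2,4) Es, of x k] w[OF x] by (simp add: c2)
    qed auto
    thus "\<P>(X in PiM J' (\<lambda>_. N). (X(j := x)) j \<in> B \<and> cnt S (X(j := x)) (E ((X(j := x)) j)) < k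
          \<and> (X(j := x)) i \<in> E ((X(j := x)) j)) \<le> binom_cdf (card S) w k * w"
      using x w[OF x] J by (simp add: c1)
  qed auto
qed auto

subsection \<open>Poisson approximation for nearly empty balls\<close>

text \<open>\<open>E x\<close> is the ball of mass \<open>v\<close> around \<open>x\<close>, \<open>Q\<close> excludes a boundary layer, \<open>Nr x\<close> contains all points of \<open>Q\<close>
  whose ball meets \<open>E x\<close>, and \<open>Cl x\<close> consists of points so close to \<open>x\<close> that no lower bound on the mass of
  \<open>E y - E x\<close> is available.\<close>
locale ball_system = prob_space M for M :: "'a measure" +
  fixes E Nr Cl :: "'a \<Rightarrow> 'a set" and Q :: "'a set" and v u \<eta> w1 w2 :: real and k :: nat
  assumes space_UNIV: "space M = UNIV"
    and E_pred: "Measurable.pred (M \<Otimes>\<^sub>M M) (\<lambda>(x, y). y \<in> E x)"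
    and Nr_pred: "Measurable.pred (M \<Otimes>\<^sub>M M) (\<lambda>(x, y). y \<in> Nr x)"
    and Cl_pred: "Measurable.pred (M \<Otimes>\<^sub>M M) (\<lambda>(x, y). y \<in> Cl x)"
    and Q_sets: "Q \<in> sets M"
    and E_mass: "measure M (E x) = v"
    and v_pos: "0 < v" and v_half: "v \<le> 1 / 2"
    and self: "x \<in> E x"
    and sep: "x \<in> Q \<Longrightarrow> y \<in> Q \<Longrightarrow> y \<notin> Nr x \<Longrightarrow> E x \<inter> E y = {}"
    and Nr_mass: "x \<in> Q \<Longrightarrow> measure M (Nr x) \<le> u"
    and Cl_mass: "x \<in> Q \<Longrightarrow> measure M (Cl x) \<le> \<eta>"
    and diff_mass_in: "x \<in> Q \<Longrightarrow> y \<in> Q \<Longrightarrow> y \<in> E x \<Longrightarrow> y \<notin> Cl x \<Longrightarrow> w1 \<le> measure M (E y - E x)"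
    and diff_mass_out: "x \<in> Q \<Longrightarrow> y \<in> Q \<Longrightarrow> y \<notin> E x \<Longrightarrow> w2 \<le> measure M (E y - E x)"
    and u_nonneg: "0 \<le> u" and \<eta>_nonneg: "0 \<le> \<eta>"
begin

abbreviation iid :: "'i set \<Rightarrow> ('i \<Rightarrow> 'a) measure" where "iid J \<equiv> PiM J (\<lambda>_. M)"

abbreviation cdf :: "nat \<Rightarrow> nat \<Rightarrow> real" where "cdf m a \<equiv> binom_cdf m v a"

definition good :: "'i set \<Rightarrow> ('i \<Rightarrow> 'a) \<Rightarrow> 'i \<Rightarrow> bool" where
  "good J X j \<longleftrightarrow> X j \<in> Q \<and> cnt (J - {j}) X (E (X j)) < k"

definition num_good :: "'i set \<Rightarrow> ('i \<Rightarrow> 'a) \<Rightarrow> nat" where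
  "num_good J X = card {j \<in> J. good J X j}"

text \<open>The centre \<open>x\<close> is a parameter and not a sampled point, and goodness is
  judged among \<open>J\<close> alone. For \<open>x\<close> in \<open>Q\<close> this makes the
  statistic a function of the points outside \<open>E x\<close>.\<close>

definition num_far :: "'a \<Rightarrow> 'i set \<Rightarrow> ('i \<Rightarrow> 'a) \<Rightarrow> nat" where
  "num_far x J X = card {j \<in> J. X j \<notin> Nr x \<and> good J X j}"

lemma prob_space_M: "prob_space M"
  by unfold_locales

lemma E_sets: "E x \<in> sets M"
  using E_pred space_UNIV by (rule section_sets)

lemma Nr_sets: "Nr x \<in> sets M"
  using Nr_pred space_UNIV by (rule section_sets)

lemma Cl_sets: "Cl x \<in> sets M"
  using Cl_pred space_UNIV by (rule section_sets)

lemma cdf_nonneg: "0 \<le> cdf m a"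
  using v_pos v_half by (intro binom_cdf_nonneg) auto

lemma pred_good:
  assumes "sets N = sets M" "finite J" "J \<subseteq> J'" "j \<in> J"
  shows "Measurable.pred (PiM J' (\<lambda>_. N)) (\<lambda>X. good J X j)"
  unfolding good_def using assms Q_sets
  by (intro pred_intros_logic pred_component pred_cnt_pair[OF E_pred assms(1)]) auto

lemma num_far_cong:
  assumes "\<And>j. j \<in> J \<Longrightarrow> X j = Y j"
  shows "num_far x J X = num_far x J Y"
proof -
  have "good J X j = good J Y j" if "j \<in> J" for j
  proof -
    have "cnt (J - {j}) X (E (Y j)) = cnt (J - {j}) Y (E (Y j))"
      by (rule cnt_cong) (use assms in auto)
    thus ?thesis using assms[OF that] by (simp add: good_def)
  qed
  thus ?thesis unfolding num_far_def using assms by (auto intro!: arg_cong[where f = card])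
qed

lemma measurable_num_far:
  assumes "sets N = sets M" "finite J" "J \<subseteq> J'"
  shows "(\<lambda>X. num_far x J X) \<in> measurable (PiM J' (\<lambda>_. N)) (count_space UNIV)"
  unfolding num_far_def using assms Nr_sets
  by (intro measurable_card_pred pred_intros_logic pred_component pred_good) auto

lemma measurable_num_good:
  assumes "finite J"
  shows "(\<lambda>X. num_good J X) \<in> measurable (iid J) (count_space UNIV)"
  unfolding num_good_def using assms by (intro measurable_card_pred pred_good) auto

text \<open>If \<open>X j\<close> is good and not in \<open>Nr x\<close>, its ball is disjoint from
  \<open>E x\<close>: neither \<open>X j\<close> nor any point counted for it lies in
  \<open>E x\<close>. This supplies the hypothesis \<open>h\<close> of
  \<open>cnt_decorrelation\<close>.\<close>

lemma num_far_outside: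
  assumes x: "x \<in> Q"
  shows "num_far x J X = num_far x (outside_idx J (E x) X) X"
proof -
  let ?O = "outside_idx J (E x) X"
  have "j \<in> ?O \<and> cnt (?O - {j}) X (E (X j)) = cnt (J - {j}) X (E (X j))"
    if j: "j \<in> J" "X j \<in> Q" "X j \<notin> Nr x" for j
  proof -
    have d: "E x \<inter> E (X j) = {}" using sep x j by auto
    hence "X j \<notin> E x" using self[of "X j"] by auto
    moreover have "{l \<in> ?O - {j}. X l \<in> E (X j)} = {l \<in> J - {j}. X l \<in> E (X j)}"
      using d by (auto simp: outside_idx_def)
    ultimately show ?thesis using j by (simp add: cnt_def outside_idx_def)
  qed
  hence "{j \<in> J. X j \<notin> Nr x \<and> good J X j} = {j \<in> ?O. X j \<notin> Nr x \<and> good ?O X j}"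
    using outside_subset[of J "E x" X] unfolding good_def by auto
  thus ?thesis unfolding num_far_def by simp
qed

abbreviation cond :: "'a \<Rightarrow> 'a measure" where "cond x \<equiv> uniform_measure M (space M - E x)"

lemma compl_E_nz: "emeasure M (space M - E x) \<noteq> 0"
  using E_sets[of x] E_mass[of x] v_half by (simp add: emeasure_eq_measure prob_compl)

lemma prob_cond: "prob_space (cond x)"
  using compl_E_nz by (intro prob_space_uniform_measure) auto

text \<open>\<open>E y\<close> lies in the complement of \<open>E x\<close>, so conditioning only
  divides its mass by \<open>1 - v\<close>. The value is the same for all such \<open>y\<close>, as
  \<open>prob_own_cnt_less\<close> requires.\<close>

lemma cond_far:
  assumes "x \<in> Q" "y \<in> Q" "y \<notin> Nr x"
  shows "measure (cond x) (E y) = v / (1 - v)"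
proof -
  have "(space M - E x) \<inter> E y = E y" using sep[OF assms] space_UNIV by auto
  thus ?thesis
    using compl_E_nz[of x] E_sets[of x] E_sets[of y] E_mass[of x] E_mass[of y]
    by (subst measure_uniform_measure) (auto simp: prob_compl)
qed

text \<open>The effect of deleting one of \<open>m\<close> indices. For a change, the deleted point
  must be good or lie in the ball of a good point; \<open>2 * m * v\<close> comes from at most
  \<open>m\<close> balls, each hit with probability at most \<open>2 * v\<close> under the
  conditioned law, and the exponential is the price of goodness among at least
  \<open>m / 2 - 1\<close> others. The summand \<open>2 / m\<close> covers the deletion of more than
  half of the indices.\<close>

definition err_delete :: "nat \<Rightarrow> real" where
  "err_delete m = tail_const k * (1 + 2 * real m * v) * exp (- ((real m / 2 - 1) * v / 2)) + 2 / real m"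

text \<open>By coupling: the sample over \<open>S\<close> is the restriction of the sample over
  \<open>J\<close>, so it suffices to bound the probability that the two counts differ.\<close>

lemma num_far_delete:
  fixes J :: "'i set"
  assumes x: "x \<in> Q" and J: "finite J" and S: "S \<subseteq> J"
    and b: "\<And>a. \<bar>b a\<bar> \<le> (G :: real)"
  shows "\<bar>(\<integral>X. b (num_far x S X) \<partial>PiM S (\<lambda>_. cond x)) - (\<integral>X. b (num_far x J X) \<partial>PiM J (\<lambda>_. cond x))\<bar>
    \<le> 2 * G * err_delete (card J) * real (card (J - S))"
proof (cases "S = J")
  case True
  thus ?thesis by simp
next
  case False
  let ?N = "PiM J (\<lambda>_. cond x)"
  let ?m = "card J"
  let ?JJ = "\<integral>X. b (num_far x J X) \<partial>?N"
  let ?S = "\<integral>X. b (num_far x S X) \<partial>PiM S (\<lambda>_. cond x)"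
  define w where "w = v / (1 - v)"
  define B where "B = Q - Nr x"
  define \<epsilon> where "\<epsilon> = tail_const k * exp (- ((real ?m / 2 - 1) * v / 2))"
  have G0: "0 \<le> G" using order.trans[OF abs_ge_zero b] .
  have w: "v \<le> w" "0 \<le> w" "w \<le> 1" "w \<le> 2 * v"
    using v_pos v_half by (auto simp: w_def field_simps)
  have \<epsilon>0: "0 \<le> \<epsilon>" unfolding \<epsilon>_def using tail_const_nonneg by simp
  have sN: "sets (cond x) = sets M" by simp
  interpret N: prob_space ?N using prob_cond by (rule prob_space_PiM_const)
  interpret C: prob_space "cond x" by (rule prob_cond)
  have fS: "finite S" using S J finite_subset by auto
  have Bs: "B \<in> sets (cond x)" using Q_sets Nr_sets by (auto simp: B_def)
  have Bw: "measure (cond x) (E y) = w" if "y \<in> B" for y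
    using cond_far[OF x] that by (auto simp: B_def w_def)
  have cdfw: "binom_cdf a w k \<le> \<epsilon>" if "real ?m / 2 - 1 \<le> real a" for a
  proof -
    have "(real ?m / 2 - 1) * v \<le> real a * v" using that v_pos by (intro mult_right_mono) auto
    also have "\<dots> \<le> real a * w" using w by (intro mult_left_mono) auto
    finally have "exp (- (real a * w / 2)) \<le> exp (- ((real ?m / 2 - 1) * v / 2))" by simp
    hence "tail_const k * exp (- (real a * w / 2)) \<le> \<epsilon>"
      unfolding \<epsilon>_def by (intro mult_left_mono tail_const_nonneg)
    thus ?thesis using binom_cdf_le_exp[OF w(2,3), of a k] by linarith
  qed
  have m0: "0 < ?m" using False S J by (auto simp: card_gt_0_iff)
  have "card (J - S) > 0" using False S J by (auto simp: card_gt_0_iff)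
  note meas = measurable_num_far[OF sN]
  have "(?S) = (\<integral>X. b (num_far x S (restrict X S)) \<partial>?N)"
    by (rule integral_PiM_restrict[symmetric, OF prob_cond J S])
       (rule measurable_compose[OF meas[OF fS subset_refl]], simp)
  also have "\<dots> = (\<integral>X. b (num_far x S X) \<partial>?N)"
    by (intro Bochner_Integration.integral_cong refl arg_cong[where f = b] num_far_cong) auto
  finally have eq: "(?S) = (\<integral>X. b (num_far x S X) \<partial>?N)" .
  let ?R = "\<lambda>X. num_far x S X \<noteq> num_far x J X"
  have [measurable]: "(\<lambda>X. num_far x S X) \<in> measurable ?N (count_space UNIV)"
      "(\<lambda>X. num_far x J X) \<in> measurable ?N (count_space UNIV)"
    using meas[OF fS S] meas[OF J subset_refl] by auto
  \<comment> \<open>If fewer than half of the indices remain, \<open>2 / ?m * card (J - S)\<close>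
    is at least 1 and the bound is trivial. Otherwise each count runs over at least
    \<open>?m / 2 - 1\<close> indices, which makes goodness rare.\<close>
  have R: "\<P>(X in ?N. ?R X) \<le> err_delete ?m * real (card (J - S))"
  proof (cases "2 * card S < ?m")
    case True
    have "real (card (J - S)) = real ?m - real (card S)"
      using S J fS card_mono[OF J S] by (simp add: card_Diff_subset of_nat_diff)
    hence "1 \<le> 2 / real ?m * real (card (J - S))"
      using True m0 by (simp add: field_simps)
    also have "\<dots> \<le> err_delete ?m * real (card (J - S))"
      unfolding err_delete_def using tail_const_nonneg[of k] v_pos by (intro mult_right_mono) auto
    finally show ?thesis using N.prob_le_1 by (rule order.trans[rotated])
  next
    case False
    hence S2: "real ?m / 2 - 1 \<le> real (card S - 1)" "real ?m / 2 - 1 \<le> real (?m - 1)"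
      using m0 by auto
    define A where "A j = {X \<in> space ?N. X j \<in> B \<and> cnt (J - {j}) X (E (X j)) < k}" for j
    define H where "H j i = {X \<in> space ?N. X i \<in> B \<and> cnt (S - {i}) X (E (X i)) < k \<and> X j \<in> E (X i)}" for j i
    have Am: "A j \<in> sets ?N" if "j \<in> J" for j
    proof -
      have "Measurable.pred ?N (\<lambda>X. X j \<in> B \<and> cnt (J - {j}) X (E (X j)) < k)"
        using that J Bs by (intro pred_intros_logic pred_component pred_cnt_pair[OF E_pred sN]) auto
      thus ?thesis unfolding A_def pred_def .
    qed
    have Hm: "H j i \<in> sets ?N" if "j \<in> J" "i \<in> S" for j i
    proof -
      have "Measurable.pred ?N (\<lambda>X. X i \<in> B \<and> cnt (S - {i}) X (E (X i)) < k \<and> X j \<in> E (X i))"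
        using that J Bs S fS
        by (intro pred_intros_logic pred_component pred_cnt_pair[OF E_pred sN] pred_PiM_pair[OF E_pred sN]) auto
      thus ?thesis unfolding H_def pred_def .
    qed
    have AHm: "A j \<union> (\<Union>i\<in>S. H j i) \<in> sets ?N" if "j \<in> J" for j
      using Am[OF that] Hm[OF that] fS by (intro sets.Un sets.finite_UN) auto
    have Ap: "measure ?N (A j) \<le> \<epsilon>" if j: "j \<in> J" for j
    proof -
      have "measure ?N (A j) \<le> binom_cdf (card (J - {j})) w k * measure (cond x) B"
        unfolding A_def by (rule prob_own_cnt_less[OF prob_cond sN space_UNIV E_pred J j subset_refl Bs Bw])
      also have "\<dots> \<le> binom_cdf (card (J - {j})) w k"
        using w by (intro mult_left_le binom_cdf_nonneg) auto
      also have "\<dots> \<le> \<epsilon>" using S2 j J by (intro cdfw) auto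
      finally show ?thesis .
    qed
    have Hp: "measure ?N (H j i) \<le> \<epsilon> * (2 * v)" if j: "j \<in> J - S" and i: "i \<in> S" for j i
    proof -
      have ij: "j \<noteq> i" using j i by auto
      have "measure ?N (H j i) \<le> binom_cdf (card (S - {i})) w k * w * measure (cond x) B"
        unfolding H_def
        by (rule prob_own_cnt_less_hit[OF prob_cond sN space_UNIV E_pred J _ _ ij _ Bs Bw]) (use S i j in auto)
      also have "\<dots> \<le> binom_cdf (card (S - {i})) w k * w"
        using w by (intro mult_left_le mult_nonneg_nonneg binom_cdf_nonneg) auto
      also have "\<dots> \<le> \<epsilon> * (2 * v)"
        using S2 i fS w \<epsilon>0 by (intro mult_mono cdfw) auto
      finally show ?thesis .
    qed
    \<comment> \<open>The counts can differ only if a deleted point was good itself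
      (\<open>A\<close>), or if it lies in the ball of a remaining point that is good among
      \<open>S\<close> (\<open>H\<close>).\<close>
    have "{X \<in> space ?N. ?R X} \<subseteq> (\<Union>j\<in>J - S. A j \<union> (\<Union>i\<in>S. H j i))"
    proof (intro subsetI, elim CollectE conjE, rule ccontr)
      fix X assume X: "X \<in> space ?N" "?R X" "X \<notin> (\<Union>j\<in>J - S. A j \<union> (\<Union>i\<in>S. H j i))"
      have nA: "\<not> (X j \<in> B \<and> cnt (J - {j}) X (E (X j)) < k)" if "j \<in> J - S" for j
        using X that by (auto simp: A_def)
      have nH: "\<not> (X i \<in> B \<and> cnt (S - {i}) X (E (X i)) < k \<and> X j \<in> E (X i))" if "j \<in> J - S" "i \<in> S" for i j
        using X that by (auto simp: H_def)
      have "{j \<in> S. X j \<notin> Nr x \<and> good S X j} = {j \<in> J. X j \<notin> Nr x \<and> good J X j}"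
      proof (intro set_eqI iffI)
        fix i assume "i \<in> {j \<in> S. X j \<notin> Nr x \<and> good S X j}"
        hence i: "i \<in> S" "X i \<in> B" "cnt (S - {i}) X (E (X i)) < k" by (auto simp: good_def B_def)
        have "{l \<in> S - {i}. X l \<in> E (X i)} = {l \<in> J - {i}. X l \<in> E (X i)}"
          using nH[of _ i] i S by auto
        thus "i \<in> {j \<in> J. X j \<notin> Nr x \<and> good J X j}"
          using i S by (auto simp: good_def B_def cnt_def)
      next
        fix i assume "i \<in> {j \<in> J. X j \<notin> Nr x \<and> good J X j}"
        hence i: "i \<in> J" "X i \<in> B" "cnt (J - {i}) X (E (X i)) < k" by (auto simp: good_def B_def)
        have iS: "i \<in> S" using nA[of i] i by auto
        have "cnt (S - {i}) X (E (X i)) \<le> cnt (J - {i}) X (E (X i))"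
          using S J by (intro cnt_mono) auto
        thus "i \<in> {j \<in> S. X j \<notin> Nr x \<and> good S X j}"
          using i iS by (auto simp: good_def B_def)
      qed
      thus False using X(2) unfolding num_far_def by simp
    qed
    hence "\<P>(X in ?N. ?R X) \<le> measure ?N (\<Union>j\<in>J - S. A j \<union> (\<Union>i\<in>S. H j i))"
      using AHm J by (intro N.finite_measure_mono sets.finite_UN) auto
    also have "\<dots> \<le> (\<Sum>j\<in>J - S. measure ?N (A j \<union> (\<Union>i\<in>S. H j i)))"
      using AHm J by (intro N.finite_measure_subadditive_finite) auto
    also have "\<dots> \<le> (\<Sum>j\<in>J - S. \<epsilon> + real ?m * (\<epsilon> * (2 * v)))"
    proof (intro sum_mono)
      fix j assume j: "j \<in> J - S"
      have "measure ?N (A j \<union> (\<Union>i\<in>S. H j i)) \<le> measure ?N (A j) + measure ?N (\<Union>i\<in>S. H j i)"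
        using Am Hm j fS by (intro measure_Un_le) auto
      also have "measure ?N (\<Union>i\<in>S. H j i) \<le> (\<Sum>i\<in>S. measure ?N (H j i))"
        using Hm j fS by (intro N.finite_measure_subadditive_finite) auto
      also have "\<dots> \<le> (\<Sum>i\<in>S. \<epsilon> * (2 * v))"
        using Hp j by (intro sum_mono) auto
      also have "\<dots> \<le> real ?m * (\<epsilon> * (2 * v))"
        using card_mono[OF J S] \<epsilon>0 v_pos by (simp add: mult_right_mono)
      finally show "measure ?N (A j \<union> (\<Union>i\<in>S. H j i)) \<le> \<epsilon> + real ?m * (\<epsilon> * (2 * v))"
        using Ap[of j] j by simp
    qed
    also have "\<dots> = (\<epsilon> * (1 + 2 * real ?m * v)) * real (card (J - S))"
      by (simp add: algebra_simps)
    also have "\<dots> \<le> err_delete ?m * real (card (J - S))"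
      unfolding err_delete_def \<epsilon>_def by (intro mult_right_mono) (auto simp: mult_ac)
    finally show ?thesis .
  qed
  have "\<bar>(\<integral>X. b (num_far x S X) \<partial>?N) - (?JJ)\<bar> \<le> 2 * G * \<P>(X in ?N. ?R X)"
    by (rule N.integral_diff_le_prob) (use b in auto)
  also have "\<dots> \<le> 2 * G * (err_delete ?m * real (card (J - S)))"
    using R G0 by (intro mult_left_mono) auto
  finally show ?thesis unfolding eq by (simp add: mult.assoc)
qed

lemma err_delete_nonneg: "0 \<le> err_delete m"
  unfolding err_delete_def using tail_const_nonneg[of k] v_pos by (intro add_nonneg_nonneg mult_nonneg_nonneg) auto

lemma num_far_decorrelation:
  fixes J :: "'i set"
  assumes x: "x \<in> Q" and J: "finite J" and b: "\<And>a. \<bar>b a\<bar> \<le> (G :: real)"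
  shows "\<bar>(\<integral>X. of_bool (cnt J X (E x) < k) * b (num_far x J X) \<partial>iid J)
      - cdf (card J) k * (\<integral>X. b (num_far x J X) \<partial>iid J)\<bar>
    \<le> 2 * G * err_delete (card J) * cdf (card J) k * (real k + real (card J) * v)"
proof -
  have G0: "0 \<le> G" using order.trans[OF abs_ge_zero b] .
  have "\<bar>(\<integral>X. of_bool (cnt J X (E x) < k) * b (num_far x J X) \<partial>iid J)
      - binom_cdf (card J) (measure M (E x)) k * (\<integral>X. b (num_far x J X) \<partial>iid J)\<bar>
    \<le> 2 * G * err_delete (card J) * binom_cdf (card J) (measure M (E x)) k * (real k + real (card J) * measure M (E x))"
  proof (rule cnt_decorrelation[where F = "\<lambda>S X. b (num_far x S X)" and G = G])
    show "(\<lambda>X. b (num_far x S X)) \<in> borel_measurable (PiM S (\<lambda>_. M))" if "S \<subseteq> J" for S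
    proof -
      have "finite S" using that J finite_subset by auto
      hence [measurable]: "(\<lambda>X. num_far x S X) \<in> measurable (PiM S (\<lambda>_. M)) (count_space UNIV)"
        by (intro measurable_num_far) auto
      show ?thesis by measurable
    qed
    show "b (num_far x J X) = b (num_far x (outside_idx J (E x) X) (restrict X (outside_idx J (E x) X)))" for X
    proof -
      have "num_far x (outside_idx J (E x) X) (restrict X (outside_idx J (E x) X)) = num_far x (outside_idx J (E x) X) X"
        by (rule num_far_cong) auto
      thus ?thesis using num_far_outside[OF x, of J X] by simp
    qed
    show "\<bar>(\<integral>X. b (num_far x S X) \<partial>PiM S (\<lambda>_. cond x)) - (\<integral>X. b (num_far x J X) \<partial>PiM J (\<lambda>_. cond x))\<bar>
      \<le> 2 * G * err_delete (card J) * real (card (J - S))" if "S \<subseteq> J" for S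
      by (rule num_far_delete[OF x J that b])
  qed (use J E_sets E_mass v_pos v_half b G0 err_delete_nonneg prob_space_M in auto)
  thus ?thesis by (simp add: E_mass)
qed

end

section \<open>From the far count to the full count, and pairs of good points close to each
  other\<close>

context ball_system
begin

lemma prob_good_le:
  assumes "finite J" "i \<in> J" "B \<in> sets M"
  shows "\<P>(X in iid J. X i \<in> B \<and> cnt (J - {i}) X (E (X i)) < k) \<le> cdf (card J - 1) k * measure M B"
  using prob_own_cnt_less[OF prob_space_M refl space_UNIV E_pred assms(1,2) subset_refl assms(3) E_mass] assms
  by simp

text \<open>Three causes of a difference: the added point is good (\<open>A\<close>), a good point
  lies in \<open>Nr x\<close> (\<open>B j\<close>), or the added point falls into the ball of a
  point that is good without it (\<open>H j\<close>).\<close>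

lemma prob_num_far_neq_num_good:
  fixes J :: "'i set"
  assumes x: "x \<in> Q" and J: "finite J" "i \<notin> J"
  shows "\<P>(X in iid (insert i J). num_far x J X \<noteq> num_good (insert i J) X)
    \<le> cdf (card J) k * (1 + real (card J) * u) + real (card J) * (cdf (card J - 1) k * v)"
proof -
  let ?J = "insert i J"
  let ?P = "iid ?J"
  let ?m = "card J"
  interpret P: prob_space ?P using prob_space_M by (rule prob_space_PiM_const)
  define A where "A = {X \<in> space ?P. X i \<in> Q \<and> cnt (?J - {i}) X (E (X i)) < k}"
  define B where "B j = {X \<in> space ?P. X j \<in> Nr x \<inter> Q \<and> cnt (?J - {j}) X (E (X j)) < k}" for j
  define H where "H j = {X \<in> space ?P. X j \<in> Q \<and> cnt (J - {j}) X (E (X j)) < k \<and> X i \<in> E (X j)}" for j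
  have Am: "A \<in> sets ?P"
  proof -
    have "Measurable.pred ?P (\<lambda>X. X i \<in> Q \<and> cnt (?J - {i}) X (E (X i)) < k)"
      using J Q_sets by (intro pred_intros_logic pred_component pred_cnt_pair[OF E_pred refl]) auto
    thus ?thesis unfolding A_def pred_def .
  qed
  have Bm: "B j \<in> sets ?P" if "j \<in> J" for j
  proof -
    have "Measurable.pred ?P (\<lambda>X. X j \<in> Nr x \<inter> Q \<and> cnt (?J - {j}) X (E (X j)) < k)"
      using J Q_sets Nr_sets that by (intro pred_intros_logic pred_component pred_cnt_pair[OF E_pred refl]) auto
    thus ?thesis unfolding B_def pred_def .
  qed
  have Hm: "H j \<in> sets ?P" if "j \<in> J" for j
  proof -
    have "Measurable.pred ?P (\<lambda>X. X j \<in> Q \<and> cnt (J - {j}) X (E (X j)) < k \<and> X i \<in> E (X j))"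
      using J Q_sets that
      by (intro pred_intros_logic pred_component pred_cnt_pair[OF E_pred refl] pred_PiM_pair[OF E_pred refl]) auto
    thus ?thesis unfolding H_def pred_def .
  qed
  have BHm: "B j \<union> H j \<in> sets ?P" if "j \<in> J" for j using Bm Hm that by auto
  have UBH: "(\<Union>j\<in>J. B j \<union> H j) \<in> sets ?P"
    using J(1) BHm by (rule sets.finite_UN)
  have Ap: "measure ?P A \<le> cdf ?m k"
  proof -
    have "measure ?P A \<le> cdf (card ?J - 1) k * measure M Q"
      unfolding A_def using J Q_sets by (intro prob_good_le) auto
    also have "\<dots> \<le> cdf (card ?J - 1) k" by (intro mult_left_le cdf_nonneg) auto
    finally show ?thesis using J by simp
  qed
  have Bp: "measure ?P (B j) \<le> cdf ?m k * u" if "j \<in> J" for j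
  proof -
    have "measure ?P (B j) \<le> cdf (card ?J - 1) k * measure M (Nr x \<inter> Q)"
      unfolding B_def using J Q_sets Nr_sets that by (intro prob_good_le) auto
    also have "measure M (Nr x \<inter> Q) \<le> u"
      using Nr_mass[OF x] Nr_sets finite_measure_mono[of "Nr x \<inter> Q" "Nr x"] by auto
    finally show ?thesis using J by (simp add: mult_left_mono cdf_nonneg)
  qed
  have Hp: "measure ?P (H j) \<le> cdf (?m - 1) k * v" if j: "j \<in> J" for j
  proof -
    have ij: "i \<noteq> j" using J j by auto
    have "measure ?P (H j) \<le> cdf (card (J - {j})) k * v * measure M Q"
      unfolding H_def
      by (rule prob_own_cnt_less_hit[OF prob_space_M refl space_UNIV E_pred _ _ _ ij _ Q_sets E_mass]) (use J j in auto)
    also have "\<dots> \<le> cdf (card (J - {j})) k * v"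
      using v_pos by (intro mult_left_le mult_nonneg_nonneg cdf_nonneg) auto
    finally show ?thesis using J j by simp
  qed
  have "{X \<in> space ?P. num_far x J X \<noteq> num_good ?J X} \<subseteq> A \<union> (\<Union>j\<in>J. B j \<union> H j)"
  proof (intro subsetI, elim CollectE conjE, rule ccontr)
    fix X assume X: "X \<in> space ?P" "num_far x J X \<noteq> num_good ?J X" "X \<notin> A \<union> (\<Union>j\<in>J. B j \<union> H j)"
    have nA: "\<not> good ?J X i" using X by (auto simp: A_def good_def)
    have nB: "\<not> (X j \<in> Nr x \<and> good ?J X j)" if "j \<in> J" for j
      using X that by (auto simp: B_def good_def)
    have nH: "\<not> (X j \<in> Q \<and> cnt (J - {j}) X (E (X j)) < k \<and> X i \<in> E (X j))" if "j \<in> J" for j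
      using X that by (auto simp: H_def)
    have "{j \<in> J. X j \<notin> Nr x \<and> good J X j} = {j \<in> ?J. good ?J X j}"
    proof (intro set_eqI iffI)
      fix j assume "j \<in> {j \<in> J. X j \<notin> Nr x \<and> good J X j}"
      hence j: "j \<in> J" "X j \<in> Q" "cnt (J - {j}) X (E (X j)) < k" by (auto simp: good_def)
      have "{l \<in> J - {j}. X l \<in> E (X j)} = {l \<in> ?J - {j}. X l \<in> E (X j)}"
        using nH[of j] j by auto
      thus "j \<in> {j \<in> ?J. good ?J X j}"
        using j by (auto simp: good_def cnt_def)
    next
      fix j assume j: "j \<in> {j \<in> ?J. good ?J X j}"
      hence jJ: "j \<in> J" using nA by auto
      have "cnt (J - {j}) X (E (X j)) \<le> cnt (?J - {j}) X (E (X j))"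
        using J by (intro cnt_mono) auto
      thus "j \<in> {j \<in> J. X j \<notin> Nr x \<and> good J X j}"
        using j jJ nB[OF jJ] by (auto simp: good_def)
    qed
    thus False using X(2) unfolding num_far_def num_good_def by simp
  qed
  hence "\<P>(X in ?P. num_far x J X \<noteq> num_good ?J X) \<le> measure ?P (A \<union> (\<Union>j\<in>J. B j \<union> H j))"
    using Am UBH by (intro P.finite_measure_mono) auto
  also have "\<dots> \<le> measure ?P A + measure ?P (\<Union>j\<in>J. B j \<union> H j)"
    using Am UBH by (intro measure_Un_le) auto
  also have "measure ?P (\<Union>j\<in>J. B j \<union> H j) \<le> (\<Sum>j\<in>J. measure ?P (B j \<union> H j))"
    using BHm J by (intro P.finite_measure_subadditive_finite) auto
  also have "\<dots> \<le> (\<Sum>j\<in>J. cdf ?m k * u + cdf (?m - 1) k * v)"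
  proof (intro sum_mono)
    fix j assume j: "j \<in> J"
    have "measure ?P (B j \<union> H j) \<le> measure ?P (B j) + measure ?P (H j)"
      using Bm Hm j by (intro measure_Un_le) auto
    thus "measure ?P (B j \<union> H j) \<le> cdf ?m k * u + cdf (?m - 1) k * v"
      using Bp[OF j] Hp[OF j] by linarith
  qed
  finally show ?thesis using Ap by (simp add: algebra_simps)
qed

text \<open>The summands belong to a second good point inside and outside \<open>E x\<close>;
  \<open>m - 1\<close> indices remain besides the pair. A point inside takes one of the fewer than
  \<open>k\<close> places of \<open>E x\<close>, hence the first \<open>k - 1\<close>.
  \<open>\<eta>\<close> accounts for points too close to be separated, and the exponentials for
  \<open>E y - E x\<close> being nearly empty.\<close>

definition pair_bound :: "nat \<Rightarrow> real" where
  "pair_bound m = cdf (m - 1) (k - 1) * (\<eta> + tail_const k * exp (- (real (m - 1 - (k - 1)) * w1 / 2)) * v)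
     + cdf (m - 1) k * (tail_const k * exp (- (real (m - 1 - k) * w2 / 2))) * u"

lemma pair_bound_nonneg: "0 \<le> pair_bound m"
  unfolding pair_bound_def
  using cdf_nonneg tail_const_nonneg[of k] u_nonneg \<eta>_nonneg v_pos
  by (intro add_nonneg_nonneg mult_nonneg_nonneg) auto

lemma prob_two_cnt:
  assumes L: "finite L" "j \<notin> L" and B: "B \<in> sets M" and c: "0 \<le> c"
    and le: "\<And>y. y \<in> B \<Longrightarrow> \<P>(X in iid L. cnt L X (E x) < a \<and> cnt L X (E y) < k) \<le> c"
  shows "\<P>(X in iid (insert j L). X j \<in> B \<and> cnt L X (E x) < a \<and> cnt L X (E (X j)) < k)
     \<le> c * measure M B"
proof (rule measure_PiM_insert_le[OF prob_space_M L _ B c])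
  have [measurable]: "(\<lambda>X. cnt L X (E x)) \<in> measurable (iid (insert j L)) (count_space UNIV)"
    using L E_sets by (intro measurable_cnt) auto
  have pc: "Measurable.pred (iid (insert j L)) (\<lambda>X. cnt L X (E x) < a)" by measurable
  show "Measurable.pred (iid (insert j L)) (\<lambda>X. X j \<in> B \<and> cnt L X (E x) < a \<and> cnt L X (E (X j)) < k)"
    using L B by (intro pred_intros_logic pc pred_component pred_cnt_pair[OF E_pred refl]) auto
  fix y assume y: "y \<in> B"
  have "cnt L (X(j := y)) A = cnt L X A" for X A using L by (intro cnt_cong) auto
  thus "\<P>(X in iid L. (X(j := y)) j \<in> B \<and> cnt L (X(j := y)) (E x) < a
      \<and> cnt L (X(j := y)) (E ((X(j := y)) j)) < k) \<le> c"
    using le[OF y] y by simp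
qed auto

lemma prob_pair:
  fixes J :: "'i set"
  assumes k: "1 \<le> k" and J: "finite J" "i \<notin> J" and j: "j \<in> J"
  shows "\<P>(X in iid (insert i J). good (insert i J) X i
       \<and> good (insert i J) X j \<and> X j \<in> Nr (X i)) \<le> pair_bound (card J)"
proof -
  let ?J = "insert i J"
  let ?m = "card J"
  define L where "L = J - {j}"
  have L: "J = insert j L" "finite L" "j \<notin> L" "i \<notin> L" "i \<noteq> j" "card L = ?m - 1"
    using J j by (auto simp: L_def)
  define T where "T a w = tail_const k * exp (- (real (?m - 1 - a) * w / 2))" for a w
  have T0: "0 \<le> T a w" for a w unfolding T_def using tail_const_nonneg by simp
  interpret PJ: prob_space "iid J" using prob_space_M by (rule prob_space_PiM_const)
  interpret PL: prob_space "iid L" using prob_space_M by (rule prob_space_PiM_const)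
  have fixed: "\<P>(X in iid J. cnt J X (E x) < k \<and> X j \<in> Q \<and> cnt L X (E (X j)) < k \<and> X j \<in> Nr x)
      \<le> pair_bound ?m" if x: "x \<in> Q" for x
  proof -
    define S where "S a B = {X \<in> space (iid J). X j \<in> B \<and> cnt L X (E x) < a \<and> cnt L X (E (X j)) < k}" for a B
    have Sm: "S a B \<in> sets (iid J)" if "B \<in> sets M" for a B
    proof -
      have [measurable]: "(\<lambda>X. cnt L X (E x)) \<in> measurable (iid J) (count_space UNIV)"
        using L E_sets by (intro measurable_cnt) auto
      have pc: "Measurable.pred (iid J) (\<lambda>X. cnt L X (E x) < a)" by measurable
      have "Measurable.pred (iid J) (\<lambda>X. X j \<in> B \<and> cnt L X (E x) < a \<and> cnt L X (E (X j)) < k)"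
        using L that by (intro pred_intros_logic pc pred_component pred_cnt_pair[OF E_pred refl]) auto
      thus ?thesis unfolding S_def pred_def .
    qed
    have Sle: "measure (iid J) (S a B) \<le> c * measure M B"
      if "B \<in> sets M" "0 \<le> c"
        "\<And>y. y \<in> B \<Longrightarrow> \<P>(X in iid L. cnt L X (E x) < a \<and> cnt L X (E y) < k) \<le> c" for a B c
      using prob_two_cnt[OF L(2,3) that] unfolding S_def L(1)[symmetric] .
    \<comment> \<open>Three places for \<open>X j\<close>: inside \<open>E x\<close> and too close
      to \<open>x\<close>, inside \<open>E x\<close> at some distance, and near but outside
      \<open>E x\<close>. Only the last two come with a lower bound on the mass of
      \<open>E (X j) - E x\<close>.\<close>
    define B1 where "B1 = Q \<inter> E x \<inter> Cl x"
    define B2 where "B2 = Q \<inter> E x - Cl x"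
    define B3 where "B3 = Q \<inter> Nr x - E x"
    have Bs: "B1 \<in> sets M" "B2 \<in> sets M" "B3 \<in> sets M"
      using Q_sets E_sets Nr_sets Cl_sets by (auto simp: B1_def B2_def B3_def)
    have Bp: "measure M B1 \<le> \<eta>" "measure M B2 \<le> v" "measure M B3 \<le> u"
    proof -
      have "measure M B1 \<le> measure M (Cl x)" using Cl_sets by (intro finite_measure_mono) (auto simp: B1_def)
      thus "measure M B1 \<le> \<eta>" using Cl_mass[OF x] by linarith
      have "measure M B2 \<le> measure M (E x)" using E_sets by (intro finite_measure_mono) (auto simp: B2_def)
      thus "measure M B2 \<le> v" using E_mass by simp
      have "measure M B3 \<le> measure M (Nr x)" using Nr_sets by (intro finite_measure_mono) (auto simp: B3_def)
      thus "measure M B3 \<le> u" using Nr_mass[OF x] by linarith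
    qed
    have two: "\<P>(X in iid L. cnt L X (E x) < a \<and> cnt L X (E y) < k) \<le> cdf (?m - 1) a * T a w"
      if "w \<le> measure M (E y - E x)" for a y w
      using prob_cnt_less_and[OF prob_space_M L(2) E_sets, of x "E y" w a k] that v_pos v_half E_sets
      by (simp add: E_mass L(6) T_def)
    have one: "\<P>(X in iid L. cnt L X (E x) < a \<and> cnt L X (E y) < k) \<le> cdf (?m - 1) a" for a y
    proof -
      have [measurable]: "(\<lambda>X. cnt L X (E x)) \<in> measurable (iid L) (count_space UNIV)"
        using L E_sets by (intro measurable_cnt) auto
      have "\<P>(X in iid L. cnt L X (E x) < a \<and> cnt L X (E y) < k)
         \<le> \<P>(X in iid L. cnt L X (E x) < a)"
        by (intro PL.finite_measure_mono) auto
      also have "\<dots> = cdf (?m - 1) a"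
        using prob_cnt_less[OF prob_space_M L(2) subset_refl E_sets, of x a] by (simp add: E_mass L(6))
      finally show ?thesis .
    qed
    have S1: "measure (iid J) (S (k - 1) B1) \<le> cdf (?m - 1) (k - 1) * \<eta>"
      using Sle[OF Bs(1) cdf_nonneg one] mult_left_mono[OF Bp(1) cdf_nonneg] by (rule order.trans)
    have S2: "measure (iid J) (S (k - 1) B2) \<le> cdf (?m - 1) (k - 1) * T (k - 1) w1 * v"
    proof (rule order.trans[OF Sle[OF Bs(2)]])
      show "\<P>(X in iid L. cnt L X (E x) < k - 1 \<and> cnt L X (E y) < k) \<le> cdf (?m - 1) (k - 1) * T (k - 1) w1"
        if "y \<in> B2" for y using diff_mass_in[OF x, of y] that by (intro two) (auto simp: B2_def)
      show "cdf (?m - 1) (k - 1) * T (k - 1) w1 * measure M B2 \<le> cdf (?m - 1) (k - 1) * T (k - 1) w1 * v"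
        by (intro mult_left_mono Bp mult_nonneg_nonneg cdf_nonneg T0)
    qed (intro mult_nonneg_nonneg cdf_nonneg T0)
    have S3: "measure (iid J) (S k B3) \<le> cdf (?m - 1) k * T k w2 * u"
    proof (rule order.trans[OF Sle[OF Bs(3)]])
      show "\<P>(X in iid L. cnt L X (E x) < k \<and> cnt L X (E y) < k) \<le> cdf (?m - 1) k * T k w2"
        if "y \<in> B3" for y using diff_mass_out[OF x, of y] that by (intro two) (auto simp: B3_def)
      show "cdf (?m - 1) k * T k w2 * measure M B3 \<le> cdf (?m - 1) k * T k w2 * u"
        by (intro mult_left_mono Bp mult_nonneg_nonneg cdf_nonneg T0)
    qed (intro mult_nonneg_nonneg cdf_nonneg T0)
    have "{X \<in> space (iid J). cnt J X (E x) < k \<and> X j \<in> Q \<and> cnt L X (E (X j)) < k \<and> X j \<in> Nr x}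
       \<subseteq> S (k - 1) B1 \<union> (S (k - 1) B2 \<union> S k B3)"
    proof
      fix X assume X: "X \<in> {X \<in> space (iid J). cnt J X (E x) < k \<and> X j \<in> Q \<and> cnt L X (E (X j)) < k \<and> X j \<in> Nr x}"
      \<comment> \<open>\<open>X j\<close> is itself counted for \<open>x\<close>: if it lies in
        \<open>E x\<close>, fewer than \<open>k - 1\<close> of the indices in \<open>L\<close>
        do.\<close>
      have "cnt J X (E x) = cnt L X (E x) + of_bool (X j \<in> E x)"
        using L by (simp add: cnt_insert)
      thus "X \<in> S (k - 1) B1 \<union> (S (k - 1) B2 \<union> S k B3)"
        using X by (auto simp: S_def B1_def B2_def B3_def split: if_splits)
    qed
    hence "\<P>(X in iid J. cnt J X (E x) < k \<and> X j \<in> Q \<and> cnt L X (E (X j)) < k \<and> X j \<in> Nr x)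
       \<le> measure (iid J) (S (k - 1) B1 \<union> (S (k - 1) B2 \<union> S k B3))"
      using Sm Bs by (intro PJ.finite_measure_mono) auto
    also have "\<dots> \<le> measure (iid J) (S (k - 1) B1) + measure (iid J) (S (k - 1) B2 \<union> S k B3)"
      using Sm Bs by (intro measure_Un_le) auto
    also have "measure (iid J) (S (k - 1) B2 \<union> S k B3) \<le> measure (iid J) (S (k - 1) B2) + measure (iid J) (S k B3)"
      using Sm Bs by (intro measure_Un_le) auto
    finally show ?thesis using S1 S2 S3 unfolding pair_bound_def T_def[symmetric] by (simp add: algebra_simps)
  qed
  have eqi: "J - {i} = J" using J by simp
  have "\<P>(X in iid ?J. good ?J X i \<and> good ?J X j \<and> X j \<in> Nr (X i)) \<le> pair_bound ?m * measure M Q"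
  proof (rule measure_PiM_insert_le[OF prob_space_M J _ Q_sets pair_bound_nonneg])
    have "finite ?J" using J by simp
    thus "Measurable.pred (iid ?J) (\<lambda>X. good ?J X i \<and> good ?J X j \<and> X j \<in> Nr (X i))"
      using j by (intro pred_intros_logic pred_good pred_PiM_pair[OF Nr_pred refl]) auto
    fix x assume x: "x \<in> Q"
    have c1: "cnt J (X(i := x)) A = cnt J X A" for X A using J by (intro cnt_cong) auto
    \<comment> \<open>Dropping \<open>i\<close> from the count of \<open>X j\<close> enlarges the
      event and leaves two counts over the same set \<open>L\<close>, which contains neither index
      of the pair.\<close>
    have c2: "cnt L X A \<le> cnt (?J - {j}) (X(i := x)) A" for X A
    proof -
      have "cnt L X A = cnt L (X(i := x)) A" using L by (intro cnt_cong) auto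
      also have "\<dots> \<le> cnt (?J - {j}) (X(i := x)) A" using J L by (intro cnt_mono) auto
      finally show ?thesis .
    qed
    have "\<P>(X in iid J. good ?J (X(i := x)) i \<and> good ?J (X(i := x)) j \<and> (X(i := x)) j \<in> Nr ((X(i := x)) i))
       \<le> \<P>(X in iid J. cnt J X (E x) < k \<and> X j \<in> Q \<and> cnt L X (E (X j)) < k \<and> X j \<in> Nr x)"
    proof (rule PJ.finite_measure_mono)
      show "{X \<in> space (iid J). good ?J (X(i := x)) i \<and> good ?J (X(i := x)) j \<and> (X(i := x)) j \<in> Nr ((X(i := x)) i)}
         \<subseteq> {X \<in> space (iid J). cnt J X (E x) < k \<and> X j \<in> Q \<and> cnt L X (E (X j)) < k \<and> X j \<in> Nr x}"
        using L(5) c2 by (auto simp: good_def c1 eqi intro: le_less_trans)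
      have [measurable]: "(\<lambda>X. cnt J X (E x)) \<in> measurable (iid J) (count_space UNIV)"
        using J E_sets by (intro measurable_cnt) auto
      have [measurable]: "Measurable.pred (iid J) (\<lambda>X. cnt L X (E (X j)) < k)"
        using L by (intro pred_cnt_pair[OF E_pred refl]) auto
      have [measurable]: "Measurable.pred (iid J) (\<lambda>X. X j \<in> Q)" "Measurable.pred (iid J) (\<lambda>X. X j \<in> Nr x)"
        using j Q_sets Nr_sets by (auto intro: pred_component)
      show "{X \<in> space (iid J). cnt J X (E x) < k \<and> X j \<in> Q \<and> cnt L X (E (X j)) < k \<and> X j \<in> Nr x} \<in> PJ.events"
        by measurable
    qed
    also have "\<dots> \<le> pair_bound ?m" by (rule fixed[OF x])
    finally show "\<P>(X in iid J. good ?J (X(i := x)) i \<and> good ?J (X(i := x)) j \<and> (X(i := x)) j \<in> Nr ((X(i := x)) i))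
       \<le> pair_bound ?m" .
  qed (auto simp: good_def)
  also have "\<dots> \<le> pair_bound ?m" by (intro mult_left_le pair_bound_nonneg) auto
  finally show ?thesis .
qed

end

section \<open>Stein's equation for the Poisson law\<close>

lemma stein_poisson:
  fixes l :: real
  assumes l: "0 < l"
  obtains g :: "nat \<Rightarrow> real" where "\<And>j. \<bar>g j\<bar> \<le> exp l"
    "\<And>j. l * g (Suc j) - real j * g j = of_bool (j \<in> A) - measure (measure_pmf (poisson_pmf l)) A"
proof -
  define P where "P = measure (measure_pmf (poisson_pmf l)) A"
  define h where "h i = of_bool (i \<in> A) - P" for i :: nat
  define a where "a i = h i * (l ^ i / fact i)" for i
  \<comment> \<open>The equation is a first-order recursion for \<open>g\<close>; multiplied by the
    Poisson weights \<open>l ^ i / fact i\<close> it telescopes, which gives this partial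
    sum.\<close>
  define g where "g j = (case j of 0 \<Rightarrow> 0 | Suc n \<Rightarrow> fact n / l ^ Suc n * (\<Sum>i\<le>n. a i))" for j
  have P01: "0 \<le> P" "P \<le> 1" by (auto simp: P_def)
  have h1: "\<bar>h i\<bar> \<le> 1" for i using P01 by (auto simp: h_def)
  have es: "(\<lambda>i. l ^ i / fact i) sums exp l"
    using exp_converges[of l] by (simp add: scaleR_conv_of_real field_simps)
  have Ps: "(\<lambda>i. of_bool (i \<in> A) * (l ^ i / fact i)) sums (P * exp l)"
  proof -
    have "(\<lambda>i. measure (measure_pmf (poisson_pmf l)) (A \<inter> {i})) sums measure (measure_pmf (poisson_pmf l)) (\<Union>i. A \<inter> {i})"
      by (rule measure_pmf.finite_measure_UNION) (auto simp: disjoint_family_on_def)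
    moreover have "measure (measure_pmf (poisson_pmf l)) (A \<inter> {i}) = of_bool (i \<in> A) * (l ^ i / fact i) * exp (- l)" for i
      using l by (cases "i \<in> A") (auto simp: measure_pmf_single)
    ultimately have "(\<lambda>i. of_bool (i \<in> A) * (l ^ i / fact i) * exp (- l)) sums P"
      by (simp add: P_def)
    from sums_mult2[OF this, of "exp l"] show ?thesis
      by (simp add: mult.assoc flip: exp_add)
  qed
  \<comment> \<open>The centred indicator \<open>h\<close> has Poisson mean 0. The partial sum in
    \<open>g\<close> is therefore minus the remaining tail, and the tail is what can be bounded
    uniformly in \<open>j\<close>.\<close>
  have a0: "a sums 0"
    using sums_diff[OF Ps sums_mult[OF es, of P]] by (simp add: a_def[abs_def] h_def left_diff_distrib diff_divide_distrib)
  show thesis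
  proof (rule that[of g])
    fix j
    show "l * g (Suc j) - real j * g j = of_bool (j \<in> A) - measure (measure_pmf (poisson_pmf l)) A"
    proof (cases j)
      case 0
      thus ?thesis using l by (simp add: g_def a_def h_def P_def)
    next
      case (Suc n)
      have "l * g (Suc j) = fact j / l ^ j * (\<Sum>i\<le>j. a i)"
        using l by (simp add: g_def field_simps)
      moreover have "real j * g j = fact j / l ^ j * (\<Sum>i\<le>n. a i)"
        by (simp add: g_def Suc)
      moreover have "(\<Sum>i\<le>j. a i) = (\<Sum>i\<le>n. a i) + a j" by (simp add: Suc)
      ultimately have "l * g (Suc j) - real j * g j = fact j / l ^ j * a j"
        by (simp add: algebra_simps)
      also have "\<dots> = h j" using l by (simp add: a_def)
      finally show ?thesis by (simp add: h_def P_def)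
    qed
    show "\<bar>g j\<bar> \<le> exp l"
    proof (cases j)
      case 0
      thus ?thesis by (simp add: g_def)
    next
      case (Suc n)
      define c where "c = fact n / l ^ Suc n"
      have tail: "(\<lambda>i. a (i + Suc n)) sums (- (\<Sum>i\<le>n. a i))"
        using a0 sums_split_initial_segment[of a 0 "Suc n"] by (simp add: lessThan_Suc_atMost)
      \<comment> \<open>Because \<open>fact n / fact (i + Suc n) \<le> 1 / fact i\<close>, the tail
        is dominated term by term by the series of \<open>exp l\<close>.\<close>
      have le: "\<bar>c * a (i + Suc n)\<bar> \<le> l ^ i / fact i" for i
      proof -
        have "fact i * fact n dvd (fact (i + n) :: nat)" by (rule fact_fact_dvd_fact)
        hence "fact i * fact n \<le> (fact (i + n) :: nat)" by (intro dvd_imp_le) auto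
        also have "\<dots> \<le> fact (i + Suc n)" by (intro fact_mono_nat) auto
        finally have f: "fact i * fact n \<le> (fact (i + Suc n) :: real)"
          by (metis of_nat_fact of_nat_le_iff of_nat_mult)
        have fr: "fact n / fact (i + Suc n) \<le> (1 / fact i :: real)"
          using f by (simp add: divide_simps mult.commute del: fact_Suc add_Suc_right)
        have "\<bar>c * a (i + Suc n)\<bar> = \<bar>h (i + Suc n)\<bar> * (fact n / fact (i + Suc n) * l ^ i)"
          using l by (simp add: c_def a_def abs_mult power_add field_simps)
        also have "\<dots> \<le> 1 * (1 / fact i * l ^ i)"
          using l by (intro mult_mono h1 mult_right_mono fr) auto
        finally show ?thesis by simp
      qed
      have s1: "summable (\<lambda>i. \<bar>c * a (i + Suc n)\<bar>)"
        by (rule summable_comparison_test'[OF sums_summable[OF es], of 0]) (use le in auto)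
      have "(\<Sum>i. c * a (i + Suc n)) = - g j"
        using sums_unique[OF sums_mult[OF tail, of c]] by (simp add: g_def Suc c_def)
      hence "\<bar>g j\<bar> = \<bar>\<Sum>i. c * a (i + Suc n)\<bar>" by simp
      also have "\<dots> \<le> (\<Sum>i. \<bar>c * a (i + Suc n)\<bar>)" by (rule summable_rabs[OF s1])
      also have "\<dots> \<le> (\<Sum>i. l ^ i / fact i)" by (rule suminf_le[OF le s1 sums_summable[OF es]])
      also have "\<dots> = exp l" using sums_unique[OF es] by simp
      finally show ?thesis .
    qed
  qed
qed

section \<open>Stein's method for the number of good points\<close>

context ball_system
begin

definition err_shift :: "nat \<Rightarrow> real" where
  "err_shift m = cdf m k * (1 + real m * u) + real m * (cdf (m - 1) k * v)"

text \<open>Error of \<open>good_term\<close> for test functions bounded by 1. In order: a second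
  good point nearby, the decorrelation of the far count from the number of points in the ball, the
  change from the far to the full count, and the layer outside \<open>Q\<close>, where a point is
  never good.\<close>

definition err_term :: "nat \<Rightarrow> real" where
  "err_term m = 2 * real m * pair_bound m
     + cdf m k * (2 * err_delete m * (real k + real m * v) + 2 * err_shift m + measure M (space M - Q))"

lemma integral_PiM_insert_rev:
  fixes f :: "('i \<Rightarrow> 'a) \<Rightarrow> real"
  assumes J: "finite J" "i \<notin> J" and f: "f \<in> borel_measurable (iid (insert i J))" and bd: "\<And>X. \<bar>f X\<bar> \<le> G"
  shows "(\<integral>X. f X \<partial>iid (insert i J)) = (\<integral>x. (\<integral>X. f (X(i := x)) \<partial>iid J) \<partial>M)"
    and "(\<lambda>x. \<integral>X. f (X(i := x)) \<partial>iid J) \<in> borel_measurable M"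
proof -
  interpret P: product_prob_space "\<lambda>_. M" J using prob_space_M by (rule product_prob_space_const)
  interpret I: prob_space "iid (insert i J)" using prob_space_M by (rule prob_space_PiM_const)
  interpret PJ: prob_space "iid J" using prob_space_M by (rule prob_space_PiM_const)
  interpret pair_prob_space "iid J" M ..
  have m: "(\<lambda>(X, x). f (X(i := x))) \<in> borel_measurable (iid J \<Otimes>\<^sub>M M)"
    using measurable_compose[OF measurable_add_dim f] by (simp add: case_prod_unfold)
  have m': "(\<lambda>(x, X). f (X(i := x))) \<in> borel_measurable (M \<Otimes>\<^sub>M iid J)"
    using measurable_compose[OF measurable_pair_swap' m] by (simp add: case_prod_unfold)
  have "integrable (iid (insert i J)) f"
    using f bd by (intro I.integrable_const_bound[where B = G]) auto
  from P.product_integral_insert[OF J this]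
  have "(\<integral>X. f X \<partial>iid (insert i J)) = (\<integral>X. (\<integral>x. f (X(i := x)) \<partial>M) \<partial>iid J)" .
  also have "\<dots> = (\<integral>x. (\<integral>X. f (X(i := x)) \<partial>iid J) \<partial>M)"
  proof (rule Fubini_integral[symmetric])
    show "integrable (iid J \<Otimes>\<^sub>M M) (\<lambda>(X, x). f (X(i := x)))"
      using m bd by (intro integrable_const_bound[where B = G]) auto
  qed
  finally show "(\<integral>X. f X \<partial>iid (insert i J)) = (\<integral>x. (\<integral>X. f (X(i := x)) \<partial>iid J) \<partial>M)" .
  show "(\<lambda>x. \<integral>X. f (X(i := x)) \<partial>iid J) \<in> borel_measurable M"
    using sigma_finite_measure.borel_measurable_lebesgue_integral[OF
      prob_space_imp_sigma_finite[OF prob_space_PiM_const[OF prob_space_M]] m'] by simp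
qed

lemma good_term:
  fixes J :: "'i set"
  assumes k: "1 \<le> k" and J: "finite J" "i \<notin> J" and g: "\<And>a. \<bar>g a\<bar> \<le> (G :: real)"
  shows "\<bar>(\<integral>X. of_bool (good (insert i J) X i) * g (num_good (insert i J) X) \<partial>iid (insert i J))
     - cdf (card J) k * (\<integral>X. g (Suc (num_good (insert i J) X)) \<partial>iid (insert i J))\<bar> \<le> G * err_term (card J)"
proof -
  let ?J = "insert i J"
  let ?P = "iid ?J"
  let ?m = "card J"
  let ?I = "\<integral>X. of_bool (good ?J X i) * g (num_good ?J X) \<partial>?P"
  define p where "p = cdf ?m k"
  have p0: "0 \<le> p" unfolding p_def by (rule cdf_nonneg)
  have G0: "0 \<le> G" using order.trans[OF abs_ge_zero g] .
  interpret P: prob_space ?P using prob_space_M by (rule prob_space_PiM_const)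
  interpret PJ: prob_space "iid J" using prob_space_M by (rule prob_space_PiM_const)
  have fJ: "finite ?J" using J by simp
  have mg [measurable]: "(\<lambda>X. num_good ?J X) \<in> measurable ?P (count_space UNIV)"
    using fJ by (rule measurable_num_good)
  have pg [measurable]: "Measurable.pred ?P (\<lambda>X. good ?J X i)" using fJ by (intro pred_good) auto
  have mf [measurable]: "(\<lambda>X. num_far (X i) J X) \<in> measurable ?P (count_space UNIV)"
    unfolding num_far_def using J
    by (intro measurable_card_pred pred_intros_logic pred_good pred_PiM_pair[OF Nr_pred refl]) auto
  define \<Gamma> where "\<Gamma> = (\<integral>X. g (Suc (num_good ?J X)) \<partial>?P)"
  have \<Gamma>: "\<bar>\<Gamma>\<bar> \<le> G"
  proof -
    have "\<bar>\<Gamma>\<bar> \<le> (\<integral>X. G \<partial>?P)" unfolding \<Gamma>_def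
    proof (rule order.trans[OF integral_abs_bound integral_mono])
      show "integrable ?P (\<lambda>X. \<bar>g (Suc (num_good ?J X))\<bar>)"
        using g by (intro P.integrable_const_bound[where B = G]) auto
    qed (use g in auto)
    thus ?thesis by (simp add: P.prob_space)
  qed
  define f where "f X = of_bool (good ?J X i) * g (Suc (num_far (X i) J X))" for X
  have fm: "f \<in> borel_measurable ?P" unfolding f_def by measurable
  have fb: "\<bar>f X\<bar> \<le> G" for X using g G0 by (auto simp: f_def)
  define R where "R X \<longleftrightarrow> (\<exists>j\<in>J. good ?J X i \<and> good ?J X j \<and> X j \<in> Nr (X i))" for X
  have Rm: "{X \<in> space ?P. good ?J X i \<and> good ?J X j \<and> X j \<in> Nr (X i)} \<in> P.events" if "j \<in> J" for j
  proof -
    have "Measurable.pred ?P (\<lambda>X. good ?J X i \<and> good ?J X j \<and> X j \<in> Nr (X i))"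
      using fJ that by (intro pred_intros_logic pred_good pred_PiM_pair[OF Nr_pred refl]) auto
    thus ?thesis unfolding pred_def .
  qed
  have Req: "{X \<in> space ?P. R X} = (\<Union>j\<in>J. {X \<in> space ?P. good ?J X i \<and> good ?J X j \<and> X j \<in> Nr (X i)})"
    by (auto simp: R_def)
  have Rmeas: "{X \<in> space ?P. R X} \<in> P.events"
    unfolding Req using J(1) Rm by (rule sets.finite_UN)
  have Rp: "\<P>(X in ?P. R X) \<le> real ?m * pair_bound ?m"
  proof -
    have "\<P>(X in ?P. R X)
       \<le> (\<Sum>j\<in>J. \<P>(X in ?P. good ?J X i \<and> good ?J X j \<and> X j \<in> Nr (X i)))"
      unfolding Req using J Rm by (intro P.finite_measure_subadditive_finite) auto
    also have "\<dots> \<le> (\<Sum>j\<in>J. pair_bound ?m)" by (intro sum_mono prob_pair k J)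
    finally show ?thesis by simp
  qed
  have S1: "\<bar>(?I) - (\<integral>X. f X \<partial>?P)\<bar>
     \<le> 2 * G * (real ?m * pair_bound ?m)"
  proof -
    have "\<bar>(?I) - (\<integral>X. f X \<partial>?P)\<bar>
       \<le> 2 * G * \<P>(X in ?P. R X)"
    proof (rule P.integral_diff_le_prob[OF _ _ fm fb Rmeas])
      show "(\<lambda>X. of_bool (good ?J X i) * g (num_good ?J X)) \<in> borel_measurable ?P" by measurable
      show "\<bar>of_bool (good ?J X i) * g (num_good ?J X)\<bar> \<le> G" for X using g G0 by auto
      fix X assume nR: "\<not> R X"
      show "of_bool (good ?J X i) * g (num_good ?J X) = f X"
      proof (cases "good ?J X i")
        case True
        have xQ: "X i \<in> Q" using True by (simp add: good_def)
        \<comment> \<open>Off \<open>R\<close> every other good point is far from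
          \<open>X i\<close>. The ball of a far good point is disjoint from \<open>E (X i)\<close>,
          so it does not contain \<open>X i\<close>, and goodness with and without the index
          \<open>i\<close> agree.\<close>
        have "{j \<in> ?J. good ?J X j} = insert i {j \<in> J. X j \<notin> Nr (X i) \<and> good J X j}"
        proof (intro set_eqI iffI)
          fix j assume j: "j \<in> {j \<in> ?J. good ?J X j}"
          show "j \<in> insert i {j \<in> J. X j \<notin> Nr (X i) \<and> good J X j}"
          proof (cases "j = i")
            case False
            hence jJ: "j \<in> J" using j by auto
            have "cnt (J - {j}) X (E (X j)) \<le> cnt (?J - {j}) X (E (X j))"
              using J by (intro cnt_mono) auto
            thus ?thesis using j jJ nR True by (auto simp: R_def good_def)
          qed auto
        next
          fix j assume j: "j \<in> insert i {j \<in> J. X j \<notin> Nr (X i) \<and> good J X j}"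
          show "j \<in> {j \<in> ?J. good ?J X j}"
          proof (cases "j = i")
            case False
            hence jJ: "j \<in> J" "X j \<notin> Nr (X i)" "good J X j" using j by auto
            have "E (X i) \<inter> E (X j) = {}" using sep[OF xQ] jJ by (auto simp: good_def)
            hence "X i \<notin> E (X j)" using self[of "X i"] by auto
            hence "{l \<in> ?J - {j}. X l \<in> E (X j)} = {l \<in> J - {j}. X l \<in> E (X j)}" by auto
            thus ?thesis using jJ by (auto simp: good_def cnt_def)
          qed (use True in auto)
        qed
        hence "num_good ?J X = Suc (num_far (X i) J X)"
          using J by (simp add: num_good_def num_far_def)
        thus ?thesis by (simp add: f_def)
      qed (simp add: f_def)
    qed
    also have "\<dots> \<le> 2 * G * (real ?m * pair_bound ?m)" using Rp G0 by (intro mult_left_mono) auto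
    finally show ?thesis .
  qed
  define I where "I x = (\<integral>X. f (X(i := x)) \<partial>iid J)" for x
  have If: "(\<integral>X. f X \<partial>?P) = (\<integral>x. I x \<partial>M)" and Im [measurable]: "I \<in> borel_measurable M"
    unfolding I_def using integral_PiM_insert_rev[OF J fm fb] by auto
  define \<epsilon> where "\<epsilon> = G * p * (2 * err_delete ?m * (real k + real ?m * v) + 2 * err_shift ?m)"
  have I_out: "I x = 0" if "x \<notin> Q" for x
    using that by (simp add: I_def f_def good_def)
  have I_in: "\<bar>I x - p * \<Gamma>\<bar> \<le> \<epsilon>" if x: "x \<in> Q" for x
  proof -
    have f_upd: "f (X(i := x)) = of_bool (cnt J X (E x) < k) * g (Suc (num_far x J X))" for X
    proof -
      have "cnt (?J - {i}) (X(i := x)) (E x) = cnt J X (E x)"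
      proof -
        have "?J - {i} = J" using J by auto
        thus ?thesis using J by (simp, intro cnt_cong) auto
      qed
      moreover have "num_far x J (X(i := x)) = num_far x J X" using J by (intro num_far_cong) auto
      ultimately show ?thesis using x by (simp add: f_def good_def)
    qed
    have d1: "\<bar>I x - p * (\<integral>X. g (Suc (num_far x J X)) \<partial>iid J)\<bar> \<le> 2 * G * err_delete ?m * p * (real k + real ?m * v)"
      unfolding I_def f_upd p_def
      using num_far_decorrelation[OF x J(1), of "\<lambda>a. g (Suc a)" G] g by simp
    have "(\<integral>X. g (Suc (num_far x J X)) \<partial>iid J) = (\<integral>X. g (Suc (num_far x J (restrict X J))) \<partial>?P)"
    proof (rule integral_PiM_restrict[symmetric, OF prob_space_M fJ])
      have [measurable]: "(\<lambda>X. num_far x J X) \<in> measurable (iid J) (count_space UNIV)"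
        using J by (intro measurable_num_far) auto
      show "(\<lambda>X. g (Suc (num_far x J X))) \<in> borel_measurable (iid J)" by measurable
    qed auto
    also have "\<dots> = (\<integral>X. g (Suc (num_far x J X)) \<partial>?P)"
      by (intro Bochner_Integration.integral_cong refl arg_cong[where f = "\<lambda>a. g (Suc a)"] num_far_cong) auto
    finally have e: "(\<integral>X. g (Suc (num_far x J X)) \<partial>iid J) = (\<integral>X. g (Suc (num_far x J X)) \<partial>?P)" .
    have [measurable]: "(\<lambda>X. num_far x J X) \<in> measurable ?P (count_space UNIV)"
      using J by (intro measurable_num_far) auto
    have "\<bar>(\<integral>X. g (Suc (num_far x J X)) \<partial>?P) - \<Gamma>\<bar>
        \<le> 2 * G * \<P>(X in ?P. num_far x J X \<noteq> num_good ?J X)"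
      unfolding \<Gamma>_def by (rule P.integral_diff_le_prob) (use g in auto)
    also have "\<dots> \<le> 2 * G * err_shift ?m"
      unfolding err_shift_def using G0 prob_num_far_neq_num_good[OF x J] by (intro mult_left_mono) auto
    finally have "p * \<bar>(\<integral>X. g (Suc (num_far x J X)) \<partial>?P) - \<Gamma>\<bar> \<le> p * (2 * G * err_shift ?m)"
      using p0 by (rule mult_left_mono)
    hence d2: "\<bar>p * (\<integral>X. g (Suc (num_far x J X)) \<partial>iid J) - p * \<Gamma>\<bar> \<le> p * (2 * G * err_shift ?m)"
      using p0 by (simp add: e abs_mult flip: right_diff_distrib)
    have "\<bar>I x - p * \<Gamma>\<bar> \<le> 2 * G * err_delete ?m * p * (real k + real ?m * v) + p * (2 * G * err_shift ?m)"
      using d1 d2 by linarith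
    also have "\<dots> = \<epsilon>" by (simp add: \<epsilon>_def algebra_simps)
    finally show ?thesis .
  qed
  have p\<Gamma>: "\<bar>p * \<Gamma>\<bar> \<le> p * G" using \<Gamma> p0 by (simp add: abs_mult mult_left_mono)
  have Ib: "\<bar>I x\<bar> \<le> \<bar>\<epsilon>\<bar> + p * G" for x
    using I_in[of x] I_out[of x] p\<Gamma> mult_nonneg_nonneg[OF p0 G0] by (cases "x \<in> Q") auto
  have intI: "integrable M I" using Ib by (intro integrable_const_bound[where B = "\<bar>\<epsilon>\<bar> + p * G"]) auto
  have "\<epsilon> \<ge> 0"
    unfolding \<epsilon>_def err_shift_def using G0 p0 err_delete_nonneg cdf_nonneg v_pos u_nonneg
    by (intro mult_nonneg_nonneg add_nonneg_nonneg) auto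
  \<comment> \<open>\<open>I\<close> vanishes outside \<open>Q\<close> while
    \<open>p * \<Gamma>\<close> is subtracted everywhere; this is the source of the boundary summand
    in \<open>err_term\<close>.\<close>
  have S2: "\<bar>(\<integral>x. I x \<partial>M) - p * \<Gamma>\<bar> \<le> \<epsilon> + p * G * measure M (space M - Q)"
  proof -
    have "(\<integral>x. I x \<partial>M) - p * \<Gamma> = (\<integral>x. I x - p * \<Gamma> \<partial>M)" using intI by (simp add: prob_space)
    also have "\<bar>\<dots>\<bar> \<le> (\<integral>x. \<bar>I x - p * \<Gamma>\<bar> \<partial>M)" by (rule integral_abs_bound)
    also have "\<dots> \<le> (\<integral>x. \<epsilon> + p * G * indicator (space M - Q) x \<partial>M)"
    proof (rule integral_mono)
      have "integrable M (\<lambda>x. p * G * indicator (space M - Q) x)"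
        using Q_sets by (intro integrable_mult_right integrable_real_indicator) (auto simp: emeasure_eq_measure)
      thus "integrable M (\<lambda>x. \<epsilon> + p * G * indicator (space M - Q) x)" by simp
      show "integrable M (\<lambda>x. \<bar>I x - p * \<Gamma>\<bar>)" using intI by simp
      fix x assume "x \<in> space M"
      show "\<bar>I x - p * \<Gamma>\<bar> \<le> \<epsilon> + p * G * indicator (space M - Q) x"
        using I_in[of x] I_out[of x] p\<Gamma> \<open>\<epsilon> \<ge> 0\<close> space_UNIV by (cases "x \<in> Q") auto
    qed
    also have "\<dots> = \<epsilon> + p * G * measure M (space M - Q)"
      using Q_sets by (subst Bochner_Integration.integral_add)
        (auto simp: prob_space emeasure_eq_measure intro!: integrable_mult_right integrable_real_indicator)
    finally show ?thesis .
  qed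
  have "\<bar>(?I) - p * \<Gamma>\<bar>
     \<le> 2 * G * (real ?m * pair_bound ?m) + (\<epsilon> + p * G * measure M (space M - Q))"
    using S1 S2 If by linarith
  also have "\<dots> = G * err_term ?m"
    unfolding err_term_def \<epsilon>_def p_def[symmetric] by (simp add: algebra_simps)
  finally show ?thesis unfolding p_def \<Gamma>_def .
qed

theorem num_good_poisson:
  fixes J :: "'i set"
  assumes k: "1 \<le> k" and J: "finite J" and l: "0 < l"
  shows "\<bar>\<P>(X in iid J. num_good J X \<in> A) - measure (measure_pmf (poisson_pmf l)) A\<bar>
     \<le> exp l * (\<bar>l - real (card J) * cdf (card J - 1) k\<bar> + real (card J) * err_term (card J - 1))"
proof -
  let ?P = "iid J"
  let ?n = "card J"
  let ?Poi = "measure (measure_pmf (poisson_pmf l)) A"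
  interpret P: prob_space ?P using prob_space_M by (rule prob_space_PiM_const)
  obtain g :: "nat \<Rightarrow> real" where g: "\<And>j. \<bar>g j\<bar> \<le> exp l"
    and st: "\<And>j. l * g (Suc j) - real j * g j = of_bool (j \<in> A) - ?Poi"
    using stein_poisson[OF l] by metis
  define p where "p = cdf (?n - 1) k"
  define \<Gamma> where "\<Gamma> = (\<integral>X. g (Suc (num_good J X)) \<partial>?P)"
  have [measurable]: "(\<lambda>X. num_good J X) \<in> measurable ?P (count_space UNIV)"
    using J by (rule measurable_num_good)
  have pg: "Measurable.pred ?P (\<lambda>X. good J X i)" if "i \<in> J" for i using J that by (intro pred_good) auto
  have \<Gamma>: "\<bar>\<Gamma>\<bar> \<le> exp l"
  proof -
    have "\<bar>\<Gamma>\<bar> \<le> (\<integral>X. exp l \<partial>?P)" unfolding \<Gamma>_def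
    proof (rule order.trans[OF integral_abs_bound integral_mono])
      show "integrable ?P (\<lambda>X. \<bar>g (Suc (num_good J X))\<bar>)"
        using g by (intro P.integrable_const_bound[where B = "exp l"]) auto
    qed (use g in auto)
    thus ?thesis by (simp add: P.prob_space)
  qed
  have int1: "integrable ?P (\<lambda>X. g (Suc (num_good J X)))"
    using g by (intro P.integrable_const_bound[where B = "exp l"]) auto
  have int2: "integrable ?P (\<lambda>X. of_bool (good J X i) * g (num_good J X))" if "i \<in> J" for i
  proof (rule P.integrable_const_bound[where B = "exp l"])
    note [measurable] = pg[OF that]
    show "(\<lambda>X. of_bool (good J X i) * g (num_good J X)) \<in> borel_measurable ?P" by measurable
    show "AE X in ?P. norm (of_bool (good J X i) * g (num_good J X)) \<le> exp l" using g by auto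
  qed
  have count: "real (num_good J X) * g (num_good J X) = (\<Sum>i\<in>J. of_bool (good J X i) * g (num_good J X))" for X
  proof -
    have "(\<Sum>i\<in>J. of_bool (good J X i) :: real) = real (num_good J X)"
      using J by (simp add: num_good_def Int_def)
    thus ?thesis by (simp add: sum_distrib_right[symmetric] del: sum_of_bool_eq)
  qed
  have int3: "integrable ?P (\<lambda>X. real (num_good J X) * g (num_good J X))"
    unfolding count using int2 by auto
  have "\<P>(X in ?P. num_good J X \<in> A) - ?Poi
     = (\<integral>X. indicator {X \<in> space ?P. num_good J X \<in> A} X - ?Poi \<partial>?P)"
    by (subst Bochner_Integration.integral_diff) (auto simp: P.prob_space P.emeasure_eq_measure intro!: integrable_real_indicator)
  also have "\<dots> = (\<integral>X. l * g (Suc (num_good J X)) - real (num_good J X) * g (num_good J X) \<partial>?P)"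
    by (intro Bochner_Integration.integral_cong) (auto simp: st split: split_indicator)
  also have "\<dots> = l * \<Gamma> - (\<Sum>i\<in>J. \<integral>X. of_bool (good J X i) * g (num_good J X) \<partial>?P)"
  proof -
    have "(\<integral>X. real (num_good J X) * g (num_good J X) \<partial>?P) = (\<Sum>i\<in>J. \<integral>X. of_bool (good J X i) * g (num_good J X) \<partial>?P)"
      unfolding count using int2 by (intro Bochner_Integration.integral_sum) auto
    thus ?thesis using int1 int3 by (simp add: \<Gamma>_def)
  qed
  \<comment> \<open>Each summand is compared with \<open>p * \<Gamma>\<close>. The mismatch between
    \<open>l\<close> and \<open>?n * p\<close> is split off, so that \<open>l\<close> may be the
    limit of the means and need not be a mean itself.\<close>
  also have "\<dots> = (l - real ?n * p) * \<Gamma> - (\<Sum>i\<in>J. (\<integral>X. of_bool (good J X i) * g (num_good J X) \<partial>?P) - p * \<Gamma>)"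
    by (simp add: sum_subtractf algebra_simps)
  also have "\<bar>\<dots>\<bar> \<le> \<bar>l - real ?n * p\<bar> * exp l + (\<Sum>i\<in>J. exp l * err_term (?n - 1))"
  proof -
    have "\<bar>\<Sum>i\<in>J. (\<integral>X. of_bool (good J X i) * g (num_good J X) \<partial>?P) - p * \<Gamma>\<bar>
       \<le> (\<Sum>i\<in>J. \<bar>(\<integral>X. of_bool (good J X i) * g (num_good J X) \<partial>?P) - p * \<Gamma>\<bar>)" by (rule sum_abs)
    also have "\<dots> \<le> (\<Sum>i\<in>J. exp l * err_term (?n - 1))"
    proof (intro sum_mono)
      fix i assume i: "i \<in> J"
      have "insert i (J - {i}) = J" "card (J - {i}) = ?n - 1" using i J by auto
      thus "\<bar>(\<integral>X. of_bool (good J X i) * g (num_good J X) \<partial>?P) - p * \<Gamma>\<bar> \<le> exp l * err_term (?n - 1)"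
        using good_term[OF k _ _ g, of "J - {i}" i] J unfolding p_def \<Gamma>_def by simp
    qed
    moreover have "\<bar>(l - real ?n * p) * \<Gamma>\<bar> \<le> \<bar>l - real ?n * p\<bar> * exp l"
      unfolding abs_mult by (intro mult_left_mono \<Gamma>) auto
    ultimately show ?thesis by linarith
  qed
  finally show ?thesis unfolding p_def by (simp add: algebra_simps)
qed

end

subsection \<open>Balls of prescribed mass in the cube\<close>

locale cube_density = prob_space \<mu> for \<mu> :: "(real ^ 'd) measure" +
  fixes f :: "real ^ 'd \<Rightarrow> real" and f_minus f_plus :: real
  assumes sets_\<mu>: "sets \<mu> = sets borel"
    and density: "\<And>A. A \<in> sets borel \<Longrightarrow> emeasure \<mu> A = (\<integral>\<^sup>+x\<in>A. ennreal (f x) \<partial>lborel)"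
    and supp: "msupport \<mu> = cbox 0 1"
    and f_minus_pos: "f_minus > 0" and f_plus_pos: "f_plus > 0"
    and f_bounds: "\<And>x. x \<in> cbox 0 1 \<Longrightarrow> f_minus \<le> f x \<and> f x \<le> f_plus"
begin

lemma space_\<mu>: "space \<mu> = UNIV"
  using sets_eq_imp_space_eq[OF sets_\<mu>] by simp

text \<open>The complement of the support is a union of open null sets, of which countably many
  suffice by the Lindelof property.\<close>

lemma measure_compl_cube: "measure \<mu> (- cbox 0 1) = 0"
proof -
  define \<F> where "\<F> = {U. open U \<and> emeasure \<mu> U = 0}"
  have "\<Union>\<F> = - cbox 0 1"
    unfolding supp[symmetric] msupport_def \<F>_def by auto
  moreover obtain \<F>' where F': "\<F>' \<subseteq> \<F>" "countable \<F>'" "\<Union>\<F>' = \<Union>\<F>"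
    using Lindelof[of \<F>] unfolding \<F>_def by blast
  moreover have "(\<Union>U\<in>\<F>'. U) \<in> null_sets \<mu>"
    using F' by (intro null_sets_UN') (auto simp: \<F>_def null_sets_def sets_\<mu>)
  ultimately have "- cbox 0 1 \<in> null_sets \<mu>" by simp
  thus ?thesis by (simp add: null_sets_def measure_def)
qed

lemma measure_le_lborel:
  assumes A: "A \<in> sets borel" "emeasure lborel A < \<infinity>"
  shows "measure \<mu> A \<le> f_plus * measure lborel A"
proof -
  have "measure \<mu> A \<le> measure \<mu> (A \<inter> cbox 0 1) + measure \<mu> (A - cbox 0 1)"
    using A by (intro order.trans[OF _ measure_Un_le] finite_measure_mono) (auto simp: sets_\<mu>)
  also have "measure \<mu> (A - cbox 0 1) \<le> measure \<mu> (- cbox 0 1)"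
    by (intro finite_measure_mono) (auto simp: sets_\<mu>)
  finally have 1: "measure \<mu> A \<le> measure \<mu> (A \<inter> cbox 0 1)" by (simp add: measure_compl_cube)
  have "emeasure \<mu> (A \<inter> cbox 0 1) = (\<integral>\<^sup>+x\<in>A \<inter> cbox 0 1. ennreal (f x) \<partial>lborel)"
    using A by (intro density) auto
  also have "\<dots> \<le> (\<integral>\<^sup>+x. ennreal f_plus * indicator A x \<partial>lborel)"
    using f_bounds by (intro nn_integral_mono) (auto intro!: ennreal_leI split: split_indicator)
  also have "\<dots> = ennreal f_plus * emeasure lborel A"
    using A by (simp add: nn_integral_cmult)
  also have "\<dots> = ennreal (f_plus * measure lborel A)"
    using A f_plus_pos by (simp add: emeasure_eq_ennreal_measure ennreal_mult)
  finally show ?thesis using 1 f_plus_pos by (simp add: emeasure_eq_measure)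
qed

lemma measure_ge_lborel:
  assumes A: "A \<in> sets borel" "A \<subseteq> cbox 0 1"
  shows "f_minus * measure lborel A \<le> measure \<mu> A"
proof -
  have fin: "emeasure lborel A < \<infinity>"
    using A(2) bounded_subset[OF bounded_cbox A(2)] emeasure_bounded_finite by blast
  have "ennreal (f_minus * measure lborel A) = (\<integral>\<^sup>+x. ennreal f_minus * indicator A x \<partial>lborel)"
    using A f_minus_pos fin by (simp add: nn_integral_cmult emeasure_eq_ennreal_measure ennreal_mult)
  also have "\<dots> \<le> (\<integral>\<^sup>+x\<in>A. ennreal (f x) \<partial>lborel)"
    using f_bounds A(2) by (intro nn_integral_mono) (auto intro!: ennreal_leI split: split_indicator)
  also have "\<dots> = emeasure \<mu> A" using density A by simp
  finally show ?thesis by (simp add: emeasure_eq_measure)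
qed

definition ball_vol :: real where "ball_vol = unit_ball_vol (real CARD('d))"

lemma ball_vol_pos: "0 < ball_vol"
  unfolding ball_vol_def by (intro unit_ball_vol_pos) auto

definition c_minus :: real where "c_minus = f_minus * ball_vol"
definition c_plus :: real where "c_plus = f_plus * ball_vol"

lemma c_minus_pos: "0 < c_minus" and c_plus_pos: "0 < c_plus"
  using ball_vol_pos f_minus_pos f_plus_pos by (auto simp: c_minus_def c_plus_def)

lemma lborel_cball: "0 \<le> s \<Longrightarrow> measure lborel (cball x s :: (real ^ 'd) set) = ball_vol * s ^ CARD('d)"
  by (simp add: content_cball ball_vol_def)

lemma measure_cball_le:
  assumes "0 \<le> s"
  shows "measure \<mu> (cball x s) \<le> c_plus * s ^ CARD('d)"
proof -
  have "measure \<mu> (cball x s) \<le> f_plus * measure lborel (cball x s)"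
    by (intro measure_le_lborel emeasure_bounded_finite) auto
  thus ?thesis using assms by (simp add: lborel_cball c_plus_def mult.assoc)
qed

lemma measure_cball_ge:
  assumes "0 \<le> s" "cball x s \<subseteq> cbox 0 1"
  shows "c_minus * s ^ CARD('d) \<le> measure \<mu> (cball x s)"
  using measure_ge_lborel[of "cball x s"] assms by (simp add: lborel_cball c_minus_def mult.assoc)

text \<open>The mass of a shell is bounded by its volume through the upper density bound. Continuity
  of the mass in the radius follows by comparison with \<open>c_plus * s ^ CARD('d)\<close>.\<close>

lemma measure_cball_diff_le:
  assumes "0 \<le> s" "s \<le> s'"
  shows "measure \<mu> (cball x s') - measure \<mu> (cball x s) \<le> c_plus * s' ^ CARD('d) - c_plus * s ^ CARD('d)"
proof -
  have sub: "cball x s \<subseteq> cball x s'" using assms by auto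
  have "measure \<mu> (cball x s') - measure \<mu> (cball x s) = measure \<mu> (cball x s' - cball x s)"
    using sub by (subst finite_measure_Diff) (auto simp: sets_\<mu>)
  also have "\<dots> \<le> f_plus * measure lborel (cball x s' - cball x s)"
    by (intro measure_le_lborel emeasure_bounded_finite) (auto intro: bounded_subset[OF bounded_cball])
  also have "measure lborel (cball x s' - cball x s) = measure lborel (cball x s') - measure lborel (cball x s)"
    using sub emeasure_bounded_finite[of "cball x s'"] by (intro measure_Diff) (auto simp: top.not_eq_extremum)
  finally show ?thesis using assms by (simp add: lborel_cball c_plus_def algebra_simps)
qed

lemma continuous_measure_cball: "continuous_on {0..} (\<lambda>s. measure \<mu> (cball x s))"
proof -
  have le: "dist (measure \<mu> (cball x s')) (measure \<mu> (cball x s)) \<le> dist (c_plus * s' ^ CARD('d)) (c_plus * s ^ CARD('d))"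
    if "0 \<le> s" "0 \<le> s'" for s s'
  proof -
    have *: "dist (measure \<mu> (cball x b)) (measure \<mu> (cball x a)) \<le> dist (c_plus * b ^ CARD('d)) (c_plus * a ^ CARD('d))"
      if "0 \<le> a" "a \<le> b" for a b
    proof -
      have "measure \<mu> (cball x a) \<le> measure \<mu> (cball x b)"
        using that by (intro finite_measure_mono) (auto simp: sets_\<mu>)
      thus ?thesis using measure_cball_diff_le[OF that, of x] by (simp add: dist_real_def)
    qed
    show ?thesis using *[of s s'] *[of s' s] that by (cases "s \<le> s'") (auto simp: dist_commute)
  qed
  have "continuous_on {0..} (\<lambda>s. c_plus * s ^ CARD('d))" by (intro continuous_intros)
  thus ?thesis unfolding continuous_on_iff by (meson atLeast_iff le le_less_trans)
qed

text \<open>Described by the mass of the ball reaching to \<open>y\<close> and not by a radius, so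
  that joint measurability in \<open>x\<close> and \<open>y\<close> needs no measurable choice of
  radii.\<close>

definition mass_ball :: "real \<Rightarrow> real ^ 'd \<Rightarrow> (real ^ 'd) set" where
  "mass_ball v x = {y. measure \<mu> (cball x (dist x y)) \<le> v}"

text \<open>The radius is the largest one whose ball has mass at most \<open>v\<close>. It is
  attained because the mass is continuous in the radius; some radius has mass exactly
  \<open>v\<close> by the intermediate value theorem, hence so has the largest by
  monotonicity.\<close>

lemma mass_ball_cball:
  assumes v: "0 < v" "v < 1"
  obtains r where "0 \<le> r" "mass_ball v x = cball x r" "measure \<mu> (cball x r) = v"
proof -
  define m where "m s = measure \<mu> (cball x s)" for s
  have mono: "m s \<le> m s'" if "s \<le> s'" for s s'
    unfolding m_def using that by (intro finite_measure_mono) (auto simp: sets_\<mu>)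
  define S where "S = {s. 0 \<le> s \<and> m s \<le> v}"
  have cont: "continuous_on {0..} m" unfolding m_def by (rule continuous_measure_cball)
  obtain e where e: "\<And>y. y \<in> cbox 0 1 \<Longrightarrow> dist x y \<le> e"
    using bounded_cbox[of "0 :: real^'d" 1] unfolding bounded_any_center[where a = x] by blast
  define s0 where "s0 = max e 0"
  have s0: "cbox 0 1 \<subseteq> cball x s0" "0 \<le> s0"
    using e by (force simp: s0_def)+
  have "m s0 \<ge> measure \<mu> (cbox 0 1)"
    unfolding m_def using s0 by (intro finite_measure_mono) (auto simp: sets_\<mu>)
  moreover have "measure \<mu> (cbox 0 1) = 1"
    using prob_compl[of "- cbox 0 1"] measure_compl_cube by (simp add: sets_\<mu> space_\<mu> Compl_eq_Diff_UNIV[symmetric])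
  ultimately have ms0: "v < m s0" using v by linarith
  have m0: "m 0 = 0" using measure_cball_le[of 0 x] by (auto simp: m_def power_0_left intro: antisym)
  have bdd: "bdd_above S"
  proof (rule bdd_aboveI)
    fix s assume "s \<in> S"
    thus "s \<le> s0" using mono[of s0 s] ms0 by (auto simp: S_def intro: leI)
  qed
  have "closed S"
  proof -
    have "S = {0..} \<inter> m -` {..v}" by (auto simp: S_def)
    thus ?thesis using continuous_closed_preimage[OF cont, of "{..v}"] by simp
  qed
  moreover have S0: "0 \<in> S" using m0 v by (simp add: S_def)
  ultimately have r: "Sup S \<in> S" using bdd by (intro closed_contains_Sup) auto
  have "continuous_on {0..s0} m" using cont by (rule continuous_on_subset) auto
  then obtain s where s: "0 \<le> s" "m s = v"
    using IVT'[of m 0 v s0] m0 ms0 v s0 by auto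
  have "s \<le> Sup S" using s bdd by (intro cSup_upper) (auto simp: S_def)
  hence "m (Sup S) = v" using mono[of s "Sup S"] s r by (auto simp: S_def)
  moreover have "mass_ball v x = cball x (Sup S)"
  proof (intro set_eqI iffI)
    fix y assume "y \<in> mass_ball v x"
    hence "dist x y \<in> S" by (simp add: mass_ball_def S_def m_def)
    thus "y \<in> cball x (Sup S)" using cSup_upper[OF _ bdd] by simp
  next
    fix y assume "y \<in> cball x (Sup S)"
    hence "m (dist x y) \<le> v" using mono[of "dist x y" "Sup S"] r by (auto simp: S_def)
    thus "y \<in> mass_ball v x" by (simp add: mass_ball_def m_def)
  qed
  ultimately show thesis using that[of "Sup S"] r by (auto simp: S_def m_def)
qed

lemma measure_mass_ball: "0 < v \<Longrightarrow> v < 1 \<Longrightarrow> measure \<mu> (mass_ball v x) = v"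
  using mass_ball_cball[of v x] by metis

lemma pred_dist_le: 
  assumes [measurable]: "g \<in> borel_measurable (\<mu> \<Otimes>\<^sub>M \<mu>)"
  shows "Measurable.pred (\<mu> \<Otimes>\<^sub>M \<mu>) (\<lambda>(x, y). dist x y \<le> g (x, y))"
proof -
  have s: "sets (\<mu> \<Otimes>\<^sub>M \<mu>) = sets (borel \<Otimes>\<^sub>M borel)" using sets_\<mu> by (intro sets_pair_measure_cong)
  have "(\<lambda>p. dist (fst p) (snd p)) \<in> borel_measurable (borel \<Otimes>\<^sub>M borel :: ((real^'d) \<times> (real^'d)) measure)"
    by measurable
  hence [measurable]: "(\<lambda>p. dist (fst p) (snd p)) \<in> borel_measurable (\<mu> \<Otimes>\<^sub>M \<mu>)"
    by (simp add: measurable_cong_sets[OF s refl])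
  have "Measurable.pred (\<mu> \<Otimes>\<^sub>M \<mu>) (\<lambda>p. dist (fst p) (snd p) \<le> g p)" by measurable
  thus ?thesis by (simp add: case_prod_unfold)
qed

text \<open>The mass of the ball around \<open>x\<close> reaching to \<open>y\<close> is the measure
  of a section of the closed set \<open>?C\<close>, hence measurable in the pair.\<close>

lemma pred_mass_ball: "Measurable.pred (\<mu> \<Otimes>\<^sub>M \<mu>) (\<lambda>(x, y). y \<in> mass_ball v x)"
proof -
  have s: "sets (\<mu> \<Otimes>\<^sub>M \<mu>) = sets (borel \<Otimes>\<^sub>M borel)" using sets_\<mu> by (intro sets_pair_measure_cong)
  have s3: "sets ((borel \<Otimes>\<^sub>M borel) \<Otimes>\<^sub>M \<mu>) = sets ((borel \<Otimes>\<^sub>M borel) \<Otimes>\<^sub>M borel)" using sets_\<mu> by (intro sets_pair_measure_cong) auto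
  let ?C = "{((x, y), z). dist x z \<le> dist x y} :: (((real^'d) \<times> (real^'d)) \<times> (real^'d)) set"
  have "closed ?C"
    unfolding case_prod_unfold by (intro closed_Collect_le continuous_intros)
  hence "?C \<in> sets ((borel \<Otimes>\<^sub>M borel) \<Otimes>\<^sub>M \<mu>)"
    unfolding s3 unfolding borel_prod by auto
  from measurable_emeasure_Pair[OF this]
  have "(\<lambda>p. emeasure \<mu> (Pair p -` ?C)) \<in> borel_measurable (borel \<Otimes>\<^sub>M borel)" .
  moreover have "Pair p -` ?C = cball (fst p) (dist (fst p) (snd p))" for p
    by (auto simp: case_prod_unfold)
  ultimately have "(\<lambda>p. emeasure \<mu> (cball (fst p) (dist (fst p) (snd p)))) \<in> borel_measurable (borel \<Otimes>\<^sub>M borel)"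
    by simp
  hence [measurable]: "(\<lambda>p. measure \<mu> (cball (fst p) (dist (fst p) (snd p)))) \<in> borel_measurable (\<mu> \<Otimes>\<^sub>M \<mu>)"
    unfolding measure_def by (simp add: measurable_cong_sets[OF s refl] borel_measurable_enn2real)
  have "Measurable.pred (\<mu> \<Otimes>\<^sub>M \<mu>) (\<lambda>p. measure \<mu> (cball (fst p) (dist (fst p) (snd p))) \<le> v)"
    by measurable
  thus ?thesis by (simp add: mass_ball_def case_prod_unfold)
qed

definition inner_cube :: "real \<Rightarrow> (real ^ 'd) set" where
  "inner_cube e = cbox (\<chi> i. e) (\<chi> i. 1 - e)"

lemma cball_inner_cube:
  assumes "x \<in> inner_cube e"
  shows "cball x e \<subseteq> cbox 0 1"
proof
  fix y assume y: "y \<in> cball x e"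
  have "\<bar>x $ i - y $ i\<bar> \<le> e" for i
    using component_le_norm_cart[of "x - y" i] y by (simp add: dist_norm)
  moreover have "e \<le> x $ i" "x $ i \<le> 1 - e" for i
    using assms by (auto simp: inner_cube_def mem_box_cart)
  ultimately show "y \<in> cbox 0 1"
    by (auto simp: mem_box_cart abs_le_iff) (smt (verit))+
qed

lemma measure_compl_inner_cube:
  assumes "0 \<le> e" "e \<le> 1 / 2"
  shows "measure \<mu> (space \<mu> - inner_cube e) \<le> f_plus * (2 * real CARD('d) * e)"
proof -
  have sub: "inner_cube e \<subseteq> cbox 0 1"
  proof
    fix y assume "y \<in> inner_cube e"
    hence "e \<le> y $ i" "y $ i \<le> 1 - e" for i by (auto simp: inner_cube_def mem_box_cart)
    hence "0 \<le> y $ i" "y $ i \<le> 1" for i using assms by (force intro: order.trans)+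
    thus "y \<in> cbox 0 1" by (simp add: mem_box_cart)
  qed
  have Qb: "inner_cube e \<in> sets borel" by (simp add: inner_cube_def)
  have "measure \<mu> (space \<mu> - inner_cube e) \<le> measure \<mu> (cbox 0 1 - inner_cube e) + measure \<mu> (- cbox 0 1)"
    using Qb by (intro order.trans[OF _ measure_Un_le] finite_measure_mono) (auto simp: sets_\<mu>)
  also have "measure \<mu> (cbox 0 1 - inner_cube e) \<le> f_plus * measure lborel (cbox 0 1 - inner_cube e)"
    using Qb by (intro measure_le_lborel emeasure_bounded_finite) (auto intro: bounded_subset[OF bounded_cbox])
  also have "measure lborel (cbox 0 1 - inner_cube e) = measure lborel (cbox 0 1 :: (real^'d) set) - measure lborel (inner_cube e)"
    using sub Qb by (intro measure_Diff) (auto simp: emeasure_lborel_cbox_eq)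
  also have "measure lborel (cbox 0 1 :: (real^'d) set) = 1"
    by (subst content_cbox_cart) (auto simp: interval_ne_empty_cart)
  also have "measure lborel (inner_cube e) = (1 - 2 * e) ^ CARD('d)"
    unfolding inner_cube_def using assms by (subst content_cbox_cart) (auto simp: interval_ne_empty_cart)
  also have "1 - (1 - 2 * e) ^ CARD('d) \<le> 2 * real CARD('d) * e"
    using Bernoulli_inequality[of "- 2 * e" "CARD('d)"] assms by (simp add: algebra_simps)
  finally show ?thesis using f_plus_pos measure_compl_cube by (simp add: mult_left_mono)
qed

end

section \<open>Balls centred well inside the cube and the mass of their differences\<close>

context cube_density
begin

text \<open>A radius above \<open>e\<close> would enclose \<open>cball x e\<close>, which lies in
  the cube and has mass above \<open>v\<close>. Hence the whole ball stays in the cube, where the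
  lower density bound is available.\<close>

lemma mass_ball_inner:
  assumes v: "0 < v" "v < 1" "v < c_minus * e ^ CARD('d)" and e: "0 < e" and x: "x \<in> inner_cube e"
  obtains r where "0 \<le> r" "r \<le> e" "mass_ball v x = cball x r"
    "c_minus * r ^ CARD('d) \<le> v" "v \<le> c_plus * r ^ CARD('d)"
proof -
  obtain r where r: "0 \<le> r" "mass_ball v x = cball x r" "measure \<mu> (cball x r) = v"
    using mass_ball_cball[OF v(1,2)] by metis
  have re: "r \<le> e"
  proof (rule ccontr)
    assume "\<not> r \<le> e"
    hence "measure \<mu> (cball x e) \<le> measure \<mu> (cball x r)"
      by (intro finite_measure_mono) (auto simp: sets_\<mu>)
    thus False using measure_cball_ge[OF _ cball_inner_cube[OF x]] e r v by auto
  qed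
  have "cball x r \<subseteq> cbox 0 1" using cball_inner_cube[OF x] re by (auto intro: subset_trans)
  hence "c_minus * r ^ CARD('d) \<le> v" using measure_cball_ge r by metis
  moreover have "v \<le> c_plus * r ^ CARD('d)" using measure_cball_le r by metis
  ultimately show thesis using r re that by blast
qed

text \<open>A ball of radius \<open>\<rho>\<close> fits into the difference: its centre
  \<open>c\<close> lies on the ray from \<open>x\<close> through \<open>y\<close>, beyond
  \<open>y\<close> or at \<open>y\<close>, at distance \<open>rx - \<rho>\<close> from
  \<open>y\<close>.\<close>

lemma measure_lune_ge:
  assumes r: "0 \<le> rx" "rx \<le> ry" and cube: "cball y ry \<subseteq> cbox 0 1" and xy: "x \<noteq> y"
  shows "c_minus * (min (dist x y) rx / 2) ^ CARD('d) \<le> measure \<mu> (cball y ry - cball x rx)"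
proof -
  define \<delta> where "\<delta> = dist x y"
  \<comment> \<open>\<open>2 * \<rho> \<le> \<delta>\<close> keeps the ball off
    \<open>cball x rx\<close>, and \<open>\<rho> \<le> rx\<close> keeps its centre from falling back
    towards \<open>x\<close>. In the case of equality \<open>2 * \<rho> = \<delta>\<close> the balls
    touch, hence the open ball around \<open>c\<close> below.\<close>
  define \<rho> where "\<rho> = min \<delta> rx / 2"
  define c where "c = y + ((rx - \<rho>) / \<delta>) *\<^sub>R (y - x)"
  have \<delta>: "0 < \<delta>" "norm (y - x) = \<delta>" using xy by (auto simp: \<delta>_def dist_norm norm_minus_commute)
  have \<rho>: "0 \<le> \<rho>" "2 * \<rho> \<le> \<delta>" "\<rho> \<le> rx" using \<delta> r by (auto simp: \<rho>_def min_def)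
  have cy: "dist c y = rx - \<rho>" using \<delta> \<rho> by (simp add: c_def dist_norm)
  have cx: "dist c x = \<delta> + rx - \<rho>"
  proof -
    have "c - x = (1 + (rx - \<rho>) / \<delta>) *\<^sub>R (y - x)" by (simp add: c_def algebra_simps)
    hence "dist c x = \<bar>1 + (rx - \<rho>) / \<delta>\<bar> * \<delta>" using \<delta> by (simp add: dist_norm)
    also have "\<dots> = \<delta> + rx - \<rho>" using \<delta> \<rho> by (simp add: abs_of_nonneg field_simps)
    finally show ?thesis .
  qed
  have sub: "ball c \<rho> \<subseteq> cball y ry - cball x rx"
  proof
    fix z assume "z \<in> ball c \<rho>"
    hence z: "dist c z < \<rho>" by simp
    have "dist y z \<le> dist c y + dist c z" by (metis dist_commute dist_triangle)
    moreover have "dist c x \<le> dist c z + dist x z" by (metis dist_commute dist_triangle)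
    ultimately show "z \<in> cball y ry - cball x rx" using z cy cx \<rho> r by auto
  qed
  have "c_minus * \<rho> ^ CARD('d) = f_minus * measure lborel (ball c \<rho>)"
    using \<rho> by (simp add: content_ball c_minus_def ball_vol_def)
  also have "\<dots> \<le> measure \<mu> (ball c \<rho>)"
    using sub cube by (intro measure_ge_lborel) auto
  also have "\<dots> \<le> measure \<mu> (cball y ry - cball x rx)"
    using sub by (intro finite_measure_mono) (auto simp: sets_\<mu>)
  finally show ?thesis by (simp add: \<rho>_def \<delta>_def)
qed

text \<open>Both radii satisfy \<open>r ^ CARD('d) \<ge> v / c_plus\<close>, so
  \<open>\<tau>\<close> is a common lower bound for distance and radius on the scale of
  volumes.\<close>

lemma measure_mass_ball_diff_ge:
  assumes v: "0 < v" "v < 1" "v < c_minus * e ^ CARD('d)" and e: "0 < e"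
    and x: "x \<in> inner_cube e" and y: "y \<in> inner_cube e"
    and \<tau>: "\<tau> \<le> dist x y ^ CARD('d)" "\<tau> \<le> v / c_plus"
  shows "c_minus / 2 ^ CARD('d) * \<tau> \<le> measure \<mu> (mass_ball v y - mass_ball v x)"
proof (cases "x = y")
  case True
  have "\<tau> \<le> 0" using \<tau>(1) True by (simp add: power_0_left)
  hence "c_minus / 2 ^ CARD('d) * \<tau> \<le> 0" using c_minus_pos by (intro mult_nonneg_nonpos) auto
  thus ?thesis by (rule order.trans) simp
next
  case False
  obtain rx where rx: "0 \<le> rx" "rx \<le> e" "mass_ball v x = cball x rx" "v \<le> c_plus * rx ^ CARD('d)"
    using mass_ball_inner[OF v e x] by metis
  obtain ry where ry: "0 \<le> ry" "ry \<le> e" "mass_ball v y = cball y ry" "v \<le> c_plus * ry ^ CARD('d)"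
    using mass_ball_inner[OF v e y] by metis
  have cx: "cball x rx \<subseteq> cbox 0 1" using cball_inner_cube[OF x] rx by (auto intro: subset_trans)
  have cy: "cball y ry \<subseteq> cbox 0 1" using cball_inner_cube[OF y] ry by (auto intro: subset_trans)
  have vol: "c_minus / 2 ^ CARD('d) * \<tau> \<le> c_minus * (min (dist x y) r / 2) ^ CARD('d)"
    if "0 \<le> r" "v \<le> c_plus * r ^ CARD('d)" for r
  proof -
    have "v / c_plus \<le> r ^ CARD('d)"
      using that c_plus_pos by (simp add: pos_divide_le_eq mult.commute)
    hence "\<tau> \<le> min (dist x y) r ^ CARD('d)" using \<tau> by (simp add: min_def)
    thus ?thesis using c_minus_pos by (simp add: power_divide field_simps)
  qed
  have sets: "mass_ball v x \<in> sets \<mu>" "mass_ball v y \<in> sets \<mu>" by (auto simp: rx(3) ry(3) sets_\<mu>)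
  show ?thesis
  proof (cases "rx \<le> ry")
    case True
    show ?thesis
      using order.trans[OF vol measure_lune_ge[OF rx(1) True cy False]] rx ry by simp
  next
    case yx: False
    \<comment> \<open>The bound for lunes needs the removed ball to have the smaller radius. Here it
      has the larger one, but the two balls have equal mass, so their two differences do as well and
      the roles can be exchanged.\<close>
    have "measure \<mu> (mass_ball v y - mass_ball v x) = measure \<mu> (mass_ball v y) - measure \<mu> (mass_ball v x \<inter> mass_ball v y)"
      using finite_measure_Diff'[OF sets(2,1)] by (simp add: Int_commute)
    also have "\<dots> = measure \<mu> (mass_ball v x - mass_ball v y)"
      using finite_measure_Diff'[OF sets] measure_mass_ball v by simp
    also have "\<dots> \<ge> c_minus * (min (dist y x) ry / 2) ^ CARD('d)"
      unfolding rx(3) ry(3) using yx False ry cx by (intro measure_lune_ge) auto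
    finally show ?thesis using vol[OF ry(1,4)] by (simp add: dist_commute)
  qed
qed

text \<open>Every ball centred in \<open>inner_cube e\<close> has radius at most
  \<open>root CARD('d) (v / c_minus)\<close>, so centres more than twice that far apart have
  disjoint balls. \<open>\<tau>\<close> is the volume scale, up to constants, below which two
  centres count as too close.\<close>

lemma ball_system_mass_ball:
  assumes v: "0 < v" "v \<le> 1 / 2" "v < c_minus * e ^ CARD('d)" and e: "0 < e" and \<tau>: "0 \<le> \<tau>"
  shows "ball_system \<mu> (mass_ball v) (\<lambda>x. cball x (2 * root CARD('d) (v / c_minus)))
     (\<lambda>x. cball x (root CARD('d) \<tau>)) (inner_cube e) v (c_plus * 2 ^ CARD('d) * (v / c_minus)) (c_plus * \<tau>)
     (c_minus / 2 ^ CARD('d) * min \<tau> (v / c_plus)) (c_minus / 2 ^ CARD('d) * (v / c_plus))"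
proof (unfold_locales, goal_cases)
  case 1 show ?case by (rule space_\<mu>)
  case 2 show ?case by (rule pred_mass_ball)
  case 3 show ?case using pred_dist_le[of "\<lambda>_. 2 * root CARD('d) (v / c_minus)"] by simp
  case 4 show ?case using pred_dist_le[of "\<lambda>_. root CARD('d) \<tau>"] by simp
  case 5 show ?case by (simp add: sets_\<mu> inner_cube_def)
  case (6 x) show ?case using v by (intro measure_mass_ball) auto
  case 7 show ?case by fact
  case 8 show ?case by fact
  case (9 x)
  have "measure \<mu> {x} = 0" using measure_cball_le[of 0 x] by (auto simp: power_0_left intro: antisym)
  thus ?case using v by (simp add: mass_ball_def)
next
  case (10 x y)
  have v1: "v < 1" using v by simp
  have root: "r \<le> root CARD('d) (v / c_minus)" if "0 \<le> r" "c_minus * r ^ CARD('d) \<le> v" for r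
  proof -
    have "r ^ CARD('d) \<le> v / c_minus" using that c_minus_pos by (simp add: field_simps)
    hence "root CARD('d) (r ^ CARD('d)) \<le> root CARD('d) (v / c_minus)" by (intro real_root_le_mono) auto
    thus ?thesis using that by (simp add: real_root_power_cancel)
  qed
  obtain rx where rx: "0 \<le> rx" "mass_ball v x = cball x rx" "c_minus * rx ^ CARD('d) \<le> v"
    using mass_ball_inner[OF v(1) v1 v(3) e 10(1)] by metis
  obtain ry where ry: "0 \<le> ry" "mass_ball v y = cball y ry" "c_minus * ry ^ CARD('d) \<le> v"
    using mass_ball_inner[OF v(1) v1 v(3) e 10(2)] by metis
  have d: "dist x y > rx + ry" using 10(3) root[OF rx(1,3)] root[OF ry(1,3)] by simp
  show ?case unfolding rx(2) ry(2)
  proof (rule equals0I)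
    fix z assume "z \<in> cball x rx \<inter> cball y ry"
    hence "dist x z \<le> rx" "dist y z \<le> ry" by auto
    thus False using d dist_triangle[of x y z] by (simp add: dist_commute)
  qed
next
  case (11 x)
  have "measure \<mu> (cball x (2 * root CARD('d) (v / c_minus))) \<le> c_plus * (2 * root CARD('d) (v / c_minus)) ^ CARD('d)"
    using v c_minus_pos by (intro measure_cball_le) auto
  also have "\<dots> = c_plus * 2 ^ CARD('d) * (v / c_minus)"
    using v c_minus_pos by (simp add: power_mult_distrib real_root_pow_pos2)
  finally show ?case .
next
  case (12 x)
  have "measure \<mu> (cball x (root CARD('d) \<tau>)) \<le> c_plus * root CARD('d) \<tau> ^ CARD('d)"
    using \<tau> by (intro measure_cball_le) auto
  thus ?case using \<tau> by (simp add: real_root_pow_pos2)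
next
  case (13 x y)
  have "root CARD('d) \<tau> < dist x y" using 13(4) by simp
  hence "root CARD('d) \<tau> ^ CARD('d) \<le> dist x y ^ CARD('d)" using \<tau> by (intro power_mono) auto
  hence "min \<tau> (v / c_plus) \<le> dist x y ^ CARD('d)" using \<tau> by (simp add: real_root_pow_pos2)
  thus ?case using v 13 e by (intro measure_mass_ball_diff_ge) auto
next
  case (14 x y)
  have v1: "v < 1" using v by simp
  obtain rx where rx: "0 \<le> rx" "mass_ball v x = cball x rx" "v \<le> c_plus * rx ^ CARD('d)"
    using mass_ball_inner[OF v(1) v1 v(3) e 14(1)] by metis
  have "rx < dist x y" using 14(3) rx by simp
  hence "rx ^ CARD('d) \<le> dist x y ^ CARD('d)" using rx by (intro power_mono) auto
  moreover have "v / c_plus \<le> rx ^ CARD('d)" using rx c_plus_pos by (simp add: field_simps)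
  ultimately show ?case using v 14 e by (intro measure_mass_ball_diff_ge) auto
next
  case 15 show ?case using v c_minus_pos c_plus_pos by simp
next
  case 16 show ?case using \<tau> c_plus_pos by simp
qed

end

section \<open>Nearest-neighbour distances as order statistics\<close>

lemma sorted_antimono_nth:
  assumes "sorted ds" and "\<And>x y. x \<le> y \<Longrightarrow> P y \<Longrightarrow> P x" and "i < length ds"
  shows "P (ds ! i) \<longleftrightarrow> i < length (filter P ds)"
  using assms(1,3)
proof (induction ds arbitrary: i)
  case (Cons d ds)
  show ?case
  proof (cases "P d")
    case True
    thus ?thesis using Cons.IH Cons.prems by (cases i) simp_all
  next
    case False
    have n: "\<not> P z" if "z \<in> set (d # ds)" for z
    proof
      assume "P z"
      moreover have "d \<le> z" using Cons.prems(1) that by auto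
      ultimately show False using assms(2) False by blast
    qed
    hence "filter P (d # ds) = []" by (simp add: filter_empty_conv)
    moreover have "\<not> P ((d # ds) ! i)" using n[OF nth_mem[OF Cons.prems(2)]] .
    ultimately show ?thesis by simp
  qed
qed simp

text \<open>A downward closed property holds on an initial segment of the sorted distances, and the
  length of that segment is the number of neighbours with the property, ties included.
  \<open>P\<close> will be "the ball of this radius has mass at most the threshold".\<close>

lemma nn_dist_le_iff:
  assumes k: "1 \<le> k" "k < n" and i: "i \<in> {1..n}" and P: "\<And>a b :: real. a \<le> b \<Longrightarrow> P b \<Longrightarrow> P a"
  shows "P (nn_dist x i n k) \<longleftrightarrow> k \<le> card {j \<in> {1..n} - {i}. P (dist (x i) (x j))}"
proof -
  define js where "js = filter (\<lambda>j. j \<noteq> i) [1..<n+1]"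
  define ds where "ds = map (\<lambda>j. dist (x i) (x j)) js"
  have js: "distinct js" "set js = {1..n} - {i}" by (auto simp: js_def)
  have "length js = card ({1..n} - {i})" using js distinct_card by metis
  hence len: "length ds = n - 1" using i by (simp add: ds_def)
  have "P (nn_dist x i n k) \<longleftrightarrow> P (sort ds ! (k - 1))" unfolding nn_dist_def ds_def js_def ..
  also have "\<dots> \<longleftrightarrow> k - 1 < length (filter P (sort ds))"
  proof (rule sorted_antimono_nth)
    show "P a" if "a \<le> b" "P b" for a b using that by (rule P)
  qed (use k len in auto)
  also have "length (filter P (sort ds)) = length (filter (\<lambda>j. P (dist (x i) (x j))) js)"
    unfolding ds_def by (simp only: filter_sort length_sort filter_map length_map o_def)
  also have "\<dots> = card (set (filter (\<lambda>j. P (dist (x i) (x j))) js))"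
    by (rule distinct_card[symmetric]) (use js in simp)
  also have "set (filter (\<lambda>j. P (dist (x i) (x j))) js) = {j \<in> {1..n} - {i}. P (dist (x i) (x j))}"
    using js by auto
  finally show ?thesis using k by auto
qed

context cube_density
begin

lemma C_count_eq_card:
  assumes k: "1 \<le> k" "k < n"
  shows "C_count \<mu> t x n k = card {i \<in> {1..n}. cnt ({1..n} - {i}) x (mass_ball (v_thr t n k) (x i)) < k}"
proof -
  have "(measure \<mu> (cball (x i) (nn_dist x i n k)) > v_thr t n k)
      \<longleftrightarrow> cnt ({1..n} - {i}) x (mass_ball (v_thr t n k) (x i)) < k" if "i \<in> {1..n}" for i
  proof -
    have mono: "measure \<mu> (cball (x i) a) \<le> v_thr t n k"
      if "a \<le> b" "measure \<mu> (cball (x i) b) \<le> v_thr t n k" for a b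
    proof -
      have "measure \<mu> (cball (x i) a) \<le> measure \<mu> (cball (x i) b)"
        using that by (intro finite_measure_mono) (auto simp: sets_\<mu>)
      thus ?thesis using that by simp
    qed
    have "measure \<mu> (cball (x i) (nn_dist x i n k)) \<le> v_thr t n k
        \<longleftrightarrow> k \<le> cnt ({1..n} - {i}) x (mass_ball (v_thr t n k) (x i))"
      unfolding cnt_def mass_ball_def mem_Collect_eq
      by (rule nn_dist_le_iff[OF k that, of "\<lambda>a. measure \<mu> (cball (x i) a) \<le> v_thr t n k"]) (rule mono)
    thus ?thesis by linarith
  qed
  hence "C_count \<mu> t x n k = (\<Sum>i\<in>{1..n}. of_bool (cnt ({1..n} - {i}) x (mass_ball (v_thr t n k) (x i)) < k))"
    unfolding C_count_def by (intro sum.cong) auto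
  also have "\<dots> = card {i \<in> {1..n}. cnt ({1..n} - {i}) x (mass_ball (v_thr t n k) (x i)) < k}"
    by (simp add: Int_def)
  finally show ?thesis .
qed

end

section \<open>From good points to all counted points\<close>

context ball_system
begin

text \<open>The count differs from \<open>num_good\<close> only if a counted point lies outside
  \<open>Q\<close>; the last summand bounds the expected number of such points.\<close>

lemma count_poisson:
  fixes J :: "'i set"
  assumes k: "1 \<le> k" and J: "finite J" and l: "0 < l"
  shows "\<bar>\<P>(X in iid J. card {i \<in> J. cnt (J - {i}) X (E (X i)) < k} \<in> A)
      - measure (measure_pmf (poisson_pmf l)) A\<bar>
     \<le> exp l * (\<bar>l - real (card J) * cdf (card J - 1) k\<bar> + real (card J) * err_term (card J - 1))
        + real (card J) * cdf (card J - 1) k * measure M (space M - Q)"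
proof -
  let ?P = "iid J"
  define W where "W X = card {i \<in> J. cnt (J - {i}) X (E (X i)) < k}" for X
  interpret P: prob_space ?P using prob_space_M by (rule prob_space_PiM_const)
  have [measurable]: "W \<in> measurable ?P (count_space UNIV)"
    unfolding W_def using J by (intro measurable_card_pred pred_cnt_pair[OF E_pred refl]) auto
  have [measurable]: "(\<lambda>X. num_good J X) \<in> measurable ?P (count_space UNIV)"
    using J by (rule measurable_num_good)
  define B where "B i = {X \<in> space ?P. X i \<in> space M - Q \<and> cnt (J - {i}) X (E (X i)) < k}" for i
  have Bm: "B i \<in> sets ?P" if "i \<in> J" for i
  proof -
    have "Measurable.pred ?P (\<lambda>X. X i \<in> space M - Q \<and> cnt (J - {i}) X (E (X i)) < k)"
      using J Q_sets that by (intro pred_intros_logic pred_component pred_cnt_pair[OF E_pred refl]) auto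
    thus ?thesis unfolding B_def pred_def .
  qed
  have UB: "(\<Union>i\<in>J. B i) \<in> sets ?P" using J Bm by (rule sets.finite_UN)
  have eq: "W X = num_good J X" if "X \<in> space ?P" "X \<notin> (\<Union>i\<in>J. B i)" for X
  proof -
    have "{i \<in> J. cnt (J - {i}) X (E (X i)) < k} = {i \<in> J. good J X i}"
      using that by (auto simp: B_def good_def space_UNIV)
    thus ?thesis by (simp add: W_def num_good_def)
  qed
  have "\<bar>\<P>(X in ?P. W X \<in> A) - \<P>(X in ?P. num_good J X \<in> A)\<bar> \<le> measure ?P (\<Union>i\<in>J. B i)"
  proof -
    have *: "\<P>(X in ?P. a X \<in> A) \<le> \<P>(X in ?P. b X \<in> A) + measure ?P (\<Union>i\<in>J. B i)"
      if [measurable]: "a \<in> measurable ?P (count_space UNIV)" "b \<in> measurable ?P (count_space UNIV)"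
        and "\<And>X. X \<in> space ?P \<Longrightarrow> X \<notin> (\<Union>i\<in>J. B i) \<Longrightarrow> a X = b X" for a b :: "_ \<Rightarrow> nat"
      using UB that(3) by (intro order.trans[OF P.finite_measure_mono measure_Un_le]) auto
    have "\<P>(X in ?P. W X \<in> A) \<le> \<P>(X in ?P. num_good J X \<in> A) + measure ?P (\<Union>i\<in>J. B i)"
      by (rule *) (use eq in auto)
    moreover have "\<P>(X in ?P. num_good J X \<in> A) \<le> \<P>(X in ?P. W X \<in> A) + measure ?P (\<Union>i\<in>J. B i)"
      by (rule *) (use eq in auto)
    ultimately show ?thesis by linarith
  qed
  also have "measure ?P (\<Union>i\<in>J. B i) \<le> (\<Sum>i\<in>J. measure ?P (B i))"
    using J Bm by (intro P.finite_measure_subadditive_finite) auto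
  also have "\<dots> \<le> (\<Sum>i\<in>J. cdf (card J - 1) k * measure M (space M - Q))"
    unfolding B_def using J Q_sets by (intro sum_mono prob_good_le) auto
  also have "\<dots> = real (card J) * cdf (card J - 1) k * measure M (space M - Q)" by simp
  finally show ?thesis
    using num_good_poisson[OF k J l, of A] unfolding W_def by linarith
qed

end

subsection \<open>Asymptotics of the threshold\<close>

text \<open>From \<open>f * h - 1 = (f - 1) * h + (h - 1)\<close> with \<open>h\<close> bounded:
  factors \<open>1 + O(g)\<close> are closed under products.\<close>

lemma bigo_mult_minus_one:
  fixes f h g :: "nat \<Rightarrow> real"
  assumes f: "(\<lambda>n. f n - 1) \<in> O(g)" and h: "(\<lambda>n. h n - 1) \<in> O(g)" and g: "g \<in> O(\<lambda>_. 1)"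
  shows "(\<lambda>n. f n * h n - 1) \<in> O(g)"
proof -
  have "(\<lambda>n. (h n - 1) + 1) \<in> O(\<lambda>_. 1)"
    by (rule sum_in_bigo(1)[OF landau_o.big_trans[OF h g]]) simp
  moreover have "(\<lambda>n. (h n - 1) + 1) = h" by auto
  ultimately have "h \<in> O(\<lambda>_. 1)" by metis
  hence "(\<lambda>n. (f n - 1) * h n) \<in> O(\<lambda>n. g n * 1)"
    using f by (intro landau_o.big.mult) auto
  hence "(\<lambda>n. (f n - 1) * h n) \<in> O(g)" by simp
  from sum_in_bigo(1)[OF this h] have "(\<lambda>n. (f n - 1) * h n + (h n - 1)) \<in> O(g)" .
  thus ?thesis by (simp add: algebra_simps)
qed

lemma bigo_cmult:
  fixes f g :: "nat \<Rightarrow> real"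
  assumes "f \<in> O(g)"
  shows "(\<lambda>n. c * f n) \<in> O(g)"
  using assms by (cases "c = 0") simp_all

lemma bigo_power_minus_one:
  fixes f g :: "nat \<Rightarrow> real"
  assumes f: "(\<lambda>n. f n - 1) \<in> O(g)" and g: "g \<in> O(\<lambda>_. 1)"
  shows "(\<lambda>n. f n ^ a - 1) \<in> O(g)"
proof (induction a)
  case (Suc a)
  show ?case using bigo_mult_minus_one[OF f Suc g] by simp
qed simp

context
  fixes t :: real and k :: nat
  assumes k: "1 \<le> k"
begin

text \<open>\<open>n\<close> times the threshold: the mean number of points that \<open>n\<close>
  independent draws place in a ball of the threshold mass.\<close>

private definition s :: "nat \<Rightarrow> real" where
  "s n = (t - ln (fact (k - 1))) + ln (real n) + (real k - 1) * ln (ln (real n))"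

private lemma v_eq: "v_thr t n k = s n / real n"
  by (simp add: v_thr_def s_def algebra_simps)

private lemma s_bounds: "\<forall>\<^sub>F n in sequentially. ln (real n) / 2 \<le> s n \<and> s n \<le> 2 * ln (real n)"
proof -
  have lim: "((\<lambda>n. s n / ln (real n)) \<longlongrightarrow> 1) sequentially"
    unfolding s_def by real_asymp
  have "\<forall>\<^sub>F n in sequentially. 1 / 2 < s n / ln (real n)" "\<forall>\<^sub>F n in sequentially. s n / ln (real n) < 2"
    by (rule order_tendstoD[OF lim], simp)+
  moreover have "\<forall>\<^sub>F n::nat in sequentially. 0 < ln (real n)" by real_asymp
  ultimately show ?thesis by eventually_elim (auto simp: field_simps)
qed

text \<open>The terms of the threshold are chosen for this. The mean number of counted points is
  about \<open>n * exp (- s n) * s n ^ (k - 1) / fact (k - 1)\<close>, and with \<open>s n\<close>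
  close to \<open>ln n\<close> it is close to \<open>exp (- t)\<close>.\<close>

private lemma exp_s:
  assumes "1 < ln (real n)"
  shows "real n * exp (- s n) = exp (- t) * fact (k - 1) / ln (real n) ^ (k - 1)"
proof -
  have n: "0 < real n" using assms by (cases "n = 0") auto
  have "(real k - 1) * ln (ln (real n)) = ln (ln (real n) ^ (k - 1))"
    using assms k by (simp add: ln_realpow of_nat_diff)
  moreover have "0 < ln (real n) ^ (k - 1)" using assms by simp
  ultimately have "exp (s n) = exp t / fact (k - 1) * real n * ln (real n) ^ (k - 1)"
    using n assms by (simp add: s_def exp_add exp_diff)
  moreover have "n \<noteq> Suc 0" using assms by auto
  ultimately show ?thesis using n assms by (simp add: exp_minus field_simps)
qed

private lemma large:
  "\<forall>\<^sub>F n in sequentially. 1 < ln (real n) \<and> ln (real n) / 2 \<le> s n \<and> s n \<le> 2 * ln (real n)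
     \<and> 0 < s n \<and> s n / real n \<le> 1 / 2 \<and> 2 * k + 4 \<le> n"
proof -
  have "\<forall>\<^sub>F n::nat in sequentially. 1 < ln (real n)" by real_asymp
  moreover have "\<forall>\<^sub>F n::nat in sequentially. 2 * ln (real n) / real n \<le> 1 / 2" by real_asymp
  moreover have "\<forall>\<^sub>F n in sequentially. 2 * k + 4 \<le> n" by (rule eventually_ge_at_top)
  ultimately show ?thesis using s_bounds
  proof eventually_elim
    case (elim n)
    have "s n / real n \<le> 2 * ln (real n) / real n" using elim by (intro divide_right_mono) auto
    thus ?case using elim by auto
  qed
qed

lemma v_thr_large:
  "\<forall>\<^sub>F n in sequentially. 1 < ln (real n) \<and> ln (real n) / 2 \<le> real n * v_thr t n k
     \<and> real n * v_thr t n k \<le> 2 * ln (real n) \<and> 0 < v_thr t n k \<and> v_thr t n k \<le> 1 / 2 \<and> 2 * k + 4 \<le> n"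
  using large
proof eventually_elim
  case (elim n)
  thus ?case by (auto simp: v_eq)
qed

text \<open>One constant serves the counts over \<open>n\<close>, \<open>n - 1\<close> and
  \<open>n - 2\<close> indices. At \<open>a = k - 1\<close> the bound shows the gain of
  \<open>1 / ln n\<close> from one allowed point fewer.\<close>

lemma binom_cdf_threshold_le:
  obtains C where "0 \<le> C" "\<forall>\<^sub>F n in sequentially. \<forall>m a. m \<le> n \<and> n \<le> m + 2 \<and> a \<le> k \<longrightarrow>
      real n * binom_cdf m (v_thr t n k) a \<le> C * (ln (real n) ^ a / ln (real n) ^ k)"
proof
  define C where "C = exp (real k) * real k * 2 ^ k * exp 1 * (exp (- t) * fact (k - 1))"
  show C0: "0 \<le> C" by (simp add: C_def)
  show "\<forall>\<^sub>F n in sequentially. \<forall>m a. m \<le> n \<and> n \<le> m + 2 \<and> a \<le> k \<longrightarrow>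
      real n * binom_cdf m (v_thr t n k) a \<le> C * (ln (real n) ^ a / ln (real n) ^ k)"
    using large
  proof (eventually_elim, intro allI impI, elim conjE)
    fix n m a
    assume n: "1 < ln (real n)" "s n \<le> 2 * ln (real n)" "0 < s n" "s n / real n \<le> 1 / 2" "2 * k + 4 \<le> n"
      and m: "m \<le> n" "n \<le> m + 2" and a: "a \<le> k"
    define L where "L = ln (real n)"
    define v where "v = s n / real n"
    have v: "0 \<le> v" "v \<le> 1 / 2" "real n * v = s n" using n by (auto simp: v_def)
    have L: "1 < L" using n by (simp add: L_def)
    \<comment> \<open>At most two indices are missing, which lowers the mean by at most
      \<open>2 * v \<le> 1\<close>; this is the origin of the factor \<open>exp 1\<close> in
      \<open>C\<close>.\<close>
    have mv: "real m * v \<le> s n" "s n - 1 \<le> real m * v"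
    proof -
      have "real m * v \<le> real n * v" using v m by (intro mult_right_mono) auto
      thus "real m * v \<le> s n" using v by simp
      have "real n * v \<le> (real m + 2) * v" using v m by (intro mult_right_mono) auto
      thus "s n - 1 \<le> real m * v" using v by (simp add: algebra_simps)
    qed
    show "real n * binom_cdf m (v_thr t n k) a \<le> C * (ln (real n) ^ a / ln (real n) ^ k)"
    proof (cases a)
      case 0
      thus ?thesis using C0 n by (simp add: binom_cdf_def)
    next
      case (Suc b)
      have "binom_cdf m v a \<le> exp (real a) * (\<Sum>j<a. (real m * v) ^ j * exp (- (real m * v)))"
        using v by (intro binom_cdf_le_poisson) auto
      also have "\<dots> \<le> exp (real k) * (\<Sum>j<a. (2 ^ k * L ^ b) * (exp 1 * exp (- s n)))"
      proof (intro mult_mono sum_mono sum_nonneg)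
        fix j assume j: "j \<in> {..<a}"
        have "(real m * v) ^ j \<le> (2 * L) ^ j" using mv n v by (intro power_mono) (auto simp: L_def)
        also have "\<dots> = 2 ^ j * L ^ j" by (simp add: power_mult_distrib)
        also have "\<dots> \<le> 2 ^ k * L ^ b"
          using j a Suc L by (intro mult_mono power_increasing) auto
        finally show "(real m * v) ^ j \<le> 2 ^ k * L ^ b" .
        have "exp (- (real m * v)) \<le> exp (1 - s n)" using mv by simp
        thus "exp (- (real m * v)) \<le> exp 1 * exp (- s n)" by (simp add: exp_diff exp_minus field_simps)
      qed (use a v L in auto)
      also have "\<dots> = exp (real k) * real a * 2 ^ k * L ^ b * (exp 1 * exp (- s n))" by simp
      also have "\<dots> \<le> exp (real k) * real k * 2 ^ k * L ^ b * (exp 1 * exp (- s n))"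
        using a L by (intro mult_right_mono mult_left_mono) auto
      finally have "real n * binom_cdf m v a \<le> real n * (exp (real k) * real k * 2 ^ k * L ^ b * (exp 1 * exp (- s n)))"
        by (rule mult_left_mono) simp
      also have "\<dots> = exp (real k) * real k * 2 ^ k * L ^ b * exp 1 * (real n * exp (- s n))" by simp
      also have "\<dots> = C * (L ^ b / L ^ (k - 1))"
        using exp_s[OF n(1)] by (simp add: C_def L_def)
      also have "L ^ b / L ^ (k - 1) = L ^ a / L ^ k"
      proof -
        have "L ^ a = L * L ^ b" "L ^ k = L * L ^ (k - 1)" using Suc k by (auto simp flip: power_Suc)
        thus ?thesis using L by simp
      qed
      finally show ?thesis by (simp add: v_eq v_def L_def)
    qed
  qed
qed

private abbreviation (input) g :: "nat \<Rightarrow> real" where "g \<equiv> \<lambda>n. ln (ln (real n)) / ln (real n)"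

private lemma g_bounded: "g \<in> O(\<lambda>_. 1)"
  by real_asymp

text \<open>\<open>(n - 1 choose (k - 1)) * fact (k - 1)\<close> is a falling factorial with
  \<open>k - 1\<close> factors, each between \<open>n - k\<close> and \<open>n\<close>.\<close>

private lemma choose_bounds:
  assumes "k \<le> n"
  shows "real (n - 1 choose (k - 1)) * fact (k - 1) \<le> real n ^ (k - 1)"
    and "(real n - real k) ^ (k - 1) \<le> real (n - 1 choose (k - 1)) * fact (k - 1)"
proof -
  have "(n - 1 choose (k - 1)) * fact (k - 1) \<le> (n - 1) ^ (k - 1)" by (rule binomial_fact_pow)
  also have "\<dots> \<le> n ^ (k - 1)" by (intro power_mono) auto
  finally have "real ((n - 1 choose (k - 1)) * fact (k - 1)) \<le> real (n ^ (k - 1))" by (simp only: of_nat_le_iff)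
  thus "real (n - 1 choose (k - 1)) * fact (k - 1) \<le> real n ^ (k - 1)" by simp
  have "(real n - real k) ^ (k - 1) = (\<Prod>i<k - 1. real n - real k)" by simp
  also have "\<dots> \<le> (\<Prod>i<k - 1. real (n - 1) - real i)" using assms k by (intro prod_mono) auto
  also have "\<dots> = real (n - 1 choose (k - 1)) * fact (k - 1)"
    by (simp add: binomial_gbinomial gbinomial_prod_rev atLeast0LessThan)
  finally show "(real n - real k) ^ (k - 1) \<le> real (n - 1 choose (k - 1)) * fact (k - 1)" .
qed

text \<open>The quotient \<open>s n / ln n\<close> is 1 plus a term of order \<open>1 / ln n\<close>
  plus \<open>(k - 1) * ln (ln n) / ln n\<close>. For \<open>k \<ge> 2\<close> this alone already
  has the order of the target rate.\<close>

private lemma s_ratio: "(\<lambda>n. (s n / ln (real n)) ^ (k - 1) - 1) \<in> O(g)"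
proof (rule bigo_power_minus_one[OF _ g_bounded])
  have "(\<lambda>n::nat. (t - ln (fact (k - 1))) * (1 / ln (real n)) + (real k - 1) * (ln (ln (real n)) / ln (real n))) \<in> O(g)"
  proof (rule sum_in_bigo)
    have "(\<lambda>n::nat. 1 / ln (real n)) \<in> O(g)" by real_asymp
    thus "(\<lambda>n::nat. (t - ln (fact (k - 1))) * (1 / ln (real n))) \<in> O(g)" by (rule bigo_cmult)
  qed (rule bigo_cmult, simp)
  moreover have "\<forall>\<^sub>F n::nat in sequentially. s n / ln (real n) - 1
      = (t - ln (fact (k - 1))) * (1 / ln (real n)) + (real k - 1) * (ln (ln (real n)) / ln (real n))"
    using large by eventually_elim (simp add: s_def field_simps)
  ultimately show "(\<lambda>n. s n / ln (real n) - 1) \<in> O(g)"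
    by (subst landau_o.big.in_cong)
qed

text \<open>The binomial term with \<open>k - 1\<close> successes carries the limit. It is enclosed
  between \<open>exp (- t) * B n\<close> and \<open>exp (- t) * U n\<close>, where \<open>B\<close>
  and \<open>U\<close> are \<open>1 + O(g)\<close>.\<close>

private lemma main_term: "(\<lambda>n. real n * (real (n - 1 choose (k - 1)) * (s n / real n) ^ (k - 1) * (1 - s n / real n) ^ (n - k))
    - exp (- t)) \<in> O(g)"
proof -
  \<comment> \<open>The exponential in \<open>U\<close> pays for the exponent \<open>n - k\<close>
    in place of \<open>n\<close>; that in \<open>B\<close> comes from
    \<open>1 - v \<ge> exp (- v - 2 * v\<^sup>2)\<close> together with
    \<open>n * v \<le> 2 * ln n\<close>.\<close>
  define U where "U n = (s n / ln (real n)) ^ (k - 1) * exp (2 * real k * ln (real n) / real n)" for n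
  define B where "B n = (s n / ln (real n)) ^ (k - 1) * ((1 - real k / real n) ^ (k - 1) * exp (- 8 * (ln (real n))\<^sup>2 / real n))" for n
  have U: "(\<lambda>n. U n - 1) \<in> O(g)"
    unfolding U_def
  proof (rule bigo_mult_minus_one[OF s_ratio _ g_bounded])
    have "0 < real k" using k by simp
    thus "(\<lambda>n. exp (2 * real k * ln (real n) / real n) - 1) \<in> O(g)" by real_asymp
  qed
  have B: "(\<lambda>n. B n - 1) \<in> O(g)"
    unfolding B_def
  proof (intro bigo_mult_minus_one[OF s_ratio _ g_bounded] bigo_mult_minus_one[OF _ _ g_bounded]
      bigo_power_minus_one[OF _ g_bounded])
    have "0 < real k" using k by simp
    thus "(\<lambda>n. 1 - real k / real n - 1) \<in> O(g)" by real_asymp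
    show "(\<lambda>n. exp (- 8 * (ln (real n))\<^sup>2 / real n) - 1) \<in> O(g)" by real_asymp
  qed
  have "\<forall>\<^sub>F n in sequentially. norm (real n * (real (n - 1 choose (k - 1)) * (s n / real n) ^ (k - 1) * (1 - s n / real n) ^ (n - k))
    - exp (- t)) \<le> norm (exp (- t) * \<bar>U n - 1\<bar> + exp (- t) * \<bar>B n - 1\<bar>)"
    using large
  proof eventually_elim
    case (elim n)
    define v where "v = s n / real n"
    define L where "L = ln (real n)"
    define b where "b = real (n - 1 choose (k - 1)) * fact (k - 1)"
    define D where "D = real n * (real (n - 1 choose (k - 1)) * v ^ (k - 1) * (1 - v) ^ (n - k))"
    have v: "0 < v" "v \<le> 1 / 2" "real n * v = s n" using elim by (auto simp: v_def)
    have n: "0 < real n" "k \<le> n" using elim by auto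
    have L: "1 < L" using elim by (simp add: L_def)
    have vL: "v \<le> 2 * L / real n" using elim n by (simp add: v_def L_def divide_right_mono)
    have D: "D = (b * v ^ (k - 1)) * ((1 - v) ^ (n - k) * exp (s n)) * (real n * exp (- s n)) / fact (k - 1)"
      unfolding D_def b_def by (simp add: exp_minus)
    have scale: "real n ^ (k - 1) * v ^ (k - 1) * (real n * exp (- s n)) / fact (k - 1) = exp (- t) * (s n / L) ^ (k - 1)"
      using exp_s[of n] elim v by (simp add: L_def power_divide flip: power_mult_distrib)
    have e1: "(1 - v) ^ (n - k) * exp (s n) \<le> exp (2 * real k * L / real n)"
    proof -
      have "(1 - v) ^ (n - k) \<le> exp (- v) ^ (n - k)"
        using v exp_ge_add_one_self[of "- v"] by (intro power_mono) auto
      also have "\<dots> = exp (real k * v - s n)"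
        using n v by (simp add: of_nat_diff algebra_simps flip: exp_of_nat_mult)
      finally have "(1 - v) ^ (n - k) * exp (s n) \<le> exp (real k * v - s n) * exp (s n)"
        by (rule mult_right_mono) simp
      also have "\<dots> = exp (real k * v)" by (simp flip: exp_add)
      also have "\<dots> \<le> exp (real k * (2 * L / real n))"
        using mult_left_mono[OF vL, of "real k"] by simp
      finally show ?thesis by (simp add: mult_ac)
    qed
    have e2: "exp (- 8 * L\<^sup>2 / real n) \<le> (1 - v) ^ (n - k) * exp (s n)"
    proof -
      have "- v - 2 * v\<^sup>2 \<le> ln (1 - v)"
        using ln_one_minus_pos_lower_bound[of v] v by simp
      hence "real n * (- v - 2 * v\<^sup>2) \<le> real n * ln (1 - v)" by (rule mult_left_mono) simp
      hence "exp (real n * (- v - 2 * v\<^sup>2)) \<le> exp (ln (1 - v)) ^ n"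
        by (simp flip: exp_of_nat_mult)
      also have "\<dots> = (1 - v) ^ n" using v by simp
      also have "\<dots> \<le> (1 - v) ^ (n - k)" using v by (intro power_decreasing) auto
      finally have "exp (real n * (- v - 2 * v\<^sup>2)) * exp (s n) \<le> (1 - v) ^ (n - k) * exp (s n)"
        by (rule mult_right_mono) simp
      moreover have "exp (real n * (- v - 2 * v\<^sup>2)) * exp (s n) = exp (- 2 * (s n)\<^sup>2 / real n)"
        using n by (simp add: v_def power2_eq_square field_simps flip: exp_add)
      moreover have "exp (- 8 * L\<^sup>2 / real n) \<le> exp (- 2 * (s n)\<^sup>2 / real n)"
      proof -
        have "(s n)\<^sup>2 \<le> (2 * L)\<^sup>2" using elim by (intro power_mono) (auto simp: L_def)
        thus ?thesis using n by (simp add: divide_right_mono)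
      qed
      ultimately show ?thesis by linarith
    qed
    define X where "X = (1 - v) ^ (n - k) * exp (s n)"
    define Y where "Y = v ^ (k - 1) * (real n * exp (- s n)) / fact (k - 1)"
    have D': "D = b * X * Y" unfolding D X_def Y_def by simp
    have XY: "0 \<le> X" "0 \<le> Y" "0 \<le> b" using v by (auto simp: X_def Y_def b_def)
    have scale': "real n ^ (k - 1) * Y = exp (- t) * (s n / L) ^ (k - 1)"
      using scale by (simp add: Y_def)
    have "D \<le> real n ^ (k - 1) * exp (2 * real k * L / real n) * Y"
      unfolding D' using choose_bounds(1)[OF n(2)] e1 XY by (intro mult_mono) (auto simp: b_def X_def)
    also have "\<dots> = exp (- t) * U n"
      using scale' by (simp add: U_def L_def mult_ac)
    finally have up: "D \<le> exp (- t) * U n" .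
    have nk: "0 \<le> real n - real k" using n by simp
    have "exp (- t) * B n = (real n ^ (k - 1) * Y) * ((1 - real k / real n) ^ (k - 1) * exp (- 8 * L\<^sup>2 / real n))"
      unfolding scale' by (simp add: B_def L_def)
    also have "\<dots> = (real n - real k) ^ (k - 1) * exp (- 8 * L\<^sup>2 / real n) * Y"
    proof -
      have "real n ^ (k - 1) * (1 - real k / real n) ^ (k - 1) = (real n - real k) ^ (k - 1)"
        using n by (simp add: right_diff_distrib flip: power_mult_distrib)
      thus ?thesis by (simp add: mult_ac)
    qed
    also have "\<dots> \<le> D"
      unfolding D' using choose_bounds(2)[OF n(2)] e2 XY nk by (intro mult_mono) (auto simp: b_def X_def)
    finally have low: "exp (- t) * B n \<le> D" .
    have "\<bar>D - exp (- t)\<bar> \<le> \<bar>exp (- t) * (U n - 1)\<bar> + \<bar>exp (- t) * (B n - 1)\<bar>"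
      using up low by (simp add: right_diff_distrib)
    thus ?case unfolding D_def v_def by (simp add: abs_mult)
  qed
  moreover have "(\<lambda>n. exp (- t) * \<bar>U n - 1\<bar> + exp (- t) * \<bar>B n - 1\<bar>) \<in> O(g)"
    using U B by (intro sum_in_bigo bigo_cmult) simp_all
  ultimately show ?thesis by (rule landau_o.big_mono[THEN landau_o.big_trans])
qed

text \<open>The binomial terms below \<open>k - 1\<close> form the same sum at \<open>k - 1\<close>,
  which is \<open>O(1 / ln n)\<close> after multiplication by \<open>n\<close>; the remaining term
  is that of \<open>main_term\<close>.\<close>

lemma binom_cdf_threshold_limit:
  "(\<lambda>n. exp (- t) - real n * binom_cdf (n - 1) (v_thr t n k) k) \<in> O(\<lambda>n. ln (ln (real n)) / ln (real n))"
proof -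
  obtain C where C: "0 \<le> C" "\<forall>\<^sub>F n in sequentially. \<forall>m a. m \<le> n \<and> n \<le> m + 2 \<and> a \<le> k \<longrightarrow>
      real n * binom_cdf m (v_thr t n k) a \<le> C * (ln (real n) ^ a / ln (real n) ^ k)"
    by (rule binom_cdf_threshold_le)
  define T where "T n = real n * (real (n - 1 choose (k - 1)) * (s n / real n) ^ (k - 1) * (1 - s n / real n) ^ (n - k))" for n
  define R where "R n = real n * binom_cdf (n - 1) (v_thr t n k) (k - 1)" for n
  have "\<forall>\<^sub>F n in sequentially. norm (R n) \<le> norm (C * (1 / ln (real n)))"
    using C(2) v_thr_large
  proof eventually_elim
    case (elim n)
    have "R n \<le> C * (ln (real n) ^ (k - 1) / ln (real n) ^ k)"
      unfolding R_def using elim(1)[rule_format, of "n - 1" "k - 1"] by simp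
    also have "ln (real n) ^ (k - 1) / ln (real n) ^ k = 1 / ln (real n)"
    proof -
      have "ln (real n) ^ k = ln (real n) * ln (real n) ^ (k - 1)" using k by (simp flip: power_Suc)
      thus ?thesis using elim(2) by simp
    qed
    finally have "R n \<le> C * (1 / ln (real n))" .
    moreover have "0 \<le> R n" unfolding R_def using elim(2) by (intro mult_nonneg_nonneg binom_cdf_nonneg) auto
    ultimately show ?case using C(1) elim(2) by simp
  qed
  moreover have "(\<lambda>n::nat. C * (1 / ln (real n))) \<in> O(g)"
    by (rule bigo_cmult) real_asymp
  ultimately have R: "R \<in> O(g)" by (rule landau_o.big_mono[THEN landau_o.big_trans])
  have "(\<lambda>n. T n - exp (- t)) \<in> O(g)" unfolding T_def by (rule main_term)
  hence "(\<lambda>n. - 1 * (T n - exp (- t)) - R n) \<in> O(g)"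
    using sum_in_bigo(2)[OF bigo_cmult[of _ _ "- 1"] R] by blast
  moreover have "- 1 * (T n - exp (- t)) - R n = exp (- t) - real n * binom_cdf (n - 1) (v_thr t n k) k" for n
  proof -
    have "{..<k} = insert (k - 1) {..<k - 1}" using k by auto
    moreover have "n - 1 - (k - 1) = n - k" using k by auto
    ultimately have "binom_cdf (n - 1) (v_thr t n k) k = binom_cdf (n - 1) (v_thr t n k) (k - 1)
        + real (n - 1 choose (k - 1)) * (s n / real n) ^ (k - 1) * (1 - s n / real n) ^ (n - k)"
      by (simp add: binom_cdf_def v_eq)
    thus ?thesis by (simp add: T_def R_def algebra_simps)
  qed
  ultimately show ?thesis by (simp only:)
qed

end

section \<open>Size of the error terms at the threshold\<close>

context ball_system
begin

text \<open>In the application \<open>L = ln n\<close>, which is the order of the expected number \<open>n v\<close> of points in a ball, and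
  \<open>G = ln L / L\<close> is the target rate.\<close>
lemma err_term_le:
  fixes n :: nat and C L G A cu cp \<kappa> :: real
  assumes n: "2 * k + 4 \<le> n" and k: "1 \<le> k" and L: "1 < L" "L / 2 \<le> real n * v" "real n * v \<le> 2 * L"
    and lnL: "1 \<le> ln L"
    and C: "0 \<le> C" "\<And>m. m \<le> n \<Longrightarrow> n \<le> m + 2 \<Longrightarrow> real n * cdf m k \<le> C" "real n * cdf (n - 2) (k - 1) \<le> C / L"
    and u: "u = cu * v" "0 \<le> cu" and \<eta>: "real n * \<eta> = cp * (4 / \<kappa> * ln L)" "0 \<le> cp" "0 < \<kappa>"
    and w1: "real n * w1 = 4 * ln L" and w2: "w2 = b * v" "0 < b"
    and G: "ln L / L = G" "1 / L \<le> G" "L / real n \<le> G" "L ^ 2 * exp (- L / 8) \<le> G" "L * exp (- (b / 8) * L) \<le> G"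
    and q: "measure M (space M - Q) \<le> cq * (1 / L)" "0 \<le> cq"
  shows "real n * err_term (n - 1) \<le> (2 * (C * (cp * (4 / \<kappa>) + 2 * tail_const k) + 2 * C * tail_const k * cu)
     + C * (2 * (5 * tail_const k * exp 1 * (real k + 2) + 4 * (real k + 2)) + 2 * (C * (1 + 2 * cu) + 2 * C) + cq)) * G"
proof -
  let ?T = "tail_const k"
  let ?q = "measure M (space M - Q)"
  let ?kv = "err_delete (n - 1) * (real k + real (n - 1) * v)"
  let ?c3 = "C * (cp * (4 / \<kappa>) + 2 * ?T) + 2 * C * ?T * cu"
  let ?c2 = "C * (1 + 2 * cu) + 2 * C"
  let ?c1 = "5 * ?T * exp 1 * (real k + 2) + 4 * (real k + 2)"
  have T0: "0 \<le> ?T" by (rule tail_const_nonneg)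
  have n0: "0 < real n" using n by simp
  have "0 \<le> 1 / L" using L by simp
  hence G0: "0 \<le> G" using G(2) by linarith
  have v2L: "v \<le> 2 * L / real n" using L n0 by (simp add: field_simps)
  have p: "cdf m k \<le> C / real n" if "m \<le> n" "n \<le> m + 2" for m
    using C(2)[OF that] n0 by (simp add: field_simps)
  have mv: "real (n - 1) * v \<le> 2 * L"
  proof -
    have "real (n - 1) * v \<le> real n * v" using v_pos by (intro mult_right_mono) auto
    thus ?thesis using L by simp
  qed
  have ED: "?kv \<le> (?c1) * G"
  proof -
    \<comment> \<open>Since \<open>(n - 1) / 2 - 1 = n / 2 - 3 / 2\<close>, the correction
      \<open>3 / 2 * v\<close> is absorbed by \<open>exp 1\<close>, and
      \<open>n * v \<ge> L / 2\<close> leaves \<open>exp (- L / 8)\<close>.\<close>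
    have "exp (- ((real (n - 1) / 2 - 1) * v / 2)) \<le> exp (1 - L / 8)"
    proof -
      have "real (n - 1) = real n - 1" using n by simp
      hence "(real (n - 1) / 2 - 1) * v = real n * v / 2 - 3 / 2 * v"
        by (simp only:) (simp add: left_diff_distrib diff_divide_distrib)
      hence "- ((real (n - 1) / 2 - 1) * v / 2) \<le> 1 - L / 8" using L v_half by linarith
      thus ?thesis by simp
    qed
    also have "\<dots> = exp 1 * exp (- L / 8)" by (simp flip: exp_add)
    finally have e: "exp (- ((real (n - 1) / 2 - 1) * v / 2)) \<le> exp 1 * exp (- L / 8)" .
    have "err_delete (n - 1) \<le> ?T * (5 * L) * (exp 1 * exp (- L / 8)) + 4 / real n"
      unfolding err_delete_def
    proof (intro add_mono mult_mono e mult_nonneg_nonneg T0)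
      show "1 + 2 * real (n - 1) * v \<le> 5 * L" using mv L by simp
      show "2 / real (n - 1) \<le> 4 / real n" using n by (simp add: of_nat_diff field_simps)
    qed (use v_pos T0 L in auto)
    moreover have "real k + real (n - 1) * v \<le> (real k + 2) * L"
      using mv L mult_left_mono[of 1 L "real k"] by (simp add: algebra_simps)
    ultimately have "?kv
        \<le> (?T * (5 * L) * (exp 1 * exp (- L / 8)) + 4 / real n) * ((real k + 2) * L)"
      using v_pos T0 L by (intro mult_mono) auto
    also have "\<dots> = 5 * ?T * exp 1 * (real k + 2) * (L ^ 2 * exp (- L / 8)) + 4 * (real k + 2) * (L / real n)"
      by (simp add: algebra_simps power2_eq_square)
    also have "\<dots> \<le> 5 * ?T * exp 1 * (real k + 2) * G + 4 * (real k + 2) * G"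
      using T0 G by (intro add_mono mult_left_mono) auto
    finally show ?thesis by (simp add: algebra_simps)
  qed
  have ES: "err_shift (n - 1) \<le> (?c2) * G"
  proof -
    have "real (n - 1) * u \<le> 2 * cu * L"
      using mult_left_mono[OF mv u(2)] by (simp add: u(1) mult_ac)
    hence "1 + real (n - 1) * u \<le> (1 + 2 * cu) * L"
      using L by (simp add: distrib_right)
    hence "cdf (n - 1) k * (1 + real (n - 1) * u) \<le> C / real n * ((1 + 2 * cu) * L)"
      using p[of "n - 1"] n C(1) u_nonneg by (intro mult_mono) auto
    moreover have "real (n - 1) * (cdf (n - 1 - 1) k * v) \<le> C * (2 * L / real n)"
    proof -
      have "n - 1 - 1 = n - 2" by simp
      hence "real (n - 1) * (cdf (n - 1 - 1) k * v) \<le> real n * cdf (n - 2) k * v"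
        using v_pos cdf_nonneg[of "n - 2" k] by (simp add: mult_right_mono mult.assoc)
      also have "\<dots> \<le> C * (2 * L / real n)"
        using C(1) C(2)[of "n - 2"] n v2L v_pos by (intro mult_mono) auto
      finally show ?thesis .
    qed
    ultimately have "err_shift (n - 1) \<le> C / real n * ((1 + 2 * cu) * L) + C * (2 * L / real n)"
      unfolding err_shift_def by (rule add_mono)
    also have "\<dots> = (?c2) * (L / real n)"
      by (simp only: distrib_right times_divide_eq_left times_divide_eq_right mult.assoc
            mult.left_commute[of 2 C] add_divide_distrib)
    also have "\<dots> \<le> (?c2) * G"
      using C(1) u(2) by (intro mult_left_mono G) simp_all
    finally show ?thesis .
  qed
  have PB: "real n * (real (n - 1) * pair_bound (n - 1)) \<le> (?c3) * G"
  proof -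
    define r1 where "r1 = n - 1 - 1 - (k - 1)"
    define r2 where "r2 = n - 1 - 1 - k"
    define e1 where "e1 = exp (- (real r1 * w1 / 2))"
    define e2 where "e2 = exp (- (real r2 * w2 / 2))"
    \<comment> \<open>At least half of the \<open>n\<close> indices are left for the difference of
      the balls; for \<open>r2\<close> this is exactly \<open>2 * k + 4 \<le> n\<close>.\<close>
    have "r1 + k + 1 = n" "r2 + k + 2 = n" unfolding r1_def r2_def using n k by auto
    hence "n \<le> 2 * r1" "n \<le> 2 * r2" using n by linarith+
    hence half: "real n / 2 \<le> real r1" "real n / 2 \<le> real r2" by linarith+
    have "0 \<le> real n * w1" unfolding w1 using lnL by simp
    hence w10: "0 \<le> w1" using n0 by (simp add: zero_le_mult_iff)
    have w20: "0 \<le> w2" unfolding w2(1) by (rule mult_nonneg_nonneg[OF less_imp_le[OF w2(2)] less_imp_le[OF v_pos]])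
    \<comment> \<open>Halving the indices and the factor 1/2 in the exponent cost a factor 4
      together, so \<open>n * w1 = 4 * ln L\<close> is what produces \<open>1 / L\<close>.\<close>
    have e1: "e1 \<le> 1 / L"
    proof -
      have "real n / 2 * w1 \<le> real r1 * w1" by (rule mult_right_mono[OF half(1) w10])
      moreover have "real n / 2 * w1 = 2 * ln L" using w1 by simp
      ultimately have "- (real r1 * w1 / 2) \<le> - ln L" by linarith
      hence "e1 \<le> exp (- ln L)" unfolding e1_def by simp
      also have "\<dots> = 1 / L" using L(1) by (simp add: exp_minus divide_inverse)
      finally show ?thesis .
    qed
    have e2: "e2 \<le> exp (- (b / 8) * L)"
    proof -
      have "b * (L / 2) \<le> b * (real n * v)" by (rule mult_left_mono[OF L(2) less_imp_le[OF w2(2)]])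
      also have "\<dots> = 2 * (real n / 2 * w2)" unfolding w2(1) by simp
      also have "\<dots> \<le> 2 * (real r2 * w2)" by (rule mult_left_mono[OF mult_right_mono[OF half(2) w20]]) simp
      finally have "- (real r2 * w2 / 2) \<le> - (b / 8) * L" by linarith
      thus ?thesis unfolding e2_def by simp
    qed
    have pb: "pair_bound (n - 1) = cdf (n - 2) (k - 1) * (\<eta> + ?T * e1 * v) + cdf (n - 2) k * (?T * e2) * u"
      unfolding pair_bound_def e1_def e2_def r1_def r2_def by (simp only: diff_diff_left one_add_one)
    have "real n * (real (n - 1) * pair_bound (n - 1)) \<le> real n * (real n * pair_bound (n - 1))"
      using pair_bound_nonneg by (intro mult_left_mono mult_right_mono) auto
    also have "real n * (real n * pair_bound (n - 1))
       = real n * cdf (n - 2) (k - 1) * (real n * \<eta> + ?T * e1 * (real n * v)) + real n * cdf (n - 2) k * (?T * e2) * (real n * u)"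
      unfolding pb by algebra
    \<comment> \<open>The dominant contribution is \<open>C / L\<close>, from the place taken in the
      ball, times \<open>n * \<eta>\<close>, of order \<open>ln L\<close>, from the points too close
      to separate.\<close>
    also have "\<dots> \<le> C / L * (cp * (4 / \<kappa> * ln L) + ?T * (1 / L) * (2 * L)) + C * (?T * exp (- (b / 8) * L)) * (cu * (2 * L))"
    proof (rule add_mono)
      have e0: "0 \<le> e1" "0 \<le> e2" by (simp_all add: e1_def e2_def)
      have nv: "0 \<le> real n * v" using v_pos by simp
      have "?T * e1 * (real n * v) \<le> ?T * (1 / L) * (2 * L)"
        by (rule mult_mono[OF mult_left_mono[OF e1 T0] L(3) _ nv]) (use T0 L in simp)
      hence i1: "real n * \<eta> + ?T * e1 * (real n * v) \<le> cp * (4 / \<kappa> * ln L) + ?T * (1 / L) * (2 * L)"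
        using \<eta>(1) by linarith
      show "real n * cdf (n - 2) (k - 1) * (real n * \<eta> + ?T * e1 * (real n * v))
          \<le> C / L * (cp * (4 / \<kappa> * ln L) + ?T * (1 / L) * (2 * L))"
      proof (rule mult_mono[OF C(3) i1])
        show "0 \<le> C / L" using C(1) L by simp
        show "0 \<le> real n * \<eta> + ?T * e1 * (real n * v)"
          using \<eta>_nonneg T0 e0 less_imp_le[OF v_pos] by (intro add_nonneg_nonneg mult_nonneg_nonneg) simp_all
      qed
      have "real n * u \<le> cu * (2 * L)" using mult_left_mono[OF L(3) u(2)] by (simp add: u(1) mult_ac)
      moreover have "real n * cdf (n - 2) k * (?T * e2) \<le> C * (?T * exp (- (b / 8) * L))"
      proof (rule mult_mono)
        show "real n * cdf (n - 2) k \<le> C" using n by (intro C(2)) auto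
        show "?T * e2 \<le> ?T * exp (- (b / 8) * L)" by (rule mult_left_mono[OF e2 T0])
      qed (use C(1) T0 e0 in simp_all)
      ultimately show "real n * cdf (n - 2) k * (?T * e2) * (real n * u) \<le> C * (?T * exp (- (b / 8) * L)) * (cu * (2 * L))"
        using C(1) T0 u_nonneg by (intro mult_mono[of "real n * cdf (n - 2) k * (?T * e2)"]) simp_all
    qed
    also have "\<dots> = C * (cp * (4 / \<kappa>)) * (ln L / L) + 2 * C * ?T * (1 / L) + 2 * C * ?T * cu * (L * exp (- (b / 8) * L))"
    proof -
      have "C / L * (cp * (q * l) + T * (1 / L) * (2 * L)) + C * (T * x) * (cu * (2 * L))
          = C * (cp * q) * (l / L) + 2 * C * T * (1 / L) + 2 * C * T * cu * (L * x)" for q l T x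
        using L by (simp add: divide_simps) (simp add: algebra_simps)?
      thus ?thesis .
    qed
    also have "\<dots> \<le> C * (cp * (4 / \<kappa>)) * G + 2 * C * ?T * G + 2 * C * ?T * cu * G"
      unfolding G(1) using C(1) T0 u(2) \<eta>(2,3) G(2,5) by (intro add_mono mult_left_mono order.refl) simp_all
    also have "\<dots> = (?c3) * G"
      by (simp add: algebra_simps)
    finally show ?thesis .
  qed
  have q': "?q \<le> cq * G"
    by (rule order.trans[OF q(1) mult_left_mono[OF G(2) q(2)]])
  have nn: "0 \<le> err_delete (n - 1)" "0 \<le> err_shift (n - 1)"
    using err_delete_nonneg cdf_nonneg v_pos u_nonneg by (auto simp: err_shift_def intro!: add_nonneg_nonneg mult_nonneg_nonneg)
  have "real n * err_term (n - 1) = 2 * (real n * (real (n - 1) * pair_bound (n - 1)))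
      + real n * cdf (n - 1) k * (2 * (?kv) + 2 * err_shift (n - 1) + ?q)"
    unfolding err_term_def by (simp add: algebra_simps)
  also have "\<dots> \<le> 2 * ((?c3) * G)
      + C * (2 * ((?c1) * G) + 2 * ((?c2) * G) + cq * G)"
  proof (rule add_mono)
    show "real n * cdf (n - 1) k * (2 * (?kv) + 2 * err_shift (n - 1) + ?q)
      \<le> C * (2 * ((?c1) * G) + 2 * ((?c2) * G) + cq * G)"
    proof (rule mult_mono)
      show "real n * cdf (n - 1) k \<le> C" using n by (intro C(2)) auto
      show "2 * (?kv) + 2 * err_shift (n - 1) + ?q
        \<le> 2 * ((?c1) * G) + 2 * ((?c2) * G) + cq * G"
        using ED ES q' by linarith
      show "0 \<le> 2 * (?kv) + 2 * err_shift (n - 1) + ?q"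
        using nn v_pos by (intro add_nonneg_nonneg mult_nonneg_nonneg) simp_all
    qed (rule C(1))
  qed (use PB in simp)
  finally show ?thesis by (simp add: algebra_simps)
qed

end

section \<open>The Poisson bound for the i.i.d. sample, uniform over all sets\<close>

context cube_density
begin

lemma C_count_poisson:
  assumes k: "1 \<le> k"
  obtains D where "\<forall>\<^sub>F n in sequentially. \<forall>A.
    \<bar>\<P>(X in PiM {1..n} (\<lambda>_. \<mu>). C_count \<mu> t X n k \<in> A)
       - measure (measure_pmf (poisson_pmf (exp (- t)))) A\<bar> \<le> D * (ln (ln (real n)) / ln (real n))"
proof -
  define v where "v n = v_thr t n k" for n
  define g :: "nat \<Rightarrow> real" where "g n = ln (ln (real n)) / ln (real n)" for n
  define l where "l = exp (- t)"
  obtain C where C: "0 \<le> C" "\<forall>\<^sub>F n in sequentially. \<forall>m a. m \<le> n \<and> n \<le> m + 2 \<and> a \<le> k \<longrightarrow>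
      real n * binom_cdf m (v n) a \<le> C * (ln (real n) ^ a / ln (real n) ^ k)"
    unfolding v_def by (rule binom_cdf_threshold_le[OF k])
  obtain C2 where C2: "0 < C2" "\<forall>\<^sub>F n in sequentially. \<bar>l - real n * binom_cdf (n - 1) (v n) k\<bar> \<le> C2 * \<bar>g n\<bar>"
    using landau_o.bigE[OF binom_cdf_threshold_limit[OF k, of t]] unfolding l_def v_def g_def by auto
  define \<kappa> where "\<kappa> = c_minus / 2 ^ CARD('d)"
  define b where "b = \<kappa> / c_plus"
  define cu where "cu = c_plus * 2 ^ CARD('d) / c_minus"
  define cq where "cq = f_plus * (2 * real CARD('d))"
  have pos: "0 < \<kappa>" "0 < b" "0 \<le> cu" "0 \<le> cq"
    using c_minus_pos c_plus_pos f_plus_pos by (auto simp: \<kappa>_def b_def cu_def cq_def)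
  define K where "K = 2 * (C * (c_plus * (4 / \<kappa>) + 2 * tail_const k) + 2 * C * tail_const k * cu)
     + C * (2 * (5 * tail_const k * exp 1 * (real k + 2) + 4 * (real k + 2)) + 2 * (C * (1 + 2 * cu) + 2 * C) + cq)"
  define D where "D = exp l * (C2 + K) + C * cq"
  have "\<forall>\<^sub>F n::nat in sequentially. 1 \<le> ln (ln (real n))" by real_asymp
  moreover have "\<forall>\<^sub>F n::nat in sequentially. 2 \<le> ln (real n)" by real_asymp
  moreover have "\<forall>\<^sub>F n in sequentially. 1 / ln (real n) \<le> g n" unfolding g_def by real_asymp
  moreover have "\<forall>\<^sub>F n in sequentially. ln (real n) / real n \<le> g n" unfolding g_def by real_asymp
  moreover have "\<forall>\<^sub>F n in sequentially. ln (real n) ^ 2 * exp (- ln (real n) / 8) \<le> g n" unfolding g_def by real_asymp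
  moreover have "\<forall>\<^sub>F n in sequentially. ln (real n) * exp (- (b / 8) * ln (real n)) \<le> g n"
    unfolding g_def using pos(2) by real_asymp
  moreover have "\<forall>\<^sub>F n::nat in sequentially. 4 / \<kappa> * ln (ln (real n)) \<le> ln (real n) / (2 * c_plus)"
    using pos(1) c_plus_pos by real_asymp
  \<comment> \<open>This makes a layer of width \<open>1 / ln n\<close> admissible in
    \<open>ball_system_mass_ball\<close>: the threshold is at most \<open>2 * ln n / n\<close>, and
    powers of \<open>ln n\<close> are negligible against \<open>n\<close>.\<close>
  moreover have "\<forall>\<^sub>F n::nat in sequentially. 2 * ln (real n) / real n < c_minus * (1 / ln (real n)) ^ CARD('d)"
  proof -
    have "((\<lambda>n::nat. ln (real n) ^ Suc CARD('d) / real n) \<longlongrightarrow> 0) sequentially"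
      by real_asymp
    hence "\<forall>\<^sub>F n::nat in sequentially. ln (real n) ^ Suc CARD('d) / real n < c_minus / 2"
      using c_minus_pos by (intro order_tendstoD(2)) auto
    moreover have "\<forall>\<^sub>F n::nat in sequentially. 1 < ln (real n)" by real_asymp
    moreover have "\<forall>\<^sub>F n::nat in sequentially. 0 < n" by (rule eventually_gt_at_top)
    ultimately show ?thesis
    proof eventually_elim
      case (elim n)
      have "2 * ln (real n) / real n * ln (real n) ^ CARD('d) < c_minus" using elim(1) by (simp add: mult_ac)
      thus ?case using elim(2) by (simp add: power_one_over pos_less_divide_eq)
    qed
  qed
  ultimately have "\<forall>\<^sub>F n in sequentially. \<forall>A.
    \<bar>\<P>(X in PiM {1..n} (\<lambda>_. \<mu>). C_count \<mu> t X n k \<in> A)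
       - measure (measure_pmf (poisson_pmf l)) A\<bar> \<le> D * g n"
    using C(2) C2(2) v_thr_large[OF k, of t, folded v_def]
  proof (eventually_elim, intro allI)
    fix n :: nat and A
    assume lnL: "1 \<le> ln (ln (real n))" and L2: "2 \<le> ln (real n)"
      and g1: "1 / ln (real n) \<le> g n" and g2: "ln (real n) / real n \<le> g n"
      and g3: "ln (real n) ^ 2 * exp (- ln (real n) / 8) \<le> g n" and g4: "ln (real n) * exp (- (b / 8) * ln (real n)) \<le> g n"
      and small: "4 / \<kappa> * ln (ln (real n)) \<le> ln (real n) / (2 * c_plus)"
      and ve: "2 * ln (real n) / real n < c_minus * (1 / ln (real n)) ^ CARD('d)"
      and Cn: "\<forall>m a. m \<le> n \<and> n \<le> m + 2 \<and> a \<le> k \<longrightarrow> real n * binom_cdf m (v n) a \<le> C * (ln (real n) ^ a / ln (real n) ^ k)"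
      and lim: "\<bar>l - real n * binom_cdf (n - 1) (v n) k\<bar> \<le> C2 * \<bar>g n\<bar>"
      and vn: "1 < ln (real n) \<and> ln (real n) / 2 \<le> real n * v n \<and> real n * v n \<le> 2 * ln (real n)
         \<and> 0 < v n \<and> v n \<le> 1 / 2 \<and> 2 * k + 4 \<le> n"
    define L where "L = ln (real n)"
    let ?np = "real n * binom_cdf (n - 1) (v n) k"
    let ?d = "\<bar>\<P>(X in PiM {1..n} (\<lambda>_. \<mu>). C_count \<mu> t X n k \<in> A) - measure (measure_pmf (poisson_pmf l)) A\<bar>"
    \<comment> \<open>\<open>\<kappa> * \<tau>\<close> is the mass guaranteed for the difference of
      two balls beyond the cutoff; \<open>n * \<kappa> * \<tau> = 4 * ln L\<close> is the value that
      \<open>err_term_le\<close> asks of \<open>n * w1\<close>.\<close>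
    define \<tau> where "\<tau> = 4 / \<kappa> * ln L / real n"
    have n0: "0 < real n" using vn by auto
    have \<tau>0: "0 \<le> \<tau>" using pos lnL n0 by (simp add: \<tau>_def L_def)
    \<comment> \<open>With this the minimum in the parameter \<open>w1\<close> of the ball system is
      \<open>\<tau>\<close>.\<close>
    have \<tau>v: "\<tau> \<le> v n / c_plus"
    proof -
      have "4 / \<kappa> * ln L \<le> real n * v n / c_plus"
      proof -
        have "L / (2 * c_plus) \<le> real n * v n / c_plus"
          using vn c_plus_pos by (simp add: L_def field_simps)
        thus ?thesis using small unfolding L_def by linarith
      qed
      hence "4 / \<kappa> * ln L \<le> v n / c_plus * real n" by (simp add: mult.commute)
      thus ?thesis unfolding \<tau>_def by (simp only: pos_divide_le_eq[OF n0])
    qed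
    have "v n \<le> 2 * L / real n" using vn n0 by (simp add: L_def field_simps)
    hence v: "v n < c_minus * (1 / L) ^ CARD('d)" using ve by (simp add: L_def)
    interpret B: ball_system \<mu> "mass_ball (v n)" "\<lambda>x. cball x (2 * root CARD('d) (v n / c_minus))"
      "\<lambda>x. cball x (root CARD('d) \<tau>)" "inner_cube (1 / L)" "v n" "c_plus * 2 ^ CARD('d) * (v n / c_minus)" "c_plus * \<tau>"
      "c_minus / 2 ^ CARD('d) * min \<tau> (v n / c_plus)" "c_minus / 2 ^ CARD('d) * (v n / c_plus)" k
      using vn v \<tau>0 by (intro ball_system_mass_ball) (auto simp: L_def)
    have q: "measure \<mu> (space \<mu> - inner_cube (1 / L)) \<le> cq * (1 / L)"
      using measure_compl_inner_cube[of "1 / L"] L2 by (simp add: cq_def L_def)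
    have Ck: "real n * binom_cdf m (v n) k \<le> C" if "m \<le> n" "n \<le> m + 2" for m
      using Cn[rule_format, of m k] that vn by auto
    have Ck1: "real n * binom_cdf (n - 2) (v n) (k - 1) \<le> C / L"
    proof -
      have "ln (real n) ^ k = ln (real n) * ln (real n) ^ (k - 1)" using k by (simp flip: power_Suc)
      hence "ln (real n) ^ (k - 1) / ln (real n) ^ k = 1 / L" using vn by (simp add: L_def)
      moreover have "n - 2 \<le> n \<and> n \<le> n - 2 + 2 \<and> k - 1 \<le> k" by auto
      ultimately show ?thesis using Cn[rule_format, of "n - 2" "k - 1"] by simp
    qed
    have err: "real n * B.err_term (n - 1) \<le> K * g n"
      unfolding K_def
    proof (rule B.err_term_le[where L = L and b = b])
      show "real n * (c_plus * \<tau>) = c_plus * (4 / \<kappa> * ln L)" using n0 by (simp add: \<tau>_def)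
      show "real n * (c_minus / 2 ^ CARD('d) * min \<tau> (v n / c_plus)) = 4 * ln L"
        using \<tau>v n0 pos(1) by (simp add: \<tau>_def min_absorb1 flip: \<kappa>_def)
      show "c_minus / 2 ^ CARD('d) * (v n / c_plus) = b * v n" by (simp add: b_def \<kappa>_def)
      show "c_plus * 2 ^ CARD('d) * (v n / c_minus) = cu * v n" by (simp add: cu_def)
      show "real n * binom_cdf m (v n) k \<le> C" if "m \<le> n" "n \<le> m + 2" for m using Ck that .
    qed (use vn k lnL C(1) Ck1 pos c_plus_pos g1 g2 g3 g4 q in \<open>auto simp: L_def g_def\<close>)
    have gn: "0 \<le> g n" using lnL L2 by (simp add: g_def)
    have eqC: "C_count \<mu> t X n k = card {i \<in> {1..n}. cnt ({1..n} - {i}) X (mass_ball (v n) (X i)) < k}" for X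
      unfolding v_def using k vn by (intro C_count_eq_card) auto
    have "?d
      \<le> exp l * (\<bar>l - ?np\<bar> + real n * B.err_term (n - 1))
        + ?np * measure \<mu> (space \<mu> - inner_cube (1 / L))"
      unfolding eqC using B.count_poisson[OF k, of "{1..n}" l A] by (simp add: l_def)
    also have "\<dots> \<le> exp l * (C2 * g n + K * g n) + C * (cq * g n)"
    proof (rule add_mono)
      have "\<bar>l - ?np\<bar> \<le> C2 * g n" using lim gn by simp
      thus "exp l * (\<bar>l - ?np\<bar> + real n * B.err_term (n - 1)) \<le> exp l * (C2 * g n + K * g n)"
        by (intro mult_left_mono add_mono[OF _ err]) simp_all
      have "cq * (1 / L) \<le> cq * g n" using pos(4) g1 by (intro mult_left_mono) (auto simp: L_def)
      hence "measure \<mu> (space \<mu> - inner_cube (1 / L)) \<le> cq * g n" using q by linarith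
      moreover have "?np \<le> C" by (rule Ck) auto
      ultimately show "?np * measure \<mu> (space \<mu> - inner_cube (1 / L)) \<le> C * (cq * g n)"
        using C(1) by (intro mult_mono[of "?np"]) simp_all
    qed
    also have "\<dots> = D * g n" by (simp add: D_def algebra_simps)
    finally show "?d \<le> D * g n" .
  qed
  thus thesis unfolding l_def g_def by (rule that)
qed

end

theorem theorem1p2:
  fixes M :: "'w measure"
    and X :: "nat \<Rightarrow> 'w \<Rightarrow> real ^ 'd"
    and \<mu> :: "(real ^ 'd) measure"
    and f :: "real ^ 'd \<Rightarrow> real"
    and f_minus f_plus t :: real
    and k :: nat
    and N :: "'z measure"
    and Z :: "'z \<Rightarrow> nat"
  assumes "prob_space M"
    and "prob_space.indep_vars M (\<lambda>_. borel) X {1..}"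
    and "\<And>i. i \<ge> 1 \<Longrightarrow> distr M borel (X i) = \<mu>"
    and "f \<in> borel_measurable borel"
    and "\<And>x. f x \<ge> 0"
    and "\<And>A. A \<in> sets borel \<Longrightarrow> emeasure \<mu> A = (\<integral>\<^sup>+x\<in>A. ennreal (f x) \<partial>lborel)"
    and "msupport \<mu> = cbox 0 1"
    and "f_minus > 0" and "f_plus > 0"
    and "\<And>x. x \<in> cbox 0 1 \<Longrightarrow> f_minus \<le> f x \<and> f x \<le> f_plus"
    and "k \<ge> 1"
    and "prob_space N"
    and "Z \<in> measurable N (count_space UNIV)"
    and "distr N (count_space UNIV) Z = measure_pmf (poisson_pmf (exp (- t)))"
  shows "(\<lambda>n. dTV M (\<lambda>\<omega>. C_count \<mu> t (\<lambda>i. X i \<omega>) n k) N Z)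
           \<in> O(\<lambda>n. ln (ln (real n)) / ln (real n))"
proof -
  interpret M: prob_space M by fact
  interpret N: prob_space N by fact
  have Xm: "X i \<in> measurable M borel" if "i \<ge> 1" for i
    using assms(2) that unfolding M.indep_vars_def by auto
  have \<mu>1: "distr M borel (X 1) = \<mu>" using assms(3) by simp
  have "prob_space \<mu>" unfolding \<mu>1[symmetric] using Xm by (intro M.prob_space_distr) auto
  moreover have "sets \<mu> = sets borel" unfolding \<mu>1[symmetric] by simp
  ultimately have "cube_density \<mu> f f_minus f_plus"
    by (rule cube_density.intro[OF _ cube_density_axioms.intro]) fact+
  then interpret cube_density \<mu> f f_minus f_plus .
  let ?P = "\<lambda>n. PiM {1..n} (\<lambda>_. \<mu>)"
  obtain D where D: "\<forall>\<^sub>F n in sequentially. \<forall>A.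
    \<bar>\<P>(X in ?P n. C_count \<mu> t X n k \<in> A)
       - measure (measure_pmf (poisson_pmf (exp (- t)))) A\<bar> \<le> D * (ln (ln (real n)) / ln (real n))"
    by (rule C_count_poisson[OF assms(11)])
  have Zp: "\<P>(\<omega> in N. Z \<omega> \<in> A) = measure (measure_pmf (poisson_pmf (exp (- t)))) A" for A
  proof -
    have "measure (distr N (count_space UNIV) Z) A = measure N (Z -` A \<inter> space N)"
      using assms(13) by (intro measure_distr) auto
    moreover have "Z -` A \<inter> space N = {\<omega> \<in> space N. Z \<omega> \<in> A}" by auto
    ultimately show ?thesis unfolding assms(14) by simp
  qed
  \<comment> \<open>Independence and the common law give the first \<open>n\<close> variables the
    law \<open>?P n\<close>. \<open>k < n\<close> allows the count to be rewritten through
    \<open>mass_ball\<close>, which gives its measurability under \<open>?P n\<close>.\<close>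
  have Cp: "\<P>(\<omega> in M. C_count \<mu> t (\<lambda>i. X i \<omega>) n k \<in> A)
      = \<P>(X in ?P n. C_count \<mu> t X n k \<in> A)" if n: "k < n" for n A
  proof -
    let ?X = "\<lambda>\<omega>. \<lambda>i\<in>{1..n}. X i \<omega>"
    have ind: "M.indep_vars (\<lambda>_. borel) X {1..n}"
      using assms(2) by (rule M.indep_vars_subset) auto
    have "distr M (PiM {1..n} (\<lambda>_. borel)) ?X = PiM {1..n} (\<lambda>i. distr M borel (X i))"
      using M.indep_vars_iff_distr_eq_PiM'[of "{1..n}" X "\<lambda>_. borel"] ind Xm n by auto
    also have "\<dots> = ?P n" using assms(3) by (intro PiM_cong) auto
    finally have dist: "distr M (PiM {1..n} (\<lambda>_. borel)) ?X = ?P n" .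
    have Xmeas: "?X \<in> measurable M (PiM {1..n} (\<lambda>_. borel))"
      using Xm by (intro measurable_restrict) auto
    have eqC: "C_count \<mu> t x n k = card {i \<in> {1..n}. cnt ({1..n} - {i}) x (mass_ball (v_thr t n k) (x i)) < k}" for x
      using assms(11) n by (intro C_count_eq_card) auto
    have [measurable]: "(\<lambda>x. C_count \<mu> t x n k) \<in> measurable (?P n) (count_space UNIV)"
      unfolding eqC by (intro measurable_card_pred pred_cnt_pair[OF pred_mass_ball refl]) auto
    have S: "{x \<in> space (?P n). C_count \<mu> t x n k \<in> A} \<in> sets (?P n)" by measurable
    have sets_eq: "sets (PiM {1..n} (\<lambda>_. borel)) = sets (?P n)"
      using sets_\<mu> by (intro sets_PiM_cong) auto
    have S': "{x \<in> space (?P n). C_count \<mu> t x n k \<in> A} \<in> sets (PiM {1..n} (\<lambda>_. borel))"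
      unfolding sets_eq by (rule S)
    have "\<P>(x in ?P n. C_count \<mu> t x n k \<in> A)
      = measure M (?X -` {x \<in> space (?P n). C_count \<mu> t x n k \<in> A} \<inter> space M)"
      using measure_distr[OF Xmeas S'] unfolding dist .
    also have "?X -` {x \<in> space (?P n). C_count \<mu> t x n k \<in> A} \<inter> space M
       = {\<omega> \<in> space M. C_count \<mu> t (\<lambda>i. X i \<omega>) n k \<in> A}"
    proof -
      have "C_count \<mu> t (?X \<omega>) n k = C_count \<mu> t (\<lambda>i. X i \<omega>) n k" for \<omega>
      proof -
        have "cnt ({1..n} - {i}) (?X \<omega>) B = cnt ({1..n} - {i}) (\<lambda>i. X i \<omega>) B" for i B
          by (rule cnt_cong) auto
        thus ?thesis unfolding eqC by (intro arg_cong[where f = card]) auto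
      qed
      moreover have "?X \<omega> \<in> space (?P n)" for \<omega> by (auto simp: space_PiM space_\<mu>)
      ultimately show ?thesis by auto
    qed
    finally show ?thesis ..
  qed
  have "\<forall>\<^sub>F n in sequentially. norm (dTV M (\<lambda>\<omega>. C_count \<mu> t (\<lambda>i. X i \<omega>) n k) N Z)
      \<le> (2 * D) * norm (ln (ln (real n)) / ln (real n))"
  proof -
    have "\<forall>\<^sub>F n::nat in sequentially. 0 \<le> ln (ln (real n)) / ln (real n)" by real_asymp
    moreover have "\<forall>\<^sub>F n in sequentially. k < n" by (rule eventually_gt_at_top)
    ultimately show ?thesis using D
    proof eventually_elim
      case (elim n)
      let ?d = "\<lambda>A. \<bar>\<P>(\<omega> in M. C_count \<mu> t (\<lambda>i. X i \<omega>) n k \<in> A) - \<P>(\<omega> in N. Z \<omega> \<in> A)\<bar>"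
      have le: "?d A \<le> D * (ln (ln (real n)) / ln (real n))" for A
        unfolding Cp[OF elim(2)] Zp using elim(3) by blast
      define r where "r = ln (ln (real n)) / ln (real n)"
      \<comment> \<open>The bound is uniform in \<open>A\<close> and passes to the supremum. The
        value at \<open>{}\<close> shows that the supremum is nonnegative, so its norm is the
        supremum itself.\<close>
      define S where "S = (SUP A. ?d A)"
      have "S \<le> D * r"
        unfolding S_def r_def by (rule cSUP_least) (simp, rule le)
      moreover have "?d {} \<le> S" unfolding S_def
      proof (rule cSUP_upper)
        show "bdd_above (range ?d)" by (rule bdd_aboveI2) (rule le)
      qed simp
      moreover have "0 \<le> ?d {}" by (rule abs_ge_zero)
      ultimately have "norm (2 * S) \<le> 2 * D * norm r" using elim(1)[folded r_def] by simp
      thus ?case unfolding dTV_def S_def r_def .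
    qed
  qed
  thus ?thesis by (rule bigoI)
qed

end
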